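(* Assume the standing conditions on $F$ and $\sigma$ written out in the context. Then there exists a $\mathrm{P}$-pullback attractor $\mathcal{A}=\{\mathcal{A}(\omega^-)\}_{\omega^-\in\mathcal{B}}$ for the stochastic dynamical system $\varphi$ generated by the SDE $dY_t=F(Y_t)\,dt+\sigma\,dB^H_t$, $Y_0=x\in\mathbb{R}^d$.
   Context: **Noise.** Fix $d\ge1$, $H\in(0,1)$. For $h\in(0,1)$ let $\mathcal{B}_h$ be the closure of $C_0^\infty(\mathbb{R}^-,\mathbb{R}^d)$ (smooth compactly supported $\omega:\mathbb{R}^-=(-\infty,0]\to\mathbb{R}^d$ with $\omega(0)=0$) under $\|\omega\|_{\mathcal{B}_h}:=\sup_{s,t\in\mathbb{R}^-}\frac{|\omega(t)-\omega(s)|}{\sqrt{1+|t|+|s|}\,|t-s|^{(1-h)/2}}$ (a separable Banach space), and write $\mathcal{B}:=\mathcal{B}_H$. $\mathbf{P}$ is the Gaussian measure on $\mathcal{B}$ under which the canonical process is a time-reversed Brownian motion. $\mathcal{D}_H:\mathcal{B}_H\to\mathcal{B}_{1-H}$ is the continuous extension of $\mathcal{D}_H\omega(t)=\frac1{\alpha_H}\int_{-\infty}^0(-r)^{H-1/2}(\dot\omega(t+r)-\dot\omega(r))\,dr$, where $\alpha_H$ is the normalizing constant for which the canonical process under $(\mathcal{D}_H)_*\mathbf{P}$ is a time-reversed fractional Brownian motion with Hurst parameter $H$. For $t\ge0$ put $\vartheta_t\omega(s):=\omega(s-t)-\omega(-t)$ ($s\le0$) and $P_t(\omega^-,\omega^+)(s):=\omega^+(-s-t)-\omega^+(-t)$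 for $-t\le s\le0$, $:=\omega^-(s+t)-\omega^+(-t)$ for $s\le-t$. Let $\Omega:=\mathcal{B}\times\mathcal{B}$, $\mathbb{P}:=\mathbf{P}\times\mathbf{P}$, $\theta_t(\omega^-,\omega^+):=(P_t(\omega^-,\omega^+),\vartheta_t\omega^+)$ for $t\ge0$ and $\theta_t(\omega^-,\omega^+):=(\vartheta_{-t}\omega^-,P_{-t}(\omega^+,\omega^-))$ for $t<0$. Then $B^H_t(\omega):=-(\mathcal{D}_HP_t(\omega^-,\omega^+))(-t)$, $t\ge0$, is a fractional Brownian motion under $\mathbb{P}$. **SDE and standing conditions.** Consider $dY_t=F(Y_t)\,dt+\sigma\,dB^H_t$, $Y_0=x\in\mathbb{R}^d$, with: (1) $\sigma$ an invertible $d\times d$ matrix; (2) for some $C_1^F,C_2^F,C_3^F>0$ and all $\xi_1,\xi_2\in\mathbb{R}^d$, $\langle F(\xi_2)-F(\xi_1),\xi_2-\xi_1\rangle\le\min\{C_1^F-C_2^F|\xi_2-\xi_1|^2,\;C_3^F|\xi_2-\xi_1|^2\}$; (3) $F$ is differentiable and for some $C_F>0$, $N\ge1$: $|F(\xi)|\le C_F(1+|\xi|)^N$ and $|D_\xi F|\le C_F(1+|\xi|)^N$ for all $\xi$; (4) if $H>1/2$, the derivative of $F$ is globally bounded. Let $\Phi^t_\omega(x)$ be the solution: $\Phi^t_\omega(x)=x+\int_0^tF(\Phi^s_\omega(x))\,ds+\sigma B^H_t(\omega)$. Set $\varphi^t_{\omega^-}(x):=\Phi^t_{\theta_{-t}(\omega^-,\omega^+)}(x)$,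 which depends only on $\omega^-$; then $\Phi^t_{(\omega^-,\omega^+)}(x)=\varphi^t_{P_t(\omega^-,\omega^+)}(x)$. **$\mathrm{P}$-pullback attractor.** A random compact set is a family $\{\mathcal{A}(\omega^-)\}_{\omega^-\in\mathcal{B}}$ of non-empty subsets of $\mathbb{R}^d$ such that with probability one each $\mathcal{A}(\omega^-)$ is compact and $\omega^-\mapsto d(x,\mathcal{A}(\omega^-))$ is measurable for each $x\in\mathbb{R}^d$. It is a $\mathrm{P}$-pullback attractor for $\varphi$ if (i) for every $\omega^-,\omega^+\in\mathcal{B}$ (and $t\ge0$), $\Phi^t_{(\omega^-,\omega^+)}(\mathcal{A}(\omega^-))=\mathcal{A}(P_t(\omega^-,\omega^+))$; and (ii) for every compact $K\subset\mathbb{R}^d$, $\lim_{t\to\infty}\sup_{x\in K}d(\varphi^t_{\omega^-}(x),\mathcal{A}(\omega^-))=0$ $\mathbf{P}$-a.s. *)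

theory Defs
  imports "HOL-Probability.Probability"
begin

text \<open>
  A path on the half-line \<open>{..0}\<close> that vanishes at \<open>0\<close> is represented by a function on all of
  \<open>real\<close> that is extended by \<open>0\<close> to positive times, so that equality of paths is equality of
  functions.
\<close>

type_synonym 'd path = "real \<Rightarrow> real ^ 'd"

text \<open>Derivatives at the end point \<open>0\<close> are one-sided.\<close>

definition smooth_neg :: "'d::finite path \<Rightarrow> bool" where
  "smooth_neg \<omega> \<longleftrightarrow>
     (\<exists>D :: nat \<Rightarrow> 'd path. (\<forall>t\<le>0. D 0 t = \<omega> t) \<and>
        (\<forall>n. \<forall>t\<le>0. (D n has_vector_derivative D (Suc n) t) (at t within {..0})))"

definition C0_inf :: "'d::finite path set" where
  "C0_inf = {\<omega>. smooth_neg \<omega> \<and> (\<exists>M. \<forall>t\<le>-M. \<omega> t = 0) \<and> (\<forall>t\<ge>0. \<omega> t = 0)}"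

text \<open>On the diagonal \<open>s = t\<close> the quotient is \<open>0 / 0 = 0\<close>, hence harmless.\<close>

definition B_norm :: "real \<Rightarrow> 'd::finite path \<Rightarrow> ennreal" where
  "B_norm h \<omega> = (SUP s\<in>{..0}. SUP t\<in>{..0}.
     ennreal (norm (\<omega> t - \<omega> s) / (sqrt (1 + \<bar>t\<bar> + \<bar>s\<bar>) * \<bar>t - s\<bar> powr ((1 - h) / 2))))"

text \<open>
  The norm dominates point values of paths vanishing at \<open>0\<close>, so the abstract closure of
  \<^const>\<open>C0_inf\<close> is realised by functions.
\<close>

definition B_space :: "real \<Rightarrow> 'd::finite path set" where
  "B_space h = {\<omega>. (\<forall>t\<ge>0. \<omega> t = 0) \<and> (\<forall>\<epsilon>>0. \<exists>\<phi>\<in>C0_inf. B_norm h (\<lambda>t. \<omega> t - \<phi> t) < \<epsilon>)}"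

definition B_dist :: "real \<Rightarrow> 'd::finite path \<Rightarrow> 'd path \<Rightarrow> real" where
  "B_dist h \<omega> \<eta> = enn2real (B_norm h (\<lambda>t. \<omega> t - \<eta> t))"

definition B_top :: "real \<Rightarrow> 'd::finite path topology" where
  "B_top h = Metric_space.mtopology (B_space h) (B_dist h)"

definition B_borel :: "real \<Rightarrow> 'd::finite path measure" where
  "B_borel h = sigma (B_space h) {U. openin (B_top h) U}"

text \<open>The degenerate law (variance \<open>0\<close>) counts as Gaussian.\<close>

definition centered_gaussian :: "'w measure \<Rightarrow> ('w \<Rightarrow> real) \<Rightarrow> bool" where
  "centered_gaussian M X \<longleftrightarrow>
     X \<in> borel_measurable M \<and>
     ((AE w in M. X w = 0) \<or> (\<exists>s>0. distributed M lborel X (normal_density 0 s)))"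

text \<open>
  The components of the process are independent copies of a real-valued centered Gaussian process
  with covariance function \<open>R\<close>.
\<close>

definition centered_gaussian_process ::
  "'w measure \<Rightarrow> real set \<Rightarrow> (real \<Rightarrow> 'w \<Rightarrow> real ^ 'd::finite) \<Rightarrow> (real \<Rightarrow> real \<Rightarrow> real) \<Rightarrow> bool" where
  "centered_gaussian_process M T X R \<longleftrightarrow>
     (\<forall>J c. finite J \<and> J \<subseteq> T \<longrightarrow> centered_gaussian M (\<lambda>w. \<Sum>t\<in>J. c t \<bullet> X t w)) \<and>
     (\<forall>s\<in>T. \<forall>t\<in>T. \<forall>i j. integral\<^sup>L M (\<lambda>w. X s w $ i * X t w $ j) = (if i = j then R s t else 0))"

definition reversed_BM :: "'w measure \<Rightarrow> (real \<Rightarrow> 'w \<Rightarrow> real ^ 'd::finite) \<Rightarrow> bool" where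
  "reversed_BM M X \<longleftrightarrow> centered_gaussian_process M {..0} X (\<lambda>s t. min \<bar>s\<bar> \<bar>t\<bar>) \<and>
     (AE w in M. continuous_on {..0} (\<lambda>t. X t w))"

definition reversed_fBM :: "real \<Rightarrow> 'w measure \<Rightarrow> (real \<Rightarrow> 'w \<Rightarrow> real ^ 'd::finite) \<Rightarrow> bool" where
  "reversed_fBM H M X \<longleftrightarrow>
     centered_gaussian_process M {..0} X
       (\<lambda>s t. (\<bar>s\<bar> powr (2 * H) + \<bar>t\<bar> powr (2 * H) - \<bar>t - s\<bar> powr (2 * H)) / 2) \<and>
     (AE w in M. continuous_on {..0} (\<lambda>t. X t w))"

text \<open>
  The Borel sets of the separable space are generated by the evaluations, so this determines the
  measure uniquely.
\<close>

definition wiener_measure :: "real \<Rightarrow> 'd::finite path measure \<Rightarrow> bool" where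
  "wiener_measure H P \<longleftrightarrow>
     prob_space P \<and> sets P = sets (B_borel H) \<and> reversed_BM P (\<lambda>t \<omega>. \<omega> t)"

definition D_int :: "real \<Rightarrow> real \<Rightarrow> 'd::finite path \<Rightarrow> 'd path" where
  "D_int H \<alpha> \<omega> t =
     (if t \<le> 0
      then (1 / \<alpha>) *\<^sub>R integral {..0} (\<lambda>r. (- r) powr (H - 1 / 2) *\<^sub>R
             (vector_derivative \<omega> (at (t + r) within {..0}) -
              vector_derivative \<omega> (at r within {..0})))
      else 0)"

text \<open>
  By density of \<^const>\<open>C0_inf\<close> the continuous extension is determined on \<^term>\<open>B_space H\<close>; the last
  condition (with \<open>\<alpha> > 0\<close>) determines the normalizing constant \<open>\<alpha>\<close>.
\<close>

definition is_D_op ::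
  "real \<Rightarrow> 'd::finite path measure \<Rightarrow> real \<Rightarrow> ('d path \<Rightarrow> 'd path) \<Rightarrow> bool" where
  "is_D_op H P \<alpha> D \<longleftrightarrow>
     \<alpha> > 0 \<and>
     continuous_map (B_top H) (B_top (1 - H)) D \<and>
     (\<forall>\<omega>\<in>C0_inf. D \<omega> = D_int H \<alpha> \<omega>) \<and>
     reversed_fBM H (distr P (B_borel (1 - H)) D) (\<lambda>t \<eta>. \<eta> t)"

definition path_shift :: "real \<Rightarrow> 'd::finite path \<Rightarrow> 'd path" where
  "path_shift t \<omega> s = (if s \<le> 0 then \<omega> (s - t) - \<omega> (- t) else 0)"

fun P_op :: "real \<Rightarrow> 'd::finite path \<times> 'd path \<Rightarrow> 'd path" where
  "P_op t (\<omega>m, \<omega>p) s =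
     (if s > 0 then 0
      else if - t \<le> s then \<omega>p (- s - t) - \<omega>p (- t)
      else \<omega>m (s + t) - \<omega>p (- t))"

fun theta :: "real \<Rightarrow> 'd::finite path \<times> 'd path \<Rightarrow> 'd path \<times> 'd path" where
  "theta t (\<omega>m, \<omega>p) =
     (if t \<ge> 0 then (P_op t (\<omega>m, \<omega>p), path_shift t \<omega>p)
      else (path_shift (- t) \<omega>m, P_op (- t) (\<omega>p, \<omega>m)))"

definition fBM :: "('d::finite path \<Rightarrow> 'd path) \<Rightarrow> real \<Rightarrow> 'd path \<times> 'd path \<Rightarrow> real ^ 'd" where
  "fBM D t \<omega> = - D (P_op t \<omega>) (- t)"

definition sde_solution ::
  "('d::finite path \<Rightarrow> 'd path) \<Rightarrow> (real ^ 'd \<Rightarrow> real ^ 'd) \<Rightarrow> real ^ 'd ^ 'd \<Rightarrow>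
   'd path \<times> 'd path \<Rightarrow> real ^ 'd \<Rightarrow> 'd path \<Rightarrow> bool" where
  "sde_solution D F \<sigma> \<omega> x u \<longleftrightarrow>
     continuous_on {0..} u \<and>
     (\<forall>t\<ge>0. u t = x + integral {0..t} (\<lambda>s. F (u s)) + \<sigma> *v fBM D t \<omega>)"

definition Phi ::
  "('d::finite path \<Rightarrow> 'd path) \<Rightarrow> (real ^ 'd \<Rightarrow> real ^ 'd) \<Rightarrow> real ^ 'd ^ 'd \<Rightarrow>
   real \<Rightarrow> 'd path \<times> 'd path \<Rightarrow> real ^ 'd \<Rightarrow> real ^ 'd" where
  "Phi D F \<sigma> t \<omega> x = (THE y. \<exists>u. sde_solution D F \<sigma> \<omega> x u \<and> u t = y)"

text \<open>
  The right-hand side does not depend on the second component of the noise pair (for \<open>s \<le> t\<close> the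
  path \<open>P_op s (theta (- t) (\<omega>m, \<omega>p))\<close> does not involve \<open>\<omega>p\<close>), so that component is
  set to the zero path.
\<close>

definition phi ::
  "('d::finite path \<Rightarrow> 'd path) \<Rightarrow> (real ^ 'd \<Rightarrow> real ^ 'd) \<Rightarrow> real ^ 'd ^ 'd \<Rightarrow>
   real \<Rightarrow> 'd path \<Rightarrow> real ^ 'd \<Rightarrow> real ^ 'd" where
  "phi D F \<sigma> t \<omega>m x = Phi D F \<sigma> t (theta (- t) (\<omega>m, \<lambda>_. 0)) x"

definition random_compact_set ::
  "'d::finite path measure \<Rightarrow> ('d path \<Rightarrow> (real ^ 'd) set) \<Rightarrow> bool" where
  "random_compact_set P A \<longleftrightarrow>
     (\<forall>\<omega>m\<in>space P. A \<omega>m \<noteq> {}) \<and>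
     (AE \<omega>m in P. compact (A \<omega>m)) \<and>
     (\<forall>x. (\<lambda>\<omega>m. infdist x (A \<omega>m)) \<in> borel_measurable P)"

text \<open>The supremum is taken in \<^typ>\<open>ennreal\<close>, so that it is meaningful without a boundedness proof.\<close>

definition P_pullback_attractor ::
  "'d::finite path measure \<Rightarrow>
   (real \<Rightarrow> 'd path \<times> 'd path \<Rightarrow> real ^ 'd \<Rightarrow> real ^ 'd) \<Rightarrow>
   (real \<Rightarrow> 'd path \<Rightarrow> real ^ 'd \<Rightarrow> real ^ 'd) \<Rightarrow>
   ('d path \<Rightarrow> (real ^ 'd) set) \<Rightarrow> bool" where
  "P_pullback_attractor P \<Phi> \<phi> A \<longleftrightarrow>
     random_compact_set P A \<and>
     (\<forall>\<omega>m\<in>space P. \<forall>\<omega>p\<in>space P. \<forall>t\<ge>0.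
        \<Phi> t (\<omega>m, \<omega>p) ` A \<omega>m = A (P_op t (\<omega>m, \<omega>p))) \<and>
     (\<forall>K. compact K \<longrightarrow>
        (AE \<omega>m in P. ((\<lambda>t. SUP x\<in>K. ennreal (infdist (\<phi> t \<omega>m x) (A \<omega>m))) \<longlongrightarrow> 0) at_top))"

end

theory Submission
  imports Defs
begin

text \<open>
  Every \<open>\<omega> \<in> B_space H\<close>, not only almost every one, admits a pullback attractor: \<open>D \<omega>\<close> is continuous
  and grows at most linearly. Write \<open>\<zeta> = \<sigma> *v D \<omega>\<close>. A solution \<open>u\<close> started at time \<open>- T\<close> and driven by
  the increments of \<open>\<zeta>\<close> makes \<open>u - \<zeta>\<close> differentiable with derivative \<open>F u\<close>, and dissipativity gives
  \<open>(|u - \<zeta>|\<^sup>2)' \<le> - C2 |u - \<zeta>|\<^sup>2 + 2 C1 + |F \<zeta>|\<^sup>2 / C2\<close>. The polynomial growth of \<open>F \<circ> \<zeta>\<close> loses against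
  the exponential rate \<open>C2\<close>, so at time \<open>0\<close> all solutions started in a ball in the distant past lie in
  a ball whose radius depends on \<open>\<zeta>\<close> only. The attractor is the closure of the union of the
  \<open>\<omega>\<close>-limit sets of balls. Invariance follows from the cocycle property, which rests on \<open>D\<close> commuting
  with the shift of paths. As the flow depends continuously on the path, the distance to the union of
  all solutions started in a ball before time \<open>- n\<close> is upper semicontinuous, whence measurability.
\<close>

section \<open>The path spaces\<close>

text \<open>The invariance clause quantifies over every pair of paths, so no null set can be
  discarded and absorption has to be deterministic. It comes from the weight of the norm: taken
  against time 0 it is at most \<open>1 + \<bar>t\<bar>\<close>, whatever the Hurst parameter. A
  second obstacle is that \<open>D\<close> has an integral formula only on \<open>C0_inf\<close>,
  while \<open>path_shift\<close> turns a compactly supported path into one that is a possibly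
  nonzero constant near minus infinity, and \<open>P_op\<close> may create a kink. The work on path
  spaces is therefore density: slowly varying cutoffs remove constants at infinity and a factor
  \<open>exp (\<epsilon> / t)\<close> removes kinks, both at small cost in norm. Once
  \<open>D\<close> commutes with \<open>path_shift\<close>, the equation on \<open>{0..T}\<close> is
  driven by increments of the one path \<open>D (P_op T (\<omega>m, \<omega>p))\<close> and becomes
  an ordinary equation with continuous forcing. The one-sided Lipschitz bound gives uniqueness and
  continuous dependence, the dissipative bound gives global existence and absorption.\<close>

lemma B_norm_leI:
  assumes "c \<ge> 0"
    and "\<And>s t. s \<le> 0 \<Longrightarrow> t \<le> 0 \<Longrightarrow>
      norm (\<omega> t - \<omega> s) \<le> c * (sqrt (1 + \<bar>t\<bar> + \<bar>s\<bar>) * \<bar>t - s\<bar> powr ((1 - h) / 2))"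
  shows "B_norm h \<omega> \<le> ennreal c"
  unfolding B_norm_def
proof (intro SUP_least ennreal_leI)
  fix s t :: real assume "s \<in> {..0}" "t \<in> {..0}"
  then have *: "norm (\<omega> t - \<omega> s) \<le> c * (sqrt (1 + \<bar>t\<bar> + \<bar>s\<bar>) * \<bar>t - s\<bar> powr ((1 - h) / 2))"
    using assms by auto
  show "norm (\<omega> t - \<omega> s) / (sqrt (1 + \<bar>t\<bar> + \<bar>s\<bar>) * \<bar>t - s\<bar> powr ((1 - h) / 2)) \<le> c"
  proof (cases "s = t")
    case False
    then show ?thesis using * by (subst pos_divide_le_eq) (auto intro!: mult_pos_pos)
  qed (use assms in auto)
qed

lemma B_norm_leD:
  assumes "B_norm h \<omega> \<le> ennreal c" "c \<ge> 0" "s \<le> 0" "t \<le> 0"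
  shows "norm (\<omega> t - \<omega> s) \<le> c * (sqrt (1 + \<bar>t\<bar> + \<bar>s\<bar>) * \<bar>t - s\<bar> powr ((1 - h) / 2))"
proof (cases "s = t")
  case False
  have "ennreal (norm (\<omega> t - \<omega> s) / (sqrt (1 + \<bar>t\<bar> + \<bar>s\<bar>) * \<bar>t - s\<bar> powr ((1 - h) / 2))) \<le> B_norm h \<omega>"
    unfolding B_norm_def using assms(3,4) by (intro SUP_upper2[of s] SUP_upper2[of t]) auto
  also note assms(1)
  finally have "norm (\<omega> t - \<omega> s) / (sqrt (1 + \<bar>t\<bar> + \<bar>s\<bar>) * \<bar>t - s\<bar> powr ((1 - h) / 2)) \<le> c"
    using assms(2) by (simp add: ennreal_le_iff)
  then show ?thesis using False by (subst (asm) pos_divide_le_eq) (auto intro!: mult_pos_pos)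
qed auto

lemma B_norm_finite_bound:
  assumes "B_norm h \<omega> < \<infinity>" "s \<le> 0" "t \<le> 0"
  shows "norm (\<omega> t - \<omega> s) \<le>
    enn2real (B_norm h \<omega>) * (sqrt (1 + \<bar>t\<bar> + \<bar>s\<bar>) * \<bar>t - s\<bar> powr ((1 - h) / 2))"
  using assms by (intro B_norm_leD) (auto simp: ennreal_enn2real_if)

lemma B_norm_add: "B_norm h (\<lambda>t. f t + g t) \<le> B_norm h f + B_norm h g"
  unfolding B_norm_def[of h "\<lambda>t. f t + g t"]
proof (intro SUP_least)
  fix s t :: real assume st: "s \<in> {..0}" "t \<in> {..0}"
  let ?w = "sqrt (1 + \<bar>t\<bar> + \<bar>s\<bar>) * \<bar>t - s\<bar> powr ((1 - h) / 2)"
  have "norm (f t + g t - (f s + g s)) / ?w \<le> norm (f t - f s) / ?w + norm (g t - g s) / ?w"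
    unfolding add_divide_distrib[symmetric]
    by (intro divide_right_mono) (auto simp: add_diff_add norm_triangle_ineq)
  then have "ennreal (norm (f t + g t - (f s + g s)) / ?w)
      \<le> ennreal (norm (f t - f s) / ?w) + ennreal (norm (g t - g s) / ?w)"
    by (simp flip: ennreal_plus add: ennreal_leI)
  also have "\<dots> \<le> B_norm h f + B_norm h g"
    unfolding B_norm_def using st
    by (intro add_mono SUP_upper2[of s] SUP_upper2[of t]) auto
  finally show "ennreal (norm (f t + g t - (f s + g s)) / ?w) \<le> B_norm h f + B_norm h g" .
qed

lemma B_norm_diff_commute: "B_norm h (\<lambda>t. f t - g t) = B_norm h (\<lambda>t. g t - f t)"
proof -
  have "norm (f t - g t - (f s - g s)) = norm (g t - f t - (g s - f s))" for s t
    by (subst norm_minus_commute) (simp add: algebra_simps)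
  then show ?thesis unfolding B_norm_def by simp
qed

lemma B_norm_triangle: "B_norm h (\<lambda>t. f t - k t) \<le> B_norm h (\<lambda>t. f t - g t) + B_norm h (\<lambda>t. g t - k t)"
  using B_norm_add[of h "\<lambda>t. f t - g t" "\<lambda>t. g t - k t"] by simp

lemma B_norm_cong: "(\<And>t. t \<le> 0 \<Longrightarrow> f t = g t) \<Longrightarrow> B_norm h f = B_norm h g"
  unfolding B_norm_def by (intro SUP_cong) auto

text \<open>Splitting \<open>norm (f t - f s)\<close> into its powers with exponents
  \<open>(1 + h) / 2\<close> and \<open>(1 - h) / 2\<close> lets the oscillation control the first
  factor and the Lipschitz bound the second; the square-root weight is at least 1. The norm is thus
  small once one of \<open>M\<close>, \<open>L\<close> is small and the other stays bounded, which
  is how both density estimates below are obtained.\<close>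

lemma B_norm_interpolate:
  assumes h: "0 < h" "h < 1"
    and M: "\<And>s t. s \<le> 0 \<Longrightarrow> t \<le> 0 \<Longrightarrow> norm (f t - f s) \<le> M"
    and L: "\<And>s t. s \<le> 0 \<Longrightarrow> t \<le> 0 \<Longrightarrow> norm (f t - f s) \<le> L * \<bar>t - s\<bar>" and L0: "L \<ge> 0"
  shows "B_norm h f \<le> ennreal (M powr ((1 + h) / 2) * L powr ((1 - h) / 2))"
proof (rule B_norm_leI)
  fix s t :: real assume st: "s \<le> 0" "t \<le> 0"
  let ?x = "norm (f t - f s)" and ?a = "(1 - h) / 2"
  show "?x \<le> M powr ((1 + h) / 2) * L powr ?a * (sqrt (1 + \<bar>t\<bar> + \<bar>s\<bar>) * \<bar>t - s\<bar> powr ?a)"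
  proof (cases "?x = 0")
    case True
    then show ?thesis by simp
  next
    case False
    then have "?x = ?x powr ((1 + h) / 2) * ?x powr ?a"
      by (simp flip: powr_add add: field_simps)
    also have "\<dots> \<le> M powr ((1 + h) / 2) * (L * \<bar>t - s\<bar>) powr ?a"
      using h M[OF st] L[OF st] by (intro mult_mono powr_mono2) auto
    also have "\<dots> = M powr ((1 + h) / 2) * L powr ?a * (1 * \<bar>t - s\<bar> powr ?a)"
      using L0 by (simp add: powr_mult)
    also have "\<dots> \<le> M powr ((1 + h) / 2) * L powr ?a * (sqrt (1 + \<bar>t\<bar> + \<bar>s\<bar>) * \<bar>t - s\<bar> powr ?a)"
      by (intro mult_left_mono mult_right_mono) auto
    finally show ?thesis .
  qed
qed auto

section \<open>Mean value estimates and smooth functions on subsets of the line\<close>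

lemma norm_diff_le_of_vector_derivative:
  fixes f :: "real \<Rightarrow> 'a::real_normed_vector"
  assumes "convex S" "\<And>x. x \<in> S \<Longrightarrow> (f has_vector_derivative f' x) (at x within S)"
    and "\<And>x. x \<in> S \<Longrightarrow> norm (f' x) \<le> L" "s \<in> S" "t \<in> S"
  shows "norm (f t - f s) \<le> L * \<bar>t - s\<bar>"
proof -
  have "onorm (\<lambda>u. u *\<^sub>R f' x) \<le> L" if "x \<in> S" for x
    using assms(3)[OF that] norm_ge_zero[of "f' x"]
    by (intro onorm_bound) (auto simp: mult.commute[of "\<bar>_\<bar>"] intro!: mult_right_mono order_trans[OF norm_ge_zero assms(3)[OF that]])
  then show ?thesis
    using differentiable_bound[of S f "\<lambda>x u. u *\<^sub>R f' x" L t s] assms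
    by (auto simp: has_vector_derivative_def)
qed

lemma continuous_on_Icc_bound:
  fixes f :: "real \<Rightarrow> 'a::real_normed_vector"
  assumes "continuous_on {a..b} f"
  obtains M where "M \<ge> 0" "\<And>t. a \<le> t \<Longrightarrow> t \<le> b \<Longrightarrow> norm (f t) \<le> M"
proof -
  have "bounded (f ` {a..b})"
    by (intro compact_imp_bounded compact_continuous_image assms) auto
  then obtain M where "\<forall>x\<in>f ` {a..b}. norm x \<le> M"
    unfolding bounded_iff ..
  then show ?thesis by (intro that[of "max 0 M"]) (auto simp: le_max_iff_disj)
qed

definition smooth_on :: "real set \<Rightarrow> (real \<Rightarrow> 'a::real_normed_vector) \<Rightarrow> bool" where
  "smooth_on S f \<longleftrightarrow> (\<exists>D. (\<forall>t\<in>S. D 0 t = f t) \<and>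
     (\<forall>n::nat. \<forall>t\<in>S. (D n has_vector_derivative D (Suc n) t) (at t within S)))"

lemma smooth_neg_iff: "smooth_neg \<omega> \<longleftrightarrow> smooth_on {..0} \<omega>"
  unfolding smooth_neg_def smooth_on_def by (auto simp: Ball_def)

lemma smooth_on_derivative:
  assumes "smooth_on S f"
  obtains f' where "smooth_on S f'" "\<And>t. t \<in> S \<Longrightarrow> (f has_vector_derivative f' t) (at t within S)"
proof -
  from assms obtain D where D: "\<And>t. t \<in> S \<Longrightarrow> D 0 t = f t"
    "\<And>n t. t \<in> S \<Longrightarrow> (D n has_vector_derivative D (Suc n) t) (at t within S)"
    unfolding smooth_on_def by blast
  show ?thesis
  proof (rule that)
    show "smooth_on S (D 1)"
      unfolding smooth_on_def using D by (intro exI[of _ "\<lambda>n. D (Suc n)"]) auto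
    fix t assume t: "t \<in> S"
    then show "(f has_vector_derivative D 1 t) (at t within S)"
      using has_vector_derivative_transform[OF t D(1)[symmetric] D(2)[of t 0]] by simp
  qed
qed

text \<open>Coinduction: a class of functions closed under differentiation consists of smooth
  functions. Dependent choice builds the sequence of derivatives, so no closed formula for the n-th
  derivative has to be found.\<close>

lemma smooth_on_coinduct:
  assumes "Q f"
    and step: "\<And>f. Q f \<Longrightarrow> \<exists>f'. Q f' \<and> (\<forall>t\<in>S. (f has_vector_derivative f' t) (at t within S))"
  shows "smooth_on S f"
proof -
  have "\<exists>D. \<forall>n::nat. (Q (D n) \<and> (n = 0 \<longrightarrow> D n = f)) \<and>
      (\<forall>t\<in>S. (D n has_vector_derivative D (Suc n) t) (at t within S))"
    by (rule dependent_nat_choice) (use assms in auto)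
  then show ?thesis unfolding smooth_on_def by metis
qed

lemma smooth_on_cong:
  assumes "smooth_on S f" "\<And>t. t \<in> S \<Longrightarrow> f t = g t"
  shows "smooth_on S g"
  using assms unfolding smooth_on_def by auto

lemma smooth_on_const: "smooth_on S (\<lambda>_. c)"
  unfolding smooth_on_def
  by (intro exI[of _ "\<lambda>n _. if n = 0 then c else 0"]) (auto intro!: derivative_eq_intros)

lemma smooth_on_add:
  assumes "smooth_on S f" "smooth_on S g"
  shows "smooth_on S (\<lambda>t. f t + g t)"
proof (rule smooth_on_coinduct[where Q = "\<lambda>k. \<exists>f g. smooth_on S f \<and> smooth_on S g \<and> k = (\<lambda>t. f t + g t)"])
  fix k assume "\<exists>f g. smooth_on S f \<and> smooth_on S g \<and> k = (\<lambda>t. f t + g t)"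
  then obtain f g where *: "smooth_on S f" "smooth_on S g" and k: "k = (\<lambda>t. f t + g t)" by blast
  from smooth_on_derivative[OF *(1)] smooth_on_derivative[OF *(2)] obtain f' g' where
    "smooth_on S f'" "\<And>t. t \<in> S \<Longrightarrow> (f has_vector_derivative f' t) (at t within S)"
    "smooth_on S g'" "\<And>t. t \<in> S \<Longrightarrow> (g has_vector_derivative g' t) (at t within S)" by metis
  then show "\<exists>k'. (\<exists>f g. smooth_on S f \<and> smooth_on S g \<and> k' = (\<lambda>t. f t + g t)) \<and>
      (\<forall>t\<in>S. (k has_vector_derivative k' t) (at t within S))"
    unfolding k by (intro exI[of _ "\<lambda>t. f' t + g' t"]) (auto intro: has_vector_derivative_add)
qed (use assms in blast)

lemma smooth_on_linear:
  assumes "bounded_linear L" "smooth_on S f"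
  shows "smooth_on S (\<lambda>t. L (f t))"
proof -
  from assms(2) obtain D where "\<And>t. t \<in> S \<Longrightarrow> D 0 t = f t"
    "\<And>n t. t \<in> S \<Longrightarrow> (D n has_vector_derivative D (Suc n) t) (at t within S)"
    unfolding smooth_on_def by blast
  then show ?thesis
    unfolding smooth_on_def
    by (intro exI[of _ "\<lambda>n t. L (D n t)"])
       (auto intro: bounded_linear.has_vector_derivative[OF assms(1)])
qed

lemma smooth_on_affine:
  fixes a b :: real
  assumes "smooth_on S f" "\<And>t. t \<in> T \<Longrightarrow> a * t + b \<in> S"
  shows "smooth_on T (\<lambda>t. f (a * t + b))"
proof -
  from assms(1) obtain D where D: "\<And>t. t \<in> S \<Longrightarrow> D 0 t = f t"
    "\<And>n t. t \<in> S \<Longrightarrow> (D n has_vector_derivative D (Suc n) t) (at t within S)"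
    unfolding smooth_on_def by blast
  have "((\<lambda>t. a ^ n *\<^sub>R D n (a * t + b)) has_vector_derivative a ^ Suc n *\<^sub>R D (Suc n) (a * t + b))
      (at t within T)" if "t \<in> T" for n t
  proof -
    have *: "((\<lambda>t. a * t + b) has_vector_derivative a) (at t within T)"
      by (auto intro!: derivative_eq_intros)
    have "(D n has_vector_derivative D (Suc n) (a * t + b)) (at (a * t + b) within (\<lambda>t. a * t + b) ` T)"
      using assms(2) that by (intro has_vector_derivative_within_subset[OF D(2)]) auto
    from vector_diff_chain_within[OF * this]
    have "((\<lambda>t. D n (a * t + b)) has_vector_derivative a *\<^sub>R D (Suc n) (a * t + b)) (at t within T)"
      by (simp add: o_def)
    from bounded_linear.has_vector_derivative[OF bounded_linear_scaleR_right this, of "a ^ n"]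
    show ?thesis by (simp add: mult.commute)
  qed
  then show ?thesis unfolding smooth_on_def
    using D(1) assms(2) by (intro exI[of _ "\<lambda>n t. a ^ n *\<^sub>R D n (a * t + b)"]) simp
qed

lemma smooth_on_subset: "smooth_on S f \<Longrightarrow> T \<subseteq> S \<Longrightarrow> smooth_on T f"
  using smooth_on_affine[of S f T 1 0] by auto

lemma smooth_on_continuous: "smooth_on S f \<Longrightarrow> continuous_on S f"
  by (metis smooth_on_derivative has_vector_derivative_continuous continuous_on_eq_continuous_within)

section \<open>Functions that vanish to infinite order at 0\<close>

lemma has_vector_derivative_zero_at_flat_point:
  assumes "f x = 0" "\<And>y. dist y x < 1 \<Longrightarrow> norm (f y) \<le> C * (y - x)\<^sup>2"
  shows "(f has_vector_derivative 0) (at x)"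
  unfolding has_vector_derivative_def
proof (rule has_derivativeI_sandwich[where e = 1])
  show "((\<lambda>y. C * \<bar>y - x\<bar>) \<longlongrightarrow> 0) (at x)"
    by (auto intro!: tendsto_eq_intros)
  fix y assume "y \<in> UNIV" "y \<noteq> x" "dist y x < 1"
  then show "norm (f y - f x - (y - x) *\<^sub>R 0) / norm (y - x) \<le> C * \<bar>y - x\<bar>"
    using assms(1) assms(2)[of y] by (subst pos_divide_le_eq) (auto simp: power2_eq_square abs_mult_self_eq mult.assoc)
qed auto

text \<open>The left difference quotients at \<open>x\<close> see only the constant, and one-sided
  derivatives are unique. The case \<open>x = a\<close> matters: the function may start to move just
  to the right of \<open>a\<close>, as \<open>edge\<close> does at 0.\<close>

lemma has_vector_derivative_left_const:
  fixes f :: "real \<Rightarrow> 'a::real_normed_vector"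
  assumes "(f has_vector_derivative d) (at x within {..b})" "x \<le> a" "a \<le> b" "\<And>t. t \<le> a \<Longrightarrow> f t = c"
  shows "d = 0"
proof (rule vector_derivative_unique_within)
  show "at x within {..x} \<noteq> bot"
    using at_le[of "{..<x}" "{..x}" x] trivial_limit_at_left_real[of x] bot.extremum_uniqueI by fastforce
  show "(f has_vector_derivative d) (at x within {..x})"
    using assms(1) by (rule has_vector_derivative_within_subset) (use assms in auto)
  show "(f has_vector_derivative 0) (at x within {..x})"
    by (rule has_vector_derivative_transform[of _ _ _ "\<lambda>_. c"]) (use assms in auto)
qed

text \<open>Raise \<open>z \<le> exp z\<close> at \<open>z = x / Suc n\<close> to the power
  \<open>Suc n\<close>.\<close>

lemma power_le_exp: "x \<ge> 0 \<Longrightarrow> (x / real (Suc n)) ^ Suc n \<le> exp x"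
proof -
  assume "x \<ge> 0"
  have "(x / real (Suc n)) ^ Suc n \<le> exp (x / real (Suc n)) ^ Suc n"
    using \<open>x \<ge> 0\<close> exp_ge_add_one_self[of "x / real (Suc n)"]
    by (intro power_mono) (linarith, simp)
  also have "\<dots> = exp x"
    by (simp flip: exp_of_nat_mult del: power_Suc of_nat_Suc)
  finally show ?thesis .
qed

text \<open>The powers of \<open>inverse t\<close> make the class closed under derivatives; \<open>exp (\<epsilon> / t)\<close> dominates them as \<open>t\<close> tends to \<open>0\<close> from the left.\<close>

inductive flat_fun :: "real \<Rightarrow> (real \<Rightarrow> 'a::real_normed_vector) \<Rightarrow> bool" for \<epsilon> where
  flat_base: "smooth_on {..0} \<phi> \<Longrightarrow>
    flat_fun \<epsilon> (\<lambda>t. if t < 0 then (exp (\<epsilon> / t) * inverse t ^ k) *\<^sub>R \<phi> t else 0)"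
| flat_add: "flat_fun \<epsilon> f \<Longrightarrow> flat_fun \<epsilon> g \<Longrightarrow> flat_fun \<epsilon> (\<lambda>t. f t + g t)"

lemma flat_fun_derivative:
  assumes "flat_fun \<epsilon> f" "\<epsilon> > 0"
  shows "\<exists>f'. flat_fun \<epsilon> f' \<and> (\<forall>t. (f has_vector_derivative f' t) (at t))"
  using assms(1)
proof induction
  case (flat_base \<phi> k)
  from smooth_on_derivative[OF this] obtain \<phi>' where
    \<phi>': "smooth_on {..0} \<phi>'" "\<And>t. t \<le> 0 \<Longrightarrow> (\<phi> has_vector_derivative \<phi>' t) (at t within {..0})"
    by (metis atMost_iff)
  define B where "B = (\<lambda>k (\<phi> :: real \<Rightarrow> 'a) t. if t < 0 then (exp (\<epsilon> / t) * inverse t ^ k) *\<^sub>R \<phi> t else 0)"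
  \<comment> \<open>Product rule: the derivative of \<open>\<epsilon> / t\<close> contributes two
    more powers of \<open>inverse t\<close> and that of \<open>inverse t ^ k\<close> one more, so
    the sum stays in the class.\<close>
  define f' where "f' = (\<lambda>t. B k \<phi>' t + (B (k + 2) (\<lambda>t. (-\<epsilon>) *\<^sub>R \<phi> t) t + B (Suc k) (\<lambda>t. (- real k) *\<^sub>R \<phi> t) t))"
  have "flat_fun \<epsilon> f'"
    unfolding f'_def B_def
    using flat_base \<phi>'(1)
    by (intro flat_fun.intros smooth_on_linear[OF bounded_linear_scaleR_right])
  moreover have "(B k \<phi> has_vector_derivative f' t) (at t)" for t
  proof (cases "t < 0")
    case True
    have "at t within {..0} = at t"
      using True by (intro at_within_interior) simp
    then have d1: "(\<phi> has_vector_derivative \<phi>' t) (at t)"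
      using \<phi>'(2)[of t] True by (metis less_imp_le)
    have d2: "((\<lambda>t. exp (\<epsilon> / t) * inverse t ^ k) has_real_derivative
        exp (\<epsilon> / t) * (- \<epsilon> * inverse t ^ (k + 2) - real k * inverse t ^ Suc k)) (at t)"
      using True
      apply (auto intro!: derivative_eq_intros)
      apply (cases k)
       apply (auto simp: field_simps power2_eq_square)
      done
    have "((\<lambda>t. (exp (\<epsilon> / t) * inverse t ^ k) *\<^sub>R \<phi> t) has_vector_derivative f' t) (at t)"
      by (rule has_vector_derivative_eq_rhs[OF has_vector_derivative_scaleR[OF d2 d1]])
         (use True in \<open>simp add: f'_def B_def algebra_simps\<close>)
    then show ?thesis
      by (rule has_vector_derivative_transform_within_open[of _ _ _ "{..<0}"])
         (use True in \<open>auto simp: B_def\<close>)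
  next
    case nneg: False
    then have f'0: "f' t = 0" by (simp add: f'_def B_def)
    show ?thesis
    proof (cases "t = 0")
      case False
      have "((\<lambda>_. 0) has_vector_derivative (0::'a)) (at t)" by auto
      then show ?thesis unfolding f'0
        by (rule has_vector_derivative_transform_within_open[of _ _ _ "{0<..}"])
           (use nneg False in \<open>auto simp: B_def\<close>)
    next
      case True
      have "continuous_on {-1..0} \<phi>"
        by (rule continuous_on_subset[OF smooth_on_continuous[OF flat_base]]) auto
      then obtain M where M0: "M \<ge> 0" and M: "\<And>t. -1 \<le> t \<Longrightarrow> t \<le> 0 \<Longrightarrow> norm (\<phi> t) \<le> M"
        by (rule continuous_on_Icc_bound) (rule that)
      \<comment> \<open>The exponential is bounded by a multiple of the power
        \<open>Suc m = k + 2\<close>: after division by \<open>z ^ k\<close> a factor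
        \<open>z\<^sup>2\<close> is left, the quadratic bound that differentiability at 0 asks
        for.\<close>
      define m where "m = Suc k"
      define C where "C = (real (Suc m) / \<epsilon>) ^ Suc m * M"
      have C0: "C \<ge> 0" unfolding C_def using M0 \<open>\<epsilon> > 0\<close> by simp
      have "norm (B k \<phi> y) \<le> C * (y - 0)\<^sup>2" if y: "dist y 0 < 1" for y
      proof (cases "y < 0")
        case False then show ?thesis using C0 by (simp add: B_def)
      next
        case True
        define z where "z = - y"
        have z: "z > 0" "z < 1" using True y by (auto simp: z_def)
        have "(\<epsilon> / z / real (Suc m)) ^ Suc m \<le> exp (\<epsilon> / z)"
          using z \<open>\<epsilon> > 0\<close> by (intro power_le_exp) auto
        then have "exp (- (\<epsilon> / z)) \<le> inverse ((\<epsilon> / z / real (Suc m)) ^ Suc m)"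
          unfolding exp_minus using z \<open>\<epsilon> > 0\<close> by (intro le_imp_inverse_le) (auto intro!: zero_less_power)
        also have "\<dots> = (real (Suc m) / \<epsilon>) ^ Suc m * z ^ Suc m"
          using z \<open>\<epsilon> > 0\<close> by (simp add: power_divide field_simps del: of_nat_Suc power_Suc)
        finally have e: "exp (\<epsilon> / y) \<le> (real (Suc m) / \<epsilon>) ^ Suc m * z ^ Suc m"
          by (simp add: z_def)
        have "norm (B k \<phi> y) = exp (\<epsilon> / y) * inverse z ^ k * norm (\<phi> y)"
          using True by (simp add: B_def abs_mult power_abs z_def)
        also have "\<dots> \<le> ((real (Suc m) / \<epsilon>) ^ Suc m * z ^ Suc m) * inverse z ^ k * M"
          using e z y True M0 \<open>\<epsilon> > 0\<close>
          by (intro mult_mono M) (auto simp: dist_real_def)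
        also have "\<dots> = C * z\<^sup>2"
          using z by (simp add: C_def m_def field_simps power2_eq_square del: of_nat_Suc)
        finally show ?thesis by (simp add: z_def)
      qed
      then show ?thesis unfolding True f'0[unfolded True]
        by (rule has_vector_derivative_zero_at_flat_point[rotated]) (auto simp: B_def)
    qed
  qed
  ultimately show ?case unfolding B_def by blast
next
  case (flat_add f g)
  then obtain f' g' where
    *: "flat_fun \<epsilon> f'" "flat_fun \<epsilon> g'"
    "\<And>t. (f has_vector_derivative f' t) (at t)" "\<And>t. (g has_vector_derivative g' t) (at t)" by blast
  show ?case
    using flat_fun.flat_add[OF *(1,2)] has_vector_derivative_add[OF *(3,4)] by blast
qed

text \<open>The factor \<open>exp (\<epsilon> / t)\<close> forces contact of infinite order with
  zero at time 0, so a function that is only one-sidedly smooth there extends by zero to the whole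
  line.\<close>

lemma smooth_on_flatten:
  assumes "smooth_on {..0} \<phi>" "\<epsilon> > 0"
  shows "smooth_on UNIV (\<lambda>t. if t < 0 then exp (\<epsilon> / t) *\<^sub>R \<phi> t else 0)"
proof (rule smooth_on_coinduct[where Q = "flat_fun \<epsilon>"])
  show "flat_fun \<epsilon> (\<lambda>t. if t < 0 then exp (\<epsilon> / t) *\<^sub>R \<phi> t else 0)"
    using flat_base[OF assms(1), of \<epsilon> 0] by (simp cong: if_cong)
qed (use flat_fun_derivative[OF _ assms(2)] in auto)

section \<open>A smooth cutoff that varies on scale n\<close>

definition edge :: "real \<Rightarrow> real" where
  "edge x = (if 0 < x then exp (- 1 / x) else 0)"

lemma smooth_on_edge: "smooth_on UNIV edge"
proof (rule smooth_on_cong)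
  show "smooth_on UNIV (\<lambda>t. if (-1) * t + 0 < 0 then exp (1 / ((-1) * t + 0)) *\<^sub>R (1::real) else 0)"
    by (rule smooth_on_affine[OF smooth_on_flatten[OF smooth_on_const]]) auto
qed (auto simp: edge_def)

text \<open>All bounds are restricted to arguments at most 1 because \<open>cutoff n\<close>
  evaluates \<open>edge\<close> at \<open>1 + t / n\<close> with \<open>t \<le> 0\<close>. On that
  half-line the first two derivatives vanish left of 0, and compactness of \<open>{0..1}\<close>
  bounds the rest.\<close>

lemma edge_derivative:
  obtains e' K where "\<And>x. (edge has_real_derivative e' x) (at x)" "continuous_on UNIV e'"
    "\<And>x. x \<le> 0 \<Longrightarrow> e' x = 0" "K > 0" "\<And>x. x \<le> 1 \<Longrightarrow> \<bar>e' x\<bar> \<le> K"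
    "\<And>x y. x \<le> 1 \<Longrightarrow> y \<le> 1 \<Longrightarrow> \<bar>e' x - e' y\<bar> \<le> K * \<bar>x - y\<bar>"
proof -
  from smooth_on_derivative[OF smooth_on_edge] obtain e1 where
    e1: "smooth_on UNIV e1" "\<And>t. (edge has_vector_derivative e1 t) (at t)" by auto
  from smooth_on_derivative[OF e1(1)] obtain e2 where
    e2: "smooth_on UNIV e2" "\<And>t. (e1 has_vector_derivative e2 t) (at t)" by auto
  have z1: "e1 x = 0" if "x \<le> 0" for x
    using has_vector_derivative_left_const[OF has_vector_derivative_at_within[OF e1(2)] that order_refl, of 0]
    by (auto simp: edge_def)
  have z2: "e2 x = 0" if "x \<le> 0" for x
    using has_vector_derivative_left_const[OF has_vector_derivative_at_within[OF e2(2)] that order_refl, of 0] z1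
    by auto
  have bd: "\<exists>K. \<forall>x\<le>1. \<bar>e x\<bar> \<le> K" if "smooth_on UNIV e" "\<And>x. x \<le> 0 \<Longrightarrow> e x = 0" for e :: "real \<Rightarrow> real"
  proof -
    have "continuous_on {0..1} e"
      by (rule continuous_on_subset[OF smooth_on_continuous[OF that(1)]]) auto
    then obtain K where K: "\<And>t. 0 \<le> t \<Longrightarrow> t \<le> 1 \<Longrightarrow> \<bar>e t\<bar> \<le> K"
      by (rule continuous_on_Icc_bound) auto
    have "\<bar>e x\<bar> \<le> K" if "x \<le> 1" for x
      using K[of x] K[of 0] that(1) \<open>\<And>x. x \<le> 0 \<Longrightarrow> e x = 0\<close>[of x] by (cases "x \<le> 0") auto
    then show ?thesis by blast
  qed
  from bd[OF e1(1) z1] bd[OF e2(1) z2] obtain K1 K2 where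
    K: "\<And>x. x \<le> 1 \<Longrightarrow> \<bar>e1 x\<bar> \<le> K1" "\<And>x. x \<le> 1 \<Longrightarrow> \<bar>e2 x\<bar> \<le> K2" by auto
  define K where "K = max 1 (max K1 K2)"
  show ?thesis
  proof (rule that)
    show "(edge has_real_derivative e1 x) (at x)" for x
      using e1(2) by (simp add: has_real_derivative_iff_has_vector_derivative)
    show "continuous_on UNIV e1" using e1(1) by (rule smooth_on_continuous)
    show "\<bar>e1 x\<bar> \<le> K" if "x \<le> 1" for x using K(1)[OF that] by (auto simp: K_def)
    show "\<bar>e1 x - e1 y\<bar> \<le> K * \<bar>x - y\<bar>" if "x \<le> 1" "y \<le> 1" for x y
      using norm_diff_le_of_vector_derivative[of "{..1}" e1 e2 K y x] K(2) that
      by (auto simp: K_def le_max_iff_disj has_vector_derivative_at_within[OF e2(2)])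
  qed (auto simp: z1 K_def)
qed

text \<open>The factor \<open>exp 1\<close> is the inverse of \<open>edge 1\<close>. In contrast to
  the usual bump function, the cutoff is 0 at time 0 and 1 before time \<open>- n\<close>, so
  subtracting a multiple of it corrects a path near minus infinity without moving its value at
  0.\<close>

definition cutoff :: "real \<Rightarrow> real \<Rightarrow> real" where
  "cutoff n t = 1 - exp 1 * edge (1 + t / n)"

lemma cutoff_0 [simp]: "cutoff n 0 = 0"
  by (simp add: cutoff_def edge_def flip: exp_add)

lemma cutoff_far: "n > 0 \<Longrightarrow> t \<le> - n \<Longrightarrow> cutoff n t = 1"
  by (simp add: cutoff_def edge_def field_simps)

lemma cutoff_bounds:
  assumes "n > 0" "t \<le> 0"
  shows "0 \<le> cutoff n t" "cutoff n t \<le> 1"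
proof -
  have "edge (1 + t / n) \<le> exp (- 1)"
    using assms by (auto simp: edge_def field_simps)
  then show "0 \<le> cutoff n t"
    by (simp add: cutoff_def exp_minus field_simps)
  show "cutoff n t \<le> 1" by (simp add: cutoff_def edge_def)
qed

lemma smooth_on_cutoff: "smooth_on S (cutoff n)"
proof (rule smooth_on_cong)
  show "smooth_on S (\<lambda>t. 1 + (- exp 1) * edge ((1 / n) * t + 1))"
    by (intro smooth_on_add smooth_on_const smooth_on_linear[OF bounded_linear_mult_right]
        smooth_on_affine[OF smooth_on_edge]) auto
qed (simp add: cutoff_def add.commute)

text \<open>Each derivative of the rescaled profile gains a factor \<open>1 / n\<close>. The bound
  of order \<open>1 / n\<close> makes the path norm of a cutoff small; the Lipschitz bound of order
  \<open>1 / n\<^sup>2\<close> on the derivative is what the fractional kernel requires.\<close>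

lemma cutoff_derivative:
  obtains c' K where "\<And>n t. n > 0 \<Longrightarrow> (cutoff n has_real_derivative c' n t) (at t)"
    "\<And>n. n > 0 \<Longrightarrow> continuous_on UNIV (c' n)" "\<And>n t. n > 0 \<Longrightarrow> t \<le> - n \<Longrightarrow> c' n t = 0" "K > 0"
    "\<And>n t. n > 0 \<Longrightarrow> t \<le> 0 \<Longrightarrow> \<bar>c' n t\<bar> \<le> K / n"
    "\<And>n s t. n > 0 \<Longrightarrow> s \<le> 0 \<Longrightarrow> t \<le> 0 \<Longrightarrow> \<bar>c' n t - c' n s\<bar> \<le> K / n\<^sup>2 * \<bar>t - s\<bar>"
proof -
  obtain e' K where e: "\<And>x. (edge has_real_derivative e' x) (at x)" "continuous_on UNIV e'"
    "\<And>x. x \<le> 0 \<Longrightarrow> e' x = 0" "K > 0" "\<And>x. x \<le> 1 \<Longrightarrow> \<bar>e' x\<bar> \<le> K"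
    "\<And>x y. x \<le> 1 \<Longrightarrow> y \<le> 1 \<Longrightarrow> \<bar>e' x - e' y\<bar> \<le> K * \<bar>x - y\<bar>"
    by (rule edge_derivative) (rule that)
  define c' where "c' n t = - exp 1 * e' (1 + t / n) / n" for n t
  show ?thesis
  proof (rule that[of c' "exp 1 * K"])
    fix n :: real assume n: "n > 0"
    show "(cutoff n has_real_derivative c' n t) (at t)" for t
    proof -
      have "((\<lambda>t. 1 + t / n) has_real_derivative 1 / n) (at t)"
        using n by (auto intro!: derivative_eq_intros)
      from DERIV_chain2[OF e(1) this]
      have "((\<lambda>t. edge (1 + t / n)) has_real_derivative e' (1 + t / n) * (1 / n)) (at t)" .
      then show ?thesis
        unfolding cutoff_def c'_def by (auto intro!: derivative_eq_intros)
    qed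
    show "continuous_on UNIV (c' n)"
      unfolding c'_def using n by (intro continuous_intros continuous_on_compose2[OF e(2)]) auto
    show "c' n t = 0" if "t \<le> - n" for t
      using n that by (simp add: c'_def e(3) field_simps)
    show "\<bar>c' n t\<bar> \<le> exp 1 * K / n" if "t \<le> 0" for t
      using n that e(5)[of "1 + t / n"] by (auto simp: c'_def abs_mult field_simps)
    show "\<bar>c' n t - c' n s\<bar> \<le> exp 1 * K / n\<^sup>2 * \<bar>t - s\<bar>" if "s \<le> 0" "t \<le> 0" for s t
    proof -
      have "\<bar>c' n t - c' n s\<bar> = exp 1 / n * \<bar>e' (1 + t / n) - e' (1 + s / n)\<bar>"
      proof -
        have "c' n t - c' n s = - (exp 1 / n * (e' (1 + t / n) - e' (1 + s / n)))"
          by (simp add: c'_def diff_divide_distrib right_diff_distrib)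
        then show ?thesis using n by (simp add: abs_mult)
      qed
      also have "\<dots> \<le> exp 1 / n * (K * \<bar>(1 + t / n) - (1 + s / n)\<bar>)"
        using n that by (intro mult_left_mono e(6)) (auto simp: field_simps)
      also have "(1 + t / n) - (1 + s / n) = (t - s) / n" by (simp add: diff_divide_distrib)
      finally show ?thesis using n by (simp add: power2_eq_square abs_divide)
    qed
  qed (use e(4) in auto)
qed

text \<open>The oscillation stays below \<open>norm c\<close> while the Lipschitz constant is of
  order \<open>1 / n\<close>, so interpolation yields decay like the power
  \<open>(1 - h) / 2\<close> of \<open>1 / n\<close>. A constant at minus infinity thus costs
  nothing in the limit.\<close>

lemma B_norm_cutoff_tendsto_0:
  assumes h: "0 < h" "h < 1"
  shows "(\<lambda>n. B_norm h (\<lambda>t. cutoff (real n) t *\<^sub>R (c :: real ^ 'd::finite))) \<longlonglongrightarrow> 0"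
proof -
  obtain c' K where c: "\<And>n t. n > 0 \<Longrightarrow> (cutoff n has_real_derivative c' n t) (at t)" "K > 0"
    "\<And>n t. n > 0 \<Longrightarrow> t \<le> 0 \<Longrightarrow> \<bar>c' n t\<bar> \<le> K / n"
    by (rule cutoff_derivative) (rule that)
  let ?b = "\<lambda>n. norm c powr ((1 + h) / 2) * (norm c * K / real n) powr ((1 - h) / 2)"
  have "B_norm h (\<lambda>t. cutoff (real n) t *\<^sub>R c) \<le> ennreal (?b n)" if n: "n \<ge> 1" for n
  proof (rule B_norm_interpolate[OF h])
    fix s t :: real assume st: "s \<le> 0" "t \<le> 0"
    have *: "\<bar>cutoff n t - cutoff n s\<bar> \<le> 1"
      using cutoff_bounds[of n s] cutoff_bounds[of n t] n st by auto
    have **: "\<bar>cutoff n t - cutoff n s\<bar> \<le> K / n * \<bar>t - s\<bar>"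
      using norm_diff_le_of_vector_derivative[of "{..0}" "cutoff n" "c' n" "K / n" s t] c(1)[of n] c(3)[of n] n st
      by (auto simp: has_real_derivative_iff_has_vector_derivative intro: has_vector_derivative_at_within)
    show "norm (cutoff (real n) t *\<^sub>R c - cutoff (real n) s *\<^sub>R c) \<le> norm c"
      using mult_right_mono[OF *, of "norm c"] by (simp flip: scaleR_diff_left)
    show "norm (cutoff (real n) t *\<^sub>R c - cutoff (real n) s *\<^sub>R c) \<le> norm c * K / real n * \<bar>t - s\<bar>"
      using mult_right_mono[OF **, of "norm c"] by (simp flip: scaleR_diff_left add: mult_ac)
  qed (use c(2) in auto)
  then have ev: "\<forall>\<^sub>F n in sequentially. B_norm h (\<lambda>t. cutoff (real n) t *\<^sub>R c) \<le> ennreal (?b n)"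
    by (auto simp: eventually_sequentially)
  have "(\<lambda>n. ennreal (?b n)) \<longlonglongrightarrow> ennreal 0"
  proof (intro tendsto_ennrealI tendsto_mult_right_zero)
    have "(\<lambda>n. norm c * K / real n) \<longlonglongrightarrow> 0"
      by (rule lim_const_over_n)
    then show "(\<lambda>n. (norm c * K / real n) powr ((1 - h) / 2)) \<longlonglongrightarrow> 0"
      by (rule tendsto_zero_powrI[OF _ tendsto_const]) (use h c(2) in auto)
  qed
  then have "(\<lambda>n. ennreal (?b n)) \<longlonglongrightarrow> 0" by (simp only: ennreal_0)
  from tendsto_sandwich[OF _ ev tendsto_const this] show ?thesis by simp
qed

section \<open>Compactly supported paths, their closure and its metric topology\<close>

lemma C0_inf_I:
  assumes "smooth_on {..0} f" "\<And>t. t \<ge> 0 \<Longrightarrow> f t = 0" "\<And>t. t \<le> - M \<Longrightarrow> f t = 0"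
  shows "f \<in> C0_inf"
  using assms by (auto simp: C0_inf_def smooth_neg_iff)

lemma C0_inf_zero: "(\<lambda>_. 0) \<in> C0_inf"
  by (rule C0_inf_I[of _ 0]) (auto intro: smooth_on_const)

lemma C0_inf_derivative:
  assumes "\<phi> \<in> C0_inf"
  obtains \<phi>' L M where "\<And>t. t \<le> 0 \<Longrightarrow> (\<phi> has_vector_derivative \<phi>' t) (at t within {..0})"
    "continuous_on {..0} \<phi>'" "M > 0" "\<And>t. t \<le> - M \<Longrightarrow> \<phi> t = 0" "\<And>t. t \<le> - M \<Longrightarrow> \<phi>' t = 0"
    "L > 0" "\<And>t. t \<le> 0 \<Longrightarrow> norm (\<phi>' t) \<le> L"
    "\<And>s t. s \<le> 0 \<Longrightarrow> t \<le> 0 \<Longrightarrow> norm (\<phi> t - \<phi> s) \<le> L * \<bar>t - s\<bar>"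
    "\<And>t. t \<le> 0 \<Longrightarrow> norm (\<phi> t) \<le> L"
proof -
  from assms obtain M0 where sm: "smooth_on {..0} \<phi>" and M0: "\<And>t. t \<le> - M0 \<Longrightarrow> \<phi> t = 0"
    and z: "\<phi> 0 = 0"
    by (auto simp: C0_inf_def smooth_neg_iff)
  define M where "M = max 1 M0"
  have M: "\<And>t. t \<le> - M \<Longrightarrow> \<phi> t = 0" "M > 0" using M0 by (auto simp: M_def)
  from smooth_on_derivative[OF sm] obtain \<phi>' where \<phi>': "smooth_on {..0} \<phi>'"
    "\<And>t. t \<le> 0 \<Longrightarrow> (\<phi> has_vector_derivative \<phi>' t) (at t within {..0})" by (metis atMost_iff)
  have z': "\<phi>' t = 0" if "t \<le> - M" for t
    by (rule has_vector_derivative_left_const[OF \<phi>'(2) that]) (use that M in auto)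
  have "continuous_on {-M..0} \<phi>'"
    by (rule continuous_on_subset[OF smooth_on_continuous[OF \<phi>'(1)]]) auto
  then obtain L0 where L0: "L0 \<ge> 0" "\<And>t. - M \<le> t \<Longrightarrow> t \<le> 0 \<Longrightarrow> norm (\<phi>' t) \<le> L0"
    by (rule continuous_on_Icc_bound) (rule that)
  \<comment> \<open>Large enough to dominate both the bound \<open>L0\<close> of the derivative and
    the bound \<open>L0 * M\<close> of the path, whose support lies within distance \<open>M\<close>
    of 0.\<close>
  define L where "L = (L0 + 1) * (M + 1)"
  have L: "L > 0" "L0 \<le> L" "L0 * M \<le> L" using L0(1) M(2) mult_nonneg_nonneg[of L0 M]
    unfolding L_def ring_distribs by linarith+
  have bd: "norm (\<phi>' t) \<le> L0" if "t \<le> 0" for t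
    using L0(2)[of t] L0(1) that z'[of t] by (cases "t \<le> - M") auto
  have lip: "norm (\<phi> t - \<phi> s) \<le> L0 * \<bar>t - s\<bar>" if "s \<le> 0" "t \<le> 0" for s t
    by (rule norm_diff_le_of_vector_derivative[of "{..0}" _ \<phi>']) (use that \<phi>' bd in auto)
  show ?thesis
  proof (rule that[of \<phi>' M L])
    show "norm (\<phi> t - \<phi> s) \<le> L * \<bar>t - s\<bar>" if "s \<le> 0" "t \<le> 0" for s t
      using lip[OF that] L(2) by (meson abs_ge_zero mult_right_mono order_trans)
    show "norm (\<phi> t) \<le> L" if "t \<le> 0" for t
    proof (cases "t \<le> - M")
      case False
      have "norm (\<phi> t) \<le> L0 * \<bar>t\<bar>" using lip[of 0 t] that z by simp
      also have "\<dots> \<le> L0 * M" using False that L0(1) by (intro mult_left_mono) auto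
      finally show ?thesis using L by simp
    qed (use M L in auto)
    show "norm (\<phi>' t) \<le> L" if "t \<le> 0" for t using bd[OF that] L by simp
  qed (use \<phi>' M z' L smooth_on_continuous[OF \<phi>'(1)] in auto)
qed

lemma B_norm_C0_inf_finite:
  assumes h: "0 < h" "h < 1" and "\<phi> \<in> C0_inf"
  shows "B_norm h \<phi> < \<infinity>"
proof -
  obtain \<phi>' L where L: "L > 0" "\<And>s t. s \<le> 0 \<Longrightarrow> t \<le> 0 \<Longrightarrow> norm (\<phi> t - \<phi> s) \<le> L * \<bar>t - s\<bar>"
    "\<And>t. t \<le> 0 \<Longrightarrow> norm (\<phi> t) \<le> L"
    by (rule C0_inf_derivative[OF assms(3)]) (rule that)
  have "B_norm h \<phi> \<le> ennreal ((2 * L) powr ((1 + h) / 2) * L powr ((1 - h) / 2))"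
  proof (rule B_norm_interpolate[OF h])
    show "norm (\<phi> t - \<phi> s) \<le> 2 * L" if "s \<le> 0" "t \<le> 0" for s t
      using L(3)[of s] L(3)[of t] that norm_triangle_ineq4[of "\<phi> t" "\<phi> s"] by linarith
  qed (use L in auto)
  then show ?thesis by (rule le_less_trans) auto
qed

lemma B_space_vanish: "\<omega> \<in> B_space h \<Longrightarrow> t \<ge> 0 \<Longrightarrow> \<omega> t = 0"
  by (simp add: B_space_def)

lemma B_space_approx:
  assumes "\<omega> \<in> B_space h" "\<epsilon> > 0"
  obtains \<phi> where "\<phi> \<in> C0_inf" "B_norm h (\<lambda>t. \<omega> t - \<phi> t) < \<epsilon>"
  using assms by (auto simp: B_space_def)

lemma C0_inf_subset_B_space: "C0_inf \<subseteq> B_space h"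
proof
  fix \<phi> :: "'d::finite path" assume *: "\<phi> \<in> C0_inf"
  have "B_norm h (\<lambda>t. \<phi> t - \<phi> t) = 0" by (simp add: B_norm_def)
  moreover have "\<phi> t = 0" if "t \<ge> 0" for t
    using * that by (simp add: C0_inf_def)
  ultimately show "\<phi> \<in> B_space h"
    using * unfolding B_space_def by (auto intro!: bexI[of _ \<phi>])
qed

text \<open>The closure is closed: approximants may be taken in \<open>B_space h\<close> itself,
  which frees later arguments from having to produce compact support.\<close>

lemma B_space_I_approx:
  assumes "\<And>t. t \<ge> 0 \<Longrightarrow> \<omega> t = 0"
    and "\<And>\<epsilon>. \<epsilon> > 0 \<Longrightarrow> \<exists>\<eta>\<in>B_space h. B_norm h (\<lambda>t. \<omega> t - \<eta> t) < \<epsilon>"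
  shows "\<omega> \<in> B_space h"
  unfolding B_space_def
proof (safe intro!: assms)
  fix \<epsilon> :: ennreal assume "\<epsilon> > 0"
  then have e: "\<epsilon> / 2 > 0" by (simp add: ennreal_zero_less_divide)
  from assms(2)[OF e] obtain \<eta> where \<eta>: "\<eta> \<in> B_space h" "B_norm h (\<lambda>t. \<omega> t - \<eta> t) < \<epsilon> / 2" by blast
  from B_space_approx[OF \<eta>(1) e] obtain \<phi> where \<phi>: "\<phi> \<in> C0_inf" "B_norm h (\<lambda>t. \<eta> t - \<phi> t) < \<epsilon> / 2" .
  have "B_norm h (\<lambda>t. \<omega> t - \<phi> t) < \<epsilon> / 2 + \<epsilon> / 2"
    by (rule le_less_trans[OF B_norm_triangle add_strict_mono[OF \<eta>(2) \<phi>(2)]])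
  also have "\<epsilon> / 2 + \<epsilon> / 2 = \<epsilon>"
    unfolding add_divide_distrib_ennreal[symmetric] unfolding mult_2_right[symmetric]
    by (rule mult_divide_eq_ennreal) auto
  finally show "\<exists>\<phi>\<in>C0_inf. B_norm h (\<lambda>t. \<omega> t - \<phi> t) < \<epsilon>"
    using \<phi>(1) by auto
qed

lemma B_norm_B_space_finite:
  assumes "0 < h" "h < 1" "\<omega> \<in> B_space h"
  shows "B_norm h \<omega> < \<infinity>"
proof -
  from B_space_approx[OF assms(3) zero_less_one] obtain \<phi> where
    \<phi>: "\<phi> \<in> C0_inf" "B_norm h (\<lambda>t. \<omega> t - \<phi> t) < 1" .
  have "B_norm h \<omega> \<le> B_norm h (\<lambda>t. \<omega> t - \<phi> t) + B_norm h \<phi>"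
    using B_norm_add[of h "\<lambda>t. \<omega> t - \<phi> t" \<phi>] by simp
  also have "\<dots> < \<infinity>"
    using \<phi> B_norm_C0_inf_finite[OF assms(1,2) \<phi>(1)] by (auto simp: less_top[symmetric])
  finally show ?thesis .
qed

lemma B_norm_diff_finite:
  assumes "0 < h" "h < 1" "\<omega> \<in> B_space h" "\<eta> \<in> B_space h"
  shows "B_norm h (\<lambda>t. \<omega> t - \<eta> t) < \<infinity>"
proof -
  have "B_norm h (\<lambda>t. \<omega> t - \<eta> t) \<le> B_norm h \<omega> + B_norm h \<eta>"
    using B_norm_triangle[of h \<omega> \<eta> "\<lambda>_. 0"] B_norm_diff_commute[of h \<eta> "\<lambda>_. 0"]
      B_norm_triangle[of h \<omega> "\<lambda>_. 0" \<eta>] B_norm_diff_commute[of h "\<lambda>_. 0" \<eta>] by simp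
  also have "\<dots> < \<infinity>"
    using B_norm_B_space_finite[OF assms(1,2)] assms(3,4) by (auto simp: less_top[symmetric])
  finally show ?thesis .
qed

lemma B_dist_bound:
  assumes "0 < h" "h < 1" "\<omega> \<in> B_space h" "\<eta> \<in> B_space h" "t \<le> 0"
  shows "norm (\<omega> t - \<eta> t) \<le> B_dist h \<omega> \<eta> * (sqrt (1 + \<bar>t\<bar>) * \<bar>t\<bar> powr ((1 - h) / 2))"
  using B_norm_finite_bound[OF B_norm_diff_finite[OF assms(1-4)], of 0 t] assms(3-5)
  by (simp add: B_space_vanish B_dist_def)

lemma ennreal_B_dist:
  assumes "0 < h" "h < 1" "\<omega> \<in> B_space h" "\<eta> \<in> B_space h"
  shows "ennreal (B_dist h \<omega> \<eta>) = B_norm h (\<lambda>t. \<omega> t - \<eta> t)"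
  unfolding B_dist_def using B_norm_diff_finite[OF assms] by (simp add: ennreal_enn2real_if less_top)

text \<open>Separation holds because elements vanish at time 0, so that the norm controls point
  values. The triangle inequality is proved in \<open>ennreal\<close> and transferred by finiteness
  of the norm on the space.\<close>

lemma Metric_space_B:
  assumes h: "0 < h" "h < 1"
  shows "Metric_space (B_space h) (B_dist h :: 'd::finite path \<Rightarrow> _)"
proof
  show "0 \<le> B_dist h \<omega> \<eta>" "B_dist h \<omega> \<eta> = B_dist h \<eta> \<omega>" for \<omega> \<eta> :: "'d path"
    by (simp add: B_dist_def) (metis B_dist_def B_norm_diff_commute)
  show "B_dist h \<omega> \<eta> = 0 \<longleftrightarrow> \<omega> = \<eta>" if "\<omega> \<in> B_space h" "\<eta> \<in> B_space h" for \<omega> \<eta> :: "'d path"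
  proof
    assume *: "B_dist h \<omega> \<eta> = 0"
    show "\<omega> = \<eta>"
    proof
      fix t show "\<omega> t = \<eta> t"
        using B_dist_bound[OF h that, of t] * that by (cases "t \<le> 0") (auto simp: B_space_vanish)
    qed
  qed (auto simp: B_dist_def B_norm_def)
  show "B_dist h \<omega> \<zeta> \<le> B_dist h \<omega> \<eta> + B_dist h \<eta> \<zeta>"
    if *: "\<omega> \<in> B_space h" "\<eta> \<in> B_space h" "\<zeta> \<in> B_space h" for \<omega> \<eta> \<zeta> :: "'d path"
  proof -
    have "ennreal (B_dist h \<omega> \<zeta>) \<le> ennreal (B_dist h \<omega> \<eta>) + ennreal (B_dist h \<eta> \<zeta>)"
      using * by (simp add: ennreal_B_dist[OF h] B_norm_triangle)
    also have "\<dots> = ennreal (B_dist h \<omega> \<eta> + B_dist h \<eta> \<zeta>)"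
      by (simp add: B_dist_def)
    finally show ?thesis by (subst (asm) ennreal_le_iff) (simp_all add: B_dist_def)
  qed
qed

lemma topspace_B_top: "0 < h \<Longrightarrow> h < 1 \<Longrightarrow> topspace (B_top h :: 'd::finite path topology) = B_space h"
  unfolding B_top_def by (simp add: Metric_space.topspace_mtopology Metric_space_B)

lemma space_B_borel: "0 < h \<Longrightarrow> h < 1 \<Longrightarrow> space (B_borel h :: 'd::finite path measure) = B_space h"
  unfolding B_borel_def using topspace_B_top[of h] openin_subset[of "B_top h"]
  by (subst space_measure_of) auto

lemma openin_B_top_sets:
  assumes "0 < h" "h < 1" "openin (B_top h) U"
  shows "U \<in> sets (B_borel h :: 'd::finite path measure)"
  unfolding B_borel_def using topspace_B_top[OF assms(1,2)] openin_subset[of "B_top h"] assms(3)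
  by (subst sets_measure_of) auto

lemma openin_B_top_I:
  fixes U :: "'d::finite path set"
  assumes "0 < h" "h < 1" "U \<subseteq> B_space h"
    and "\<And>\<omega>. \<omega> \<in> U \<Longrightarrow> \<exists>r>0. \<forall>\<eta>\<in>B_space h. B_dist h \<omega> \<eta> < r \<longrightarrow> \<eta> \<in> U"
  shows "openin (B_top h) U"
proof -
  interpret Metric_space "B_space h" "B_dist h :: 'd path \<Rightarrow> _"
    by (rule Metric_space_B[OF assms(1,2)])
  show ?thesis unfolding B_top_def openin_mtopology
    using assms(3,4) by (force simp: mball_def)
qed

lemma continuous_map_B_top_D:
  fixes D :: "'d::finite path \<Rightarrow> 'd path"
  assumes "0 < h" "h < 1" "0 < k" "k < 1" "continuous_map (B_top h) (B_top k) D" "\<omega> \<in> B_space h"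
  shows "D \<omega> \<in> B_space k"
    and "\<epsilon> > 0 \<Longrightarrow> \<exists>\<delta>>0. \<forall>\<eta>\<in>B_space h. B_dist h \<omega> \<eta> < \<delta> \<longrightarrow> B_dist k (D \<omega>) (D \<eta>) < \<epsilon>"
proof -
  have *: "D ` B_space h \<subseteq> B_space k"
    "\<forall>a\<in>B_space h. \<forall>\<epsilon>>0. \<exists>\<delta>>0. \<forall>x. x \<in> B_space h \<and> B_dist h a x < \<delta> \<longrightarrow> B_dist k (D a) (D x) < \<epsilon>"
    using assms(5) Metric_space.metric_continuous_map[OF Metric_space_B[OF assms(1,2)] Metric_space_B[OF assms(3,4)], of D]
    unfolding B_top_def by simp_all
  show "D \<omega> \<in> B_space k" using *(1) assms(6) by blast
  show "\<exists>\<delta>>0. \<forall>\<eta>\<in>B_space h. B_dist h \<omega> \<eta> < \<delta> \<longrightarrow> B_dist k (D \<omega>) (D \<eta>) < \<epsilon>" if "\<epsilon> > 0"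
    using *(2)[rule_format, OF assms(6) that] by blast
qed

text \<open>Far to the left the cutoff equals 1 and cancels the constant \<open>c\<close>; at time 0
  it vanishes and leaves \<open>f 0 = 0\<close> intact.\<close>

lemma far_cutoff_in_C0_inf:
  assumes "smooth_on {..0} f" "f 0 = 0" "n > 0" "\<And>t. t \<le> - M \<Longrightarrow> f t = c"
  shows "(\<lambda>t. if t \<le> 0 then f t - cutoff n t *\<^sub>R c else 0) \<in> C0_inf"
proof (rule C0_inf_I[where M = "max M n"])
  have "smooth_on {..0} (\<lambda>t. f t + (- (cutoff n t *\<^sub>R c)))"
    by (intro smooth_on_add assms(1) smooth_on_linear[OF bounded_linear_minus[OF bounded_linear_scaleR_left]]
        smooth_on_cutoff)
  then show "smooth_on {..0} (\<lambda>t. if t \<le> 0 then f t - cutoff n t *\<^sub>R c else 0)"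
    by (rule smooth_on_cong) auto
qed (use assms in \<open>auto simp: cutoff_far\<close>)

lemma B_norm_far_cutoff_tendsto_0:
  fixes c :: "real ^ 'd::finite"
  assumes "0 < h" "h < 1"
  shows "(\<lambda>n. B_norm h (\<lambda>t. (if t \<le> 0 then f t else 0) -
    (if t \<le> 0 then f t - cutoff (real n) t *\<^sub>R c else 0))) \<longlonglongrightarrow> 0"
proof -
  have "B_norm h (\<lambda>t. (if t \<le> 0 then f t else 0) - (if t \<le> 0 then f t - cutoff (real n) t *\<^sub>R c else 0))
      = B_norm h (\<lambda>t. cutoff (real n) t *\<^sub>R c)" for n
    by (rule B_norm_cong) simp
  then show ?thesis using B_norm_cutoff_tendsto_0[OF assms] by simp
qed

text \<open>The compactly supported truncations differ from the path by
  \<open>cutoff n t *\<^sub>R c\<close> only, whose norm tends to 0.\<close>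

lemma eventually_const_in_B_space:
  assumes h: "0 < h" "h < 1"
    and f: "smooth_on {..0} f" "f 0 = 0" "\<And>t. t \<le> - M \<Longrightarrow> f t = c"
  shows "(\<lambda>t. if t \<le> 0 then f t else 0) \<in> B_space h"
proof (rule B_space_I_approx)
  fix \<epsilon> :: ennreal assume "\<epsilon> > 0"
  from order_tendstoD(2)[OF B_norm_far_cutoff_tendsto_0[OF h, of f c] this]
  obtain N where N: "\<And>n. n \<ge> N \<Longrightarrow> B_norm h (\<lambda>t. (if t \<le> 0 then f t else 0) -
    (if t \<le> 0 then f t - cutoff (real n) t *\<^sub>R c else 0)) < \<epsilon>"
    by (auto simp: eventually_sequentially)
  show "\<exists>\<eta>\<in>B_space h. B_norm h (\<lambda>t. (if t \<le> 0 then f t else 0) - \<eta> t) < \<epsilon>"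
    using N[of "Suc N"] far_cutoff_in_C0_inf[OF f(1,2) _ f(3), of "real (Suc N)"] C0_inf_subset_B_space
    by (intro bexI[of _ "\<lambda>t. if t \<le> 0 then f t - cutoff (real (Suc N)) t *\<^sub>R c else 0"]) auto
qed (use f in auto)

text \<open>
  \<open>P_op\<close> glues two paths at an interior time. Approximants that are flat at \<open>0\<close> make the glued path
  smooth there.
\<close>

lemma C0_inf_flat_dense:
  fixes \<phi> :: "'d::finite path"
  assumes h: "0 < h" "h < 1" and \<phi>: "\<phi> \<in> C0_inf" and "\<delta> > 0"
  obtains \<psi> where "\<psi> \<in> C0_inf" "smooth_on UNIV \<psi>" "B_norm h (\<lambda>t. \<phi> t - \<psi> t) < \<delta>"
proof -
  obtain \<phi>' L M where d: "\<And>t. t \<le> 0 \<Longrightarrow> (\<phi> has_vector_derivative \<phi>' t) (at t within {..0})"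
    "L > 0" "\<And>t. t \<le> 0 \<Longrightarrow> norm (\<phi>' t) \<le> L" "\<And>t. t \<le> - M \<Longrightarrow> \<phi> t = 0"
    "\<And>s t. s \<le> 0 \<Longrightarrow> t \<le> 0 \<Longrightarrow> norm (\<phi> t - \<phi> s) \<le> L * \<bar>t - s\<bar>"
    by (rule C0_inf_derivative[OF \<phi>]) (rule that)
  have \<phi>0: "\<And>t. t \<ge> 0 \<Longrightarrow> \<phi> t = 0" and sm: "smooth_on {..0} \<phi>"
    using \<phi> by (auto simp: C0_inf_def smooth_neg_iff)
  have \<phi>L: "norm (\<phi> t) \<le> L * \<bar>t\<bar>" if "t \<le> 0" for t
    using d(5)[of 0 t] that \<phi>0[of 0] by simp
  \<comment> \<open>For small \<epsilon> the error
    \<open>(1 - exp (\<epsilon> / t)) *\<^sub>R \<phi> t\<close> is uniformly at most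
    \<open>L * \<epsilon>\<close>, because \<open>norm (\<phi> t) \<le> L * \<bar>t\<bar>\<close>,
    while its Lipschitz constant stays at most \<open>2 * L\<close>. Interpolation then makes its
    norm small.\<close>
  define \<psi> where "\<psi> \<epsilon> t = (if t < 0 then exp (\<epsilon> / t) *\<^sub>R \<phi> t else 0)" for \<epsilon> t
  have \<psi>_smooth: "smooth_on UNIV (\<psi> \<epsilon>)" if "\<epsilon> > 0" for \<epsilon>
    unfolding \<psi>_def by (rule smooth_on_flatten[OF sm that])
  have \<psi>_C0: "\<psi> \<epsilon> \<in> C0_inf" if "\<epsilon> > 0" for \<epsilon>
    by (rule C0_inf_I[where M = M]) (use smooth_on_subset[OF \<psi>_smooth[OF that]] d(4) in \<open>auto simp: \<psi>_def\<close>)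
  let ?g = "\<lambda>\<epsilon> t. \<phi> t - \<psi> \<epsilon> t"
  let ?b = "\<lambda>\<epsilon>. (2 * L * \<epsilon>) powr ((1 + h) / 2) * (2 * L) powr ((1 - h) / 2)"
  have "B_norm h (?g \<epsilon>) \<le> ennreal (?b \<epsilon>)" if \<epsilon>: "\<epsilon> > 0" for \<epsilon>
  proof (rule B_norm_interpolate[OF h])
    have g: "?g \<epsilon> t = (1 - exp (\<epsilon> / t)) *\<^sub>R \<phi> t" if "t < 0" for t
      using that by (simp add: \<psi>_def scaleR_diff_left)
    have g0: "?g \<epsilon> 0 = 0" using \<phi>0[of 0] by (simp add: \<psi>_def)
    have e: "0 \<le> 1 - exp (\<epsilon> / t)" "1 - exp (\<epsilon> / t) \<le> \<epsilon> / \<bar>t\<bar>" "1 - exp (\<epsilon> / t) \<le> 1" if "t < 0" for t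
    proof -
      show "0 \<le> 1 - exp (\<epsilon> / t)" "1 - exp (\<epsilon> / t) \<le> 1" using that \<epsilon> by (auto simp: divide_nonneg_neg)
      have "\<epsilon> / \<bar>t\<bar> = - (\<epsilon> / t)" using that by simp
      then show "1 - exp (\<epsilon> / t) \<le> \<epsilon> / \<bar>t\<bar>"
        using exp_ge_add_one_self[of "\<epsilon> / t"] by linarith
    qed
    have gL: "norm (?g \<epsilon> t) \<le> L * \<epsilon>" if "t \<le> 0" for t
    proof (cases "t = 0")
      case False
      then have t: "t < 0" using that by simp
      have "norm (?g \<epsilon> t) = (1 - exp (\<epsilon> / t)) * norm (\<phi> t)"
        unfolding g[OF t] using e[OF t] by simp
      also have "\<dots> \<le> (\<epsilon> / \<bar>t\<bar>) * (L * \<bar>t\<bar>)"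
        using \<phi>L[OF that] e[OF t] \<epsilon> by (intro mult_mono) auto
      also have "\<dots> = L * \<epsilon>" using t by (simp add: field_simps)
      finally show ?thesis .
    qed (use g0 d(2) \<epsilon> in auto)
    show "norm (?g \<epsilon> t - ?g \<epsilon> s) \<le> 2 * L * \<epsilon>" if "s \<le> 0" "t \<le> 0" for s t
      using gL[OF that(1)] gL[OF that(2)] norm_triangle_ineq4[of "?g \<epsilon> t" "?g \<epsilon> s"] by linarith
    \<comment> \<open>This formula for the derivative holds at negative times only; increments with
      an end point at 0 are covered by \<open>lip0\<close>.\<close>
    define g' where "g' t = (1 - exp (\<epsilon> / t)) *\<^sub>R \<phi>' t + (\<epsilon> / t\<^sup>2 * exp (\<epsilon> / t)) *\<^sub>R \<phi> t" for t
    have g': "(?g \<epsilon> has_vector_derivative g' t) (at t within {..<0})" if "t \<in> {..<0}" for t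
    proof -
      have "((\<lambda>t. 1 - exp (\<epsilon> / t)) has_real_derivative (\<epsilon> / t\<^sup>2 * exp (\<epsilon> / t))) (at t within {..<0})"
        using that by (auto intro!: derivative_eq_intros simp: field_simps power2_eq_square)
      moreover have "(\<phi> has_vector_derivative \<phi>' t) (at t within {..<0})"
        using that by (intro has_vector_derivative_within_subset[OF d(1)]) auto
      ultimately have "((\<lambda>t. (1 - exp (\<epsilon> / t)) *\<^sub>R \<phi> t) has_vector_derivative g' t) (at t within {..<0})"
        unfolding g'_def by (rule has_vector_derivative_scaleR)
      then show ?thesis
        by (rule has_vector_derivative_transform[OF that _, rotated]) (use g in auto)
    qed
    have g'L: "norm (g' t) \<le> 2 * L" if "t \<in> {..<0}" for t
    proof -
      have t: "t < 0" using that by simp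
      have "norm ((1 - exp (\<epsilon> / t)) *\<^sub>R \<phi>' t) \<le> 1 * L"
        using e[OF t] d(3)[of t] t by (simp only: norm_scaleR) (intro mult_mono, auto)
      moreover have "norm ((\<epsilon> / t\<^sup>2 * exp (\<epsilon> / t)) *\<^sub>R \<phi> t) \<le> L"
      proof -
        have "\<epsilon> / \<bar>t\<bar> * exp (\<epsilon> / t) \<le> 1"
        proof -
          have "\<epsilon> / \<bar>t\<bar> \<le> exp (\<epsilon> / \<bar>t\<bar>)"
            using exp_ge_add_one_self[of "\<epsilon> / \<bar>t\<bar>"] by linarith
          then have "\<epsilon> / \<bar>t\<bar> * exp (- (\<epsilon> / \<bar>t\<bar>)) \<le> 1"
            using mult_right_mono[of "\<epsilon> / \<bar>t\<bar>" "exp (\<epsilon> / \<bar>t\<bar>)" "exp (- (\<epsilon> / \<bar>t\<bar>))"] by (simp flip: exp_add)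
          then show ?thesis using t by simp
        qed
        then have "(\<epsilon> / \<bar>t\<bar> * exp (\<epsilon> / t)) * L \<le> L"
          using mult_right_mono[of "\<epsilon> / \<bar>t\<bar> * exp (\<epsilon> / t)" 1 L] d(2) by simp
        have "norm ((\<epsilon> / t\<^sup>2 * exp (\<epsilon> / t)) *\<^sub>R \<phi> t) = \<epsilon> / t\<^sup>2 * exp (\<epsilon> / t) * norm (\<phi> t)"
          using \<epsilon> by simp
        also have "\<dots> \<le> \<epsilon> / t\<^sup>2 * exp (\<epsilon> / t) * (L * \<bar>t\<bar>)"
          using \<phi>L[of t] t \<epsilon> by (intro mult_left_mono) auto
        also have "\<dots> = (\<epsilon> / \<bar>t\<bar> * exp (\<epsilon> / t)) * L"
          using t by (simp add: power2_eq_square field_simps)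
        finally show ?thesis using \<open>(\<epsilon> / \<bar>t\<bar> * exp (\<epsilon> / t)) * L \<le> L\<close> by linarith
      qed
      ultimately show ?thesis unfolding g'_def by (intro norm_triangle_le) simp
    qed
    have lip0: "norm (?g \<epsilon> t) \<le> 2 * L * \<bar>t\<bar>" if "t \<le> 0" for t
    proof (cases "t = 0")
      case False
      then have t: "t < 0" using that by simp
      have "norm (?g \<epsilon> t) \<le> 1 * norm (\<phi> t)"
        unfolding g[OF t] norm_scaleR using e[OF t] by (intro mult_right_mono) auto
      then show ?thesis using \<phi>L[OF that] mult_nonneg_nonneg[of L "\<bar>t\<bar>"] d(2) by linarith
    qed (use g0 in auto)
    show "norm (?g \<epsilon> t - ?g \<epsilon> s) \<le> 2 * L * \<bar>t - s\<bar>" if st: "s \<le> 0" "t \<le> 0" for s t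
    proof -
      consider "s < 0" "t < 0" | "s = 0" | "t = 0" using st by linarith
      then show ?thesis
      proof cases
        case 1
        then show ?thesis
          by (intro norm_diff_le_of_vector_derivative[OF _ g' g'L]) auto
      next
        case 2
        then show ?thesis using lip0[OF st(2)] unfolding 2 g0 by simp
      next
        case 3
        then show ?thesis using lip0[OF st(1)] unfolding 3 g0 by (simp add: norm_minus_commute)
      qed
    qed
  qed (use d(2) in auto)
  then have ev: "\<forall>\<^sub>F n in sequentially. B_norm h (?g (1 / real (Suc n))) \<le> ennreal (?b (1 / real (Suc n)))"
    by (intro always_eventually allI) (metis of_nat_0_less_iff zero_less_Suc zero_less_divide_1_iff)
  have "(\<lambda>n. ennreal (?b (1 / real (Suc n)))) \<longlonglongrightarrow> ennreal 0"
  proof (intro tendsto_ennrealI tendsto_mult_left_zero)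
    have "(\<lambda>n. 2 * L * (1 / real (Suc n))) \<longlonglongrightarrow> 0"
      using LIMSEQ_inverse_real_of_nat by (intro tendsto_mult_right_zero) (simp add: inverse_eq_divide)
    then show "(\<lambda>n. (2 * L * (1 / real (Suc n))) powr ((1 + h) / 2)) \<longlonglongrightarrow> 0"
      by (rule tendsto_zero_powrI[OF _ tendsto_const]) (use h d(2) in auto)
  qed
  then have "(\<lambda>n. ennreal (?b (1 / real (Suc n)))) \<longlonglongrightarrow> 0" by (simp only: ennreal_0)
  from tendsto_sandwich[OF _ ev tendsto_const this]
  have "(\<lambda>n. B_norm h (?g (1 / real (Suc n)))) \<longlonglongrightarrow> 0" by simp
  from order_tendstoD(2)[OF this \<open>\<delta> > 0\<close>] obtain n where "B_norm h (?g (1 / real (Suc n))) < \<delta>"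
    by (auto simp: eventually_sequentially)
  then show ?thesis
    using \<psi>_C0[of "1 / real (Suc n)"] \<psi>_smooth[of "1 / real (Suc n)"] by (intro that) auto
qed

section \<open>Shifting and gluing as operations on the path space\<close>

lemma B_weight_shift:
  fixes s r t :: real
  assumes "t \<ge> 0"
  shows "sqrt (1 + (\<bar>s\<bar> + t) + (\<bar>r\<bar> + t)) \<le> sqrt (1 + 2 * t) * sqrt (1 + \<bar>s\<bar> + \<bar>r\<bar>)"
proof -
  have "1 + (\<bar>s\<bar> + t) + (\<bar>r\<bar> + t) \<le> (1 + 2 * t) * (1 + \<bar>s\<bar> + \<bar>r\<bar>)"
    using assms by (simp add: algebra_simps)
  then show ?thesis by (simp flip: real_sqrt_mult)
qed

text \<open>Common core of the estimates for shifting and gluing: the two times may move away from 0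
  by at most \<open>t\<close> each, but not away from each other, so only the square-root factor of
  the weight grows.\<close>

lemma B_norm_leD_shift:
  assumes f: "B_norm h f \<le> ennreal c" "c \<ge> 0" and t: "t \<ge> 0" and h: "h < 1"
    and u: "u \<le> 0" "v \<le> 0" "\<bar>u\<bar> \<le> \<bar>r\<bar> + t" "\<bar>v\<bar> \<le> \<bar>s\<bar> + t" "\<bar>u - v\<bar> \<le> \<bar>r - s\<bar>"
  shows "norm (f u - f v) \<le> sqrt (1 + 2 * t) * c * (sqrt (1 + \<bar>r\<bar> + \<bar>s\<bar>) * \<bar>r - s\<bar> powr ((1 - h) / 2))"
proof -
  have "norm (f u - f v) \<le> c * (sqrt (1 + \<bar>u\<bar> + \<bar>v\<bar>) * \<bar>u - v\<bar> powr ((1 - h) / 2))"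
    by (rule B_norm_leD[OF f u(2,1)])
  also have "\<dots> \<le> c * ((sqrt (1 + 2 * t) * sqrt (1 + \<bar>r\<bar> + \<bar>s\<bar>)) * \<bar>r - s\<bar> powr ((1 - h) / 2))"
  proof (intro mult_left_mono mult_mono powr_mono2 f(2))
    have "sqrt (1 + \<bar>u\<bar> + \<bar>v\<bar>) \<le> sqrt (1 + (\<bar>r\<bar> + t) + (\<bar>s\<bar> + t))"
      using u(3,4) by simp
    then show "sqrt (1 + \<bar>u\<bar> + \<bar>v\<bar>) \<le> sqrt (1 + 2 * t) * sqrt (1 + \<bar>r\<bar> + \<bar>s\<bar>)"
      using B_weight_shift[OF t, of r s] by linarith
  qed (use h t u in auto)
  finally show ?thesis by (simp add: mult_ac)
qed

lemma B_norm_path_shift: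
  assumes "B_norm h f \<le> ennreal c" "c \<ge> 0" "t \<ge> 0" "h < 1"
  shows "B_norm h (path_shift t f) \<le> ennreal (sqrt (1 + 2 * t) * c)"
proof (rule B_norm_leI)
  fix s r :: real assume sr: "s \<le> 0" "r \<le> 0"
  then have "norm (f (r - t) - f (s - t)) \<le>
      sqrt (1 + 2 * t) * c * (sqrt (1 + \<bar>r\<bar> + \<bar>s\<bar>) * \<bar>r - s\<bar> powr ((1 - h) / 2))"
    using assms(3) by (intro B_norm_leD_shift[OF assms]) auto
  then show "norm (path_shift t f r - path_shift t f s) \<le>
      sqrt (1 + 2 * t) * c * (sqrt (1 + \<bar>r\<bar> + \<bar>s\<bar>) * \<bar>r - s\<bar> powr ((1 - h) / 2))"
    using sr by (simp add: path_shift_def)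
qed (use assms in auto)

lemma B_norm_P_op:
  assumes f: "B_norm h f \<le> ennreal c" "f 0 = 0" and g: "B_norm h g \<le> ennreal c" "g 0 = 0"
    and c: "c \<ge> 0" "t \<ge> 0" "h < 1"
  shows "B_norm h (P_op t (f, g)) \<le> ennreal (2 * (sqrt (1 + 2 * t) * c))"
proof (rule B_norm_leI)
  define w where "w s r = sqrt (1 + 2 * t) * c * (sqrt (1 + \<bar>r\<bar> + \<bar>s\<bar>) * \<bar>r - s\<bar> powr ((1 - h) / 2))" for s r
  have w: "w s r \<ge> 0" "w s r = w r s" for s r
    using c by (auto simp: w_def abs_minus_commute add_ac)
  have fw: "norm (f u - f v) \<le> w s r" and gw: "norm (g u - g v) \<le> w s r"
    if "u \<le> 0" "v \<le> 0" "\<bar>u\<bar> \<le> \<bar>r\<bar> + t" "\<bar>v\<bar> \<le> \<bar>s\<bar> + t" "\<bar>u - v\<bar> \<le> \<bar>r - s\<bar>" for u v s r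
    unfolding w_def by (intro B_norm_leD_shift f g c that)+
  have le: "norm (P_op t (f, g) r - P_op t (f, g) s) \<le> 2 * w s r" if sr: "s \<le> r" "r \<le> 0" for s r
  proof -
    consider "- t \<le> s" | "r < - t" | "s < - t" "- t \<le> r" by linarith
    then show ?thesis
    proof cases
      case 1
      then have "norm (g (- r - t) - g (- s - t)) \<le> w s r"
        using sr by (intro gw) auto
      then show ?thesis using 1 sr w(1)[of s r] by auto
    next
      case 2
      then have "norm (f (r + t) - f (s + t)) \<le> w s r"
        using sr c by (intro fw) auto
      then show ?thesis using 2 sr w(1)[of s r] by auto
    next
      \<comment> \<open>The gluing time \<open>- t\<close> separates the two points: the increment
        splits there into one of \<open>f\<close> and one of \<open>g\<close>, each over a
        subinterval, which is the origin of the factor 2.\<close>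
      case 3
      then have "norm (f 0 - f (s + t)) \<le> w s r" "norm (g (- r - t) - g 0) \<le> w s r"
        using sr c by (intro fw gw, auto)+
      then have "norm ((g (- r - t) - g 0) + (f 0 - f (s + t))) \<le> w s r + w s r"
        by (intro norm_triangle_mono)
      then show ?thesis using 3 sr f(2) g(2) by auto
    qed
  qed
  fix s r :: real assume sr: "s \<le> 0" "r \<le> 0"
  have "norm (P_op t (f, g) r - P_op t (f, g) s) \<le> 2 * w s r"
    using le[of s r] le[of r s] sr w(2)[of s r] by (cases "s \<le> r") (auto simp: norm_minus_commute)
  then show "norm (P_op t (f, g) r - P_op t (f, g) s) \<le>
      2 * (sqrt (1 + 2 * t) * c) * (sqrt (1 + \<bar>r\<bar> + \<bar>s\<bar>) * \<bar>r - s\<bar> powr ((1 - h) / 2))"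
    by (simp add: w_def mult_ac)
qed (use c in auto)

lemma ennreal_pos_obtain_real:
  assumes "\<epsilon> > (0::ennreal)"
  obtains e where "e > 0" "ennreal e < \<epsilon>"
proof (cases \<epsilon>)
  case (real r)
  then show ?thesis using assms that[of "r / 2"] by (simp add: ennreal_less_iff)
next
  case top
  then show ?thesis using that[of 1] by simp
qed

text \<open>Shifting is bounded for the norm, so compactly supported paths suffice; their shifts are
  constant near minus infinity and belong to the space by truncation.\<close>

lemma path_shift_in_B_space:
  fixes \<omega> :: "'d::finite path"
  assumes h: "0 < h" "h < 1" and \<omega>: "\<omega> \<in> B_space h" and t: "t \<ge> 0"
  shows "path_shift t \<omega> \<in> B_space h"
proof (rule B_space_I_approx)
  show "path_shift t \<omega> s = 0" if "s \<ge> 0" for s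
    using that by (auto simp: path_shift_def)
  fix \<epsilon> :: ennreal assume "\<epsilon> > 0"
  define c where "c = sqrt (1 + 2 * t)"
  have c: "c > 0" using t by (simp add: c_def)
  obtain e where e: "e > 0" "ennreal e < \<epsilon>"
    using ennreal_pos_obtain_real[OF \<open>\<epsilon> > 0\<close>] by blast
  from B_space_approx[OF \<omega>, of "ennreal (e / c)"] e c obtain \<phi> where
    \<phi>: "\<phi> \<in> C0_inf" "B_norm h (\<lambda>s. \<omega> s - \<phi> s) < ennreal (e / c)" by auto
  obtain M where M: "\<And>s. s \<le> - M \<Longrightarrow> \<phi> s = 0" and sm: "smooth_on {..0} \<phi>"
    using \<phi>(1) by (auto simp: C0_inf_def smooth_neg_iff)
  have "(\<lambda>s. if s \<le> 0 then \<phi> (1 * s + - t) + (- \<phi> (- t)) else 0) \<in> B_space h"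
  proof (rule eventually_const_in_B_space[OF h, where M = M])
    show "smooth_on {..0} (\<lambda>s. \<phi> (1 * s + - t) + (- \<phi> (- t)))"
      using t by (intro smooth_on_add smooth_on_const smooth_on_affine[OF sm]) auto
    show "\<phi> (1 * s + - t) + (- \<phi> (- t)) = - \<phi> (- t)" if "s \<le> - M" for s
      using M[of "s - t"] t that by auto
  qed simp
  then have "path_shift t \<phi> \<in> B_space h"
    by (rule back_subst[of "\<lambda>x. x \<in> B_space h"]) (auto simp: path_shift_def)
  moreover have "B_norm h (\<lambda>s. path_shift t \<omega> s - path_shift t \<phi> s) < \<epsilon>"
  proof -
    have "B_norm h (\<lambda>s. path_shift t \<omega> s - path_shift t \<phi> s) = B_norm h (path_shift t (\<lambda>s. \<omega> s - \<phi> s))"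
      by (intro B_norm_cong) (auto simp: path_shift_def)
    also have "\<dots> \<le> ennreal (c * (e / c))"
      unfolding c_def
      by (rule B_norm_path_shift) (use \<phi>(2) e c t h in \<open>auto simp: c_def[symmetric] intro: less_imp_le\<close>)
    also have "\<dots> < \<epsilon>" using e c by simp
    finally show ?thesis .
  qed
  ultimately show "\<exists>\<eta>\<in>B_space h. B_norm h (\<lambda>s. path_shift t \<omega> s - \<eta> s) < \<epsilon>" by blast
qed

lemma B_space_flat_approx:
  fixes \<omega> :: "'d::finite path"
  assumes h: "0 < h" "h < 1" and \<omega>: "\<omega> \<in> B_space h" and "\<epsilon> > 0"
  obtains \<psi> where "\<psi> \<in> C0_inf" "smooth_on UNIV \<psi>" "B_norm h (\<lambda>t. \<omega> t - \<psi> t) < \<epsilon>"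
proof -
  have e: "\<epsilon> / 2 > 0" using \<open>\<epsilon> > 0\<close> by (simp add: ennreal_zero_less_divide)
  from B_space_approx[OF \<omega> e] obtain \<phi> where \<phi>: "\<phi> \<in> C0_inf" "B_norm h (\<lambda>t. \<omega> t - \<phi> t) < \<epsilon> / 2" .
  from C0_inf_flat_dense[OF h \<phi>(1) e] obtain \<psi> where
    \<psi>: "\<psi> \<in> C0_inf" "smooth_on UNIV \<psi>" "B_norm h (\<lambda>t. \<phi> t - \<psi> t) < \<epsilon> / 2" .
  have "B_norm h (\<lambda>t. \<omega> t - \<psi> t) < \<epsilon> / 2 + \<epsilon> / 2"
    by (rule le_less_trans[OF B_norm_triangle add_strict_mono[OF \<phi>(2) \<psi>(3)]])
  also have "\<epsilon> / 2 + \<epsilon> / 2 = \<epsilon>"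
    unfolding add_divide_distrib_ennreal[symmetric] unfolding mult_2_right[symmetric]
    by (rule mult_divide_eq_ennreal) auto
  finally show ?thesis using \<psi> by (intro that)
qed

lemma P_op_in_B_space:
  fixes \<omega>m \<omega>p :: "'d::finite path"
  assumes h: "0 < h" "h < 1" and \<omega>: "\<omega>m \<in> B_space h" "\<omega>p \<in> B_space h" and t: "t \<ge> 0"
  shows "P_op t (\<omega>m, \<omega>p) \<in> B_space h"
proof (rule B_space_I_approx)
  show "P_op t (\<omega>m, \<omega>p) s = 0" if "s \<ge> 0" for s
    using that t by auto
  fix \<epsilon> :: ennreal assume "\<epsilon> > 0"
  define c where "c = 2 * sqrt (1 + 2 * t)"
  have c: "c > 0" using t by (simp add: c_def)
  obtain e where e: "e > 0" "ennreal e < \<epsilon>"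
    using ennreal_pos_obtain_real[OF \<open>\<epsilon> > 0\<close>] by blast
  have ec: "ennreal (e / c) > 0" using e c by auto
  from B_space_flat_approx[OF h \<omega>(1) ec] obtain \<phi> where
    \<phi>: "\<phi> \<in> C0_inf" "smooth_on UNIV \<phi>" "B_norm h (\<lambda>s. \<omega>m s - \<phi> s) < ennreal (e / c)" .
  from B_space_flat_approx[OF h \<omega>(2) ec] obtain \<psi> where
    \<psi>: "\<psi> \<in> C0_inf" "smooth_on UNIV \<psi>" "B_norm h (\<lambda>s. \<omega>p s - \<psi> s) < ennreal (e / c)" .
  obtain M where M: "\<And>s. s \<le> - M \<Longrightarrow> \<phi> s = 0" using \<phi>(1) by (auto simp: C0_inf_def)
  have z: "\<And>s. s \<ge> 0 \<Longrightarrow> \<phi> s = 0" "\<And>s. s \<ge> 0 \<Longrightarrow> \<psi> s = 0" using \<phi>(1) \<psi>(1) by (auto simp: C0_inf_def)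
  \<comment> \<open>Both approximants are smooth on the whole line and vanish at nonnegative times,
    so the two branches of \<open>P_op\<close> merge into a sum: of \<open>\<phi> (s + t)\<close>
    and \<open>\<psi> (- s - t)\<close> at least one is 0 for each \<open>s\<close>.\<close>
  have "(\<lambda>s. if s \<le> 0 then \<phi> (1 * s + t) + (\<psi> ((-1) * s + (- t)) + (- \<psi> (- t))) else 0) \<in> B_space h"
  proof (rule eventually_const_in_B_space[OF h, where M = "max (M + t) t"])
    show "smooth_on {..0} (\<lambda>s. \<phi> (1 * s + t) + (\<psi> ((-1) * s + (- t)) + (- \<psi> (- t))))"
      by (intro smooth_on_add smooth_on_const smooth_on_affine[OF \<phi>(2)] smooth_on_affine[OF \<psi>(2)]) auto
    show "\<phi> (1 * s + t) + (\<psi> ((-1) * s + (- t)) + (- \<psi> (- t))) = - \<psi> (- t)" if "s \<le> - max (M + t) t" for s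
      using M[of "s + t"] z(2)[of "- s - t"] that by auto
  qed (use z t in auto)
  then have "P_op t (\<phi>, \<psi>) \<in> B_space h"
    by (rule back_subst[of "\<lambda>x. x \<in> B_space h"]) (auto simp: z)
  moreover have "B_norm h (\<lambda>s. P_op t (\<omega>m, \<omega>p) s - P_op t (\<phi>, \<psi>) s) < \<epsilon>"
  proof -
    have "B_norm h (\<lambda>s. P_op t (\<omega>m, \<omega>p) s - P_op t (\<phi>, \<psi>) s)
        = B_norm h (P_op t (\<lambda>s. \<omega>m s - \<phi> s, \<lambda>s. \<omega>p s - \<psi> s))"
      by (intro B_norm_cong) auto
    also have "\<dots> \<le> ennreal (2 * (sqrt (1 + 2 * t) * (e / c)))"
      by (rule B_norm_P_op) (use \<phi>(3) \<psi>(3) \<omega> z e c t h in \<open>auto simp: B_space_vanish intro: less_imp_le\<close>)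
    also have "2 * (sqrt (1 + 2 * t) * (e / c)) = c * (e / c)" by (simp add: c_def)
    also have "ennreal (c * (e / c)) < \<epsilon>" using e c by simp
    finally show ?thesis .
  qed
  ultimately show "\<exists>\<eta>\<in>B_space h. B_norm h (\<lambda>s. P_op t (\<omega>m, \<omega>p) s - \<eta> s) < \<epsilon>" by blast
qed

text \<open>The shift discards the piece contributed by \<open>\<omega>p\<close> and recovers the
  past from the glued path; invariance of the attractor is read off along this identity.\<close>

lemma path_shift_P_op:
  assumes "t \<ge> 0" "\<And>s. s \<ge> 0 \<Longrightarrow> \<omega>m s = 0" "\<And>s. s \<ge> 0 \<Longrightarrow> \<omega>p s = 0"
  shows "path_shift t (P_op t (\<omega>m, \<omega>p)) = \<omega>m"
proof
  fix s show "path_shift t (P_op t (\<omega>m, \<omega>p)) s = \<omega>m s"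
    using assms by (cases "s < 0"; cases "s = 0") (auto simp: path_shift_def)
qed

text \<open>All glued paths up to the horizon \<open>t\<close> are shifts of a single one, so the
  noise on \<open>{0..t}\<close> can be read off one path.\<close>

lemma path_shift_P_op_le:
  assumes "0 \<le> s" "s \<le> t" "\<And>s. s \<ge> 0 \<Longrightarrow> \<omega>m s = 0" "\<And>s. s \<ge> 0 \<Longrightarrow> \<omega>p s = 0"
  shows "path_shift (t - s) (P_op t (\<omega>m, \<omega>p)) = P_op s (\<omega>m, \<omega>p)"
proof
  fix r show "path_shift (t - s) (P_op t (\<omega>m, \<omega>p)) r = P_op s (\<omega>m, \<omega>p) r"
    using assms by (auto simp: path_shift_def algebra_simps)
qed

lemma P_op_theta_neg:
  assumes "t \<ge> 0" "\<And>s. s \<ge> 0 \<Longrightarrow> \<omega> s = 0"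
  shows "P_op t (theta (- t) (\<omega>, \<lambda>_. 0)) = \<omega>"
proof
  fix s show "P_op t (theta (- t) (\<omega>, \<lambda>_. 0)) s = \<omega> s"
    using assms by (cases "t = 0"; cases "s \<le> 0") (auto simp: path_shift_def)
qed

section \<open>The operator D commutes with shifts\<close>

lemma at_within_atMost_neq_bot:
  fixes x b :: real
  assumes "x \<le> b"
  shows "at x within {..b} \<noteq> bot"
proof -
  have "{..<x} \<subseteq> {..b}" using assms by auto
  then show ?thesis
    using at_le[of "{..<x}" "{..b}" x] trivial_limit_at_left_real[of x] bot.extremum_uniqueI by fastforce
qed

section \<open>Integrals against the fractional kernel\<close>

lemma has_integral_vanish_off:
  fixes f :: "'n::euclidean_space \<Rightarrow> 'a::banach"
  assumes "S \<subseteq> T" "\<And>x. x \<in> T - S \<Longrightarrow> f x = 0"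
  shows "(f has_integral i) T \<longleftrightarrow> (f has_integral i) S"
proof -
  have "(f has_integral i) T \<longleftrightarrow> ((\<lambda>x. if x \<in> S then f x else 0) has_integral i) T"
    using assms(2) by (intro has_integral_cong) auto
  then show ?thesis using assms(1) by simp
qed

lemma integrable_powr_neg:
  fixes p M :: real
  assumes "p > -1" "M \<ge> 0"
  shows "((\<lambda>r. (- r) powr p) has_integral (M powr (p + 1) / (p + 1))) {-M..0}"
proof -
  have "((\<lambda>r. r powr p) has_integral (M powr (p + 1) / (p + 1))) (cbox 0 M)"
    using has_integral_powr_from_0[OF assms] by simp
  from has_integral_reflect_lemma[OF this] show ?thesis by simp
qed

text \<open>For \<open>H < 1 / 2\<close> the kernel with \<open>p = H - 1 / 2\<close> is singular at
  0 but integrable there. Since \<open>g\<close> vanishes far to the left, only a bounded interval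
  matters, on which an integrable kernel is multiplied by a bounded continuous function.\<close>

lemma kernel_integrable:
  fixes g :: "real \<Rightarrow> 'a::euclidean_space"
  assumes p: "p > -1" and g: "continuous_on {..0} g" "\<And>r. r \<le> - M \<Longrightarrow> g r = 0"
  shows "(\<lambda>r. (- r) powr p *\<^sub>R g r) integrable_on {..0}"
proof -
  define m where "m = max M 0"
  have "(\<lambda>r. (- r) powr p) absolutely_integrable_on {-m..0}"
    using integrable_powr_neg[OF p, of m]
    by (intro nonnegative_absolutely_integrable_1) (auto simp: m_def integrable_on_def)
  moreover have "continuous_on {-m..0} g"
    by (rule continuous_on_subset[OF g(1)]) auto
  moreover from this have "bounded (g ` {-m..0})"
    by (intro compact_imp_bounded compact_continuous_image) auto
  ultimately have "(\<lambda>r. (- r) powr p *\<^sub>R g r) absolutely_integrable_on {-m..0}"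
    using bounded_bilinear.flip[OF bounded_bilinear_scaleR]
    by (intro absolutely_integrable_bounded_measurable_product[where h = "\<lambda>v r. r *\<^sub>R v"])
       (auto simp: bilinear_conv_bounded_bilinear intro!: continuous_imp_measurable_on_sets_lebesgue)
  then have "(\<lambda>r. (- r) powr p *\<^sub>R g r) integrable_on {-m..0}"
    by (simp add: absolutely_integrable_on_def)
  then show ?thesis
    unfolding integrable_on_def
    by (subst has_integral_vanish_off[of "{-m..0}"]) (use g(2) in \<open>auto simp: m_def\<close>)
qed

lemma kernel_difference_integrable:
  fixes g :: "real \<Rightarrow> 'a::euclidean_space"
  assumes p: "p > -1" and g: "continuous_on {..0} g" "\<And>r. r \<le> - M \<Longrightarrow> g r = 0" and s: "s \<le> 0" "M \<ge> 0"
  shows "(\<lambda>r. (- r) powr p *\<^sub>R (g (s + r) - g r)) integrable_on {..0}"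
proof (rule kernel_integrable[OF p, where M = M])
  show "continuous_on {..0} (\<lambda>r. g (s + r) - g r)"
    using s by (intro continuous_intros g(1) continuous_on_compose2[OF g(1)]) auto
qed (use g(2) s in auto)

lemma D_int_eq:
  assumes "\<And>t. t \<le> 0 \<Longrightarrow> (\<omega> has_vector_derivative \<omega>' t) (at t within {..0})" "s \<le> 0"
  shows "D_int H \<alpha> \<omega> s =
    (1 / \<alpha>) *\<^sub>R integral {..0} (\<lambda>r. (- r) powr (H - 1 / 2) *\<^sub>R (\<omega>' (s + r) - \<omega>' r))"
proof -
  have "vector_derivative \<omega> (at t within {..0}) = \<omega>' t" if "t \<le> 0" for t
    by (rule vector_derivative_within[OF at_within_atMost_neq_bot[OF that] assms(1)[OF that]])
  then show ?thesis
    unfolding D_int_def using assms(2) by (auto intro!: integral_cong arg_cong[where f = "\<lambda>x. (1 / \<alpha>) *\<^sub>R x"])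
qed

text \<open>The difference of derivatives is at most \<open>K * \<bar>s\<bar> / n\<^sup>2\<close> on
  \<open>{- n..0}\<close> and zero further left, and the kernel has mass of order
  \<open>n powr (H + 1 / 2)\<close> there, so the integral is of order
  \<open>n powr (H - 3 / 2)\<close>. Bounding the derivative itself by a multiple of
  \<open>1 / n\<close> would leave \<open>n powr (H - 1 / 2)\<close>, which does not decay for
  \<open>H \<ge> 1 / 2\<close>.\<close>

lemma cutoff_kernel_tendsto_0:
  assumes H: "0 < H" "H < 1" and s: "s \<le> 0"
    and c': "\<And>n. n > 0 \<Longrightarrow> continuous_on UNIV (c' n)" "\<And>n t. n > 0 \<Longrightarrow> t \<le> - n \<Longrightarrow> c' n t = 0"
      "\<And>n s t. n > 0 \<Longrightarrow> s \<le> 0 \<Longrightarrow> t \<le> 0 \<Longrightarrow> \<bar>c' n t - c' n s\<bar> \<le> K / n\<^sup>2 * \<bar>t - s\<bar>"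
  shows "(\<lambda>n. integral {..0} (\<lambda>r. (- r) powr (H - 1 / 2) * (c' (real n) (s + r) - c' (real n) r))) \<longlonglongrightarrow> 0"
    (is "?R \<longlonglongrightarrow> 0")
proof (rule Lim_null_comparison)
  let ?p = "H - 1 / 2"
  have bd: "norm (?R n) \<le> K * \<bar>s\<bar> / (H + 1 / 2) * real n powr (H - 3 / 2)" if n: "n \<ge> 1" for n
  proof -
    have cont: "continuous_on {..0} (c' (real n))"
      using c'(1)[of "real n"] n by (auto intro: continuous_on_subset)
    have int: "(\<lambda>r. (- r) powr ?p * (c' (real n) (s + r) - c' (real n) r)) integrable_on {..0}"
      using kernel_difference_integrable[of ?p "c' (real n)" "real n" s] cont c'(2)[of n] n s H by simp
    have vanish: "((\<lambda>r. (- r) powr ?p * (c' (real n) (s + r) - c' (real n) r)) has_integral i) {..0} \<longleftrightarrow>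
        ((\<lambda>r. (- r) powr ?p * (c' (real n) (s + r) - c' (real n) r)) has_integral i) {- real n..0}" for i
      by (rule has_integral_vanish_off) (use c'(2)[of n] n s in auto)
    then have sub: "?R n = integral {- real n..0} (\<lambda>r. (- r) powr ?p * (c' (real n) (s + r) - c' (real n) r))"
      by (simp add: integral_def integrable_on_def)
    have int': "(\<lambda>r. (- r) powr ?p * (c' (real n) (s + r) - c' (real n) r)) integrable_on {- real n..0}"
      using int vanish by (simp add: integrable_on_def)
    have hi: "((\<lambda>r. (- r) powr ?p * (K / (real n)\<^sup>2 * \<bar>s\<bar>)) has_integral
        (real n powr (?p + 1) / (?p + 1)) * (K / (real n)\<^sup>2 * \<bar>s\<bar>)) {- real n..0}"
      by (intro has_integral_mult_left integrable_powr_neg) (use H in auto)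
    have "norm (?R n) \<le> integral {- real n..0} (\<lambda>r. (- r) powr ?p * (K / (real n)\<^sup>2 * \<bar>s\<bar>))"
      unfolding sub
    proof (rule integral_norm_bound_integral[OF int'])
      show "(\<lambda>r. (- r) powr ?p * (K / (real n)\<^sup>2 * \<bar>s\<bar>)) integrable_on {- real n..0}"
        using hi by (auto simp: integrable_on_def)
      fix r assume "r \<in> {- real n..0}"
      then have "\<bar>c' (real n) (s + r) - c' (real n) r\<bar> \<le> K / (real n)\<^sup>2 * \<bar>s\<bar>"
        using c'(3)[of n r "s + r"] n s by simp
      then show "norm ((- r) powr ?p * (c' (real n) (s + r) - c' (real n) r)) \<le> (- r) powr ?p * (K / (real n)\<^sup>2 * \<bar>s\<bar>)"
        unfolding norm_mult by (intro mult_mono) auto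
    qed
    also have "\<dots> = (real n powr (?p + 1) / (?p + 1)) * (K / (real n)\<^sup>2 * \<bar>s\<bar>)"
      using hi by (rule integral_unique)
    also have "\<dots> = K * \<bar>s\<bar> / (H + 1 / 2) * (real n powr (?p + 1) / (real n)\<^sup>2)"
    proof -
      have "?p + 1 = H + 1 / 2" by simp
      then show ?thesis by (simp only:) (simp add: mult_ac)
    qed
    also have "real n powr (?p + 1) / (real n)\<^sup>2 = real n powr (H - 3 / 2)"
      using n powr_diff[of "real n" "?p + 1" 2] by (simp add: powr_numeral)
    finally show ?thesis .
  qed
  then show "\<forall>\<^sub>F n in sequentially. norm (?R n) \<le> K * \<bar>s\<bar> / (H + 1 / 2) * real n powr (H - 3 / 2)"
    unfolding eventually_sequentially by blast
  have "(\<lambda>n. real n powr (H - 3 / 2)) \<longlonglongrightarrow> 0"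
    using H by (intro tendsto_neg_powr filterlim_real_sequentially) auto
  then show "(\<lambda>n. K * \<bar>s\<bar> / (H + 1 / 2) * real n powr (H - 3 / 2)) \<longlonglongrightarrow> 0"
    by (rule tendsto_mult_right_zero)
qed

text \<open>
  The shift of \<open>\<phi>\<close> is constant near \<open>-\<infinity>\<close>; on its truncations \<open>D_int\<close> is the shift of
  \<open>D_int H \<alpha> \<phi>\<close> up to a term of order \<open>n powr (H - 3 / 2)\<close>.
\<close>

lemma D_int_shift_tendsto:
  fixes \<phi> :: "'d::finite path"
  assumes H: "0 < H" "H < 1" and \<phi>: "\<phi> \<in> C0_inf" and t: "t \<ge> 0" and s: "s \<le> 0"
  shows "(\<lambda>n. D_int H \<alpha> (\<lambda>r. if r \<le> 0 then (\<phi> (r - t) - \<phi> (- t)) - cutoff (real n) r *\<^sub>R (- \<phi> (- t)) else 0) s)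
    \<longlonglongrightarrow> D_int H \<alpha> \<phi> (s - t) - D_int H \<alpha> \<phi> (- t)"
proof -
  let ?p = "H - 1 / 2"
  define c where "c = - \<phi> (- t)"
  obtain \<phi>' M where \<phi>': "\<And>t. t \<le> 0 \<Longrightarrow> (\<phi> has_vector_derivative \<phi>' t) (at t within {..0})"
    "continuous_on {..0} \<phi>'" "M > 0" "\<And>t. t \<le> - M \<Longrightarrow> \<phi>' t = 0"
    by (rule C0_inf_derivative[OF \<phi>]) (rule that)
  obtain c' K where c': "\<And>n t. n > 0 \<Longrightarrow> (cutoff n has_real_derivative c' n t) (at t)"
    "\<And>n. n > 0 \<Longrightarrow> continuous_on UNIV (c' n)" "\<And>n t. n > 0 \<Longrightarrow> t \<le> - n \<Longrightarrow> c' n t = 0"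
    "\<And>n s t. n > 0 \<Longrightarrow> s \<le> 0 \<Longrightarrow> t \<le> 0 \<Longrightarrow> \<bar>c' n t - c' n s\<bar> \<le> K / n\<^sup>2 * \<bar>t - s\<bar>"
    by (rule cutoff_derivative) (rule that)
  define R where "R n = integral {..0} (\<lambda>r. (- r) powr ?p * (c' (real n) (s + r) - c' (real n) r))" for n
  have R: "R \<longlonglongrightarrow> 0"
    unfolding R_def by (rule cutoff_kernel_tendsto_0[OF H s c'(2,3,4)])
  let ?f = "\<lambda>n r. if r \<le> 0 then (\<phi> (r - t) - \<phi> (- t)) - cutoff (real n) r *\<^sub>R c else 0"
  have eq: "D_int H \<alpha> (?f n) s = D_int H \<alpha> \<phi> (s - t) - D_int H \<alpha> \<phi> (- t) - (1 / \<alpha>) *\<^sub>R (R n *\<^sub>R c)"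
    if n: "n \<ge> 1" for n
  proof -
    define f' where "f' r = \<phi>' (r - t) - c' (real n) r *\<^sub>R c" for r
    have f': "(?f n has_vector_derivative f' r) (at r within {..0})" if r: "r \<le> 0" for r
    proof -
      have a: "((\<lambda>r. r - t) has_vector_derivative 1) (at r within {..0})"
        by (auto intro!: derivative_eq_intros)
      have "(\<phi> has_vector_derivative \<phi>' (r - t)) (at (r - t) within (\<lambda>r. r - t) ` {..0})"
        using r t by (intro has_vector_derivative_within_subset[OF \<phi>'(1)]) auto
      from vector_diff_chain_within[OF a this]
      have b: "((\<lambda>r. \<phi> (r - t)) has_vector_derivative \<phi>' (r - t)) (at r within {..0})"
        by (simp add: o_def)
      have d: "(cutoff (real n) has_real_derivative c' (real n) r) (at r within {..0})"
        using c'(1)[of "real n" r] n by (auto intro: has_field_derivative_at_within)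
      have "((\<lambda>r. (\<phi> (r - t) - \<phi> (- t)) - cutoff (real n) r *\<^sub>R c) has_vector_derivative f' r) (at r within {..0})"
        unfolding f'_def using b d by (auto intro!: derivative_eq_intros)
      then show ?thesis
        by (rule has_vector_derivative_transform[rotated 2]) (use r in auto)
    qed
    have i1: "(\<lambda>r. (- r) powr ?p *\<^sub>R (\<phi>' (u + r) - \<phi>' r)) integrable_on {..0}" if "u \<le> 0" for u
      using kernel_difference_integrable[of ?p \<phi>' M u] \<phi>' that H by simp
    have cont: "continuous_on {..0} (c' (real n))"
      using c'(2)[of "real n"] n by (auto intro: continuous_on_subset)
    have i2: "(\<lambda>r. (- r) powr ?p * (c' (real n) (s + r) - c' (real n) r)) integrable_on {..0}"
      using kernel_difference_integrable[of ?p "c' (real n)" "real n" s] cont c'(3)[of n] n s H by simp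
    \<comment> \<open>The kernel integrands for the times \<open>s - t\<close> and
      \<open>- t\<close> are subtracted: the terms \<open>\<phi>' r\<close> cancel and leave the
      integrand of the shifted path. The third term is the contribution of the cutoff.\<close>
    have "((\<lambda>r. (- r) powr ?p *\<^sub>R (\<phi>' ((s - t) + r) - \<phi>' r) - (- r) powr ?p *\<^sub>R (\<phi>' (- t + r) - \<phi>' r)
          - ((- r) powr ?p * (c' (real n) (s + r) - c' (real n) r)) *\<^sub>R c) has_integral
        (integral {..0} (\<lambda>r. (- r) powr ?p *\<^sub>R (\<phi>' ((s - t) + r) - \<phi>' r))
        - integral {..0} (\<lambda>r. (- r) powr ?p *\<^sub>R (\<phi>' (- t + r) - \<phi>' r)) - R n *\<^sub>R c)) {..0}"
      unfolding R_def
      by (intro has_integral_diff has_integral_scaleR_left integrable_integral i1 i2) (use s t in auto)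
    then have "((\<lambda>r. (- r) powr ?p *\<^sub>R (f' (s + r) - f' r)) has_integral
        (integral {..0} (\<lambda>r. (- r) powr ?p *\<^sub>R (\<phi>' ((s - t) + r) - \<phi>' r))
        - integral {..0} (\<lambda>r. (- r) powr ?p *\<^sub>R (\<phi>' (- t + r) - \<phi>' r)) - R n *\<^sub>R c)) {..0}"
      by (rule has_integral_eq[rotated]) (simp add: f'_def algebra_simps)
    then have "integral {..0} (\<lambda>r. (- r) powr ?p *\<^sub>R (f' (s + r) - f' r)) =
        integral {..0} (\<lambda>r. (- r) powr ?p *\<^sub>R (\<phi>' ((s - t) + r) - \<phi>' r))
        - integral {..0} (\<lambda>r. (- r) powr ?p *\<^sub>R (\<phi>' (- t + r) - \<phi>' r)) - R n *\<^sub>R c"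
      by (rule integral_unique)
    then show ?thesis
      using D_int_eq[of "?f n" f' s H \<alpha>] f' s t D_int_eq[of \<phi> \<phi>' "s - t" H \<alpha>] D_int_eq[of \<phi> \<phi>' "- t" H \<alpha>] \<phi>'(1)
      by (simp add: scaleR_diff_right)
  qed
  have "(\<lambda>n. D_int H \<alpha> \<phi> (s - t) - D_int H \<alpha> \<phi> (- t) - (1 / \<alpha>) *\<^sub>R (R n *\<^sub>R c))
      \<longlonglongrightarrow> D_int H \<alpha> \<phi> (s - t) - D_int H \<alpha> \<phi> (- t) - (1 / \<alpha>) *\<^sub>R (0 *\<^sub>R c)"
    by (intro tendsto_intros R)
  moreover have "\<forall>\<^sub>F n in sequentially. D_int H \<alpha> \<phi> (s - t) - D_int H \<alpha> \<phi> (- t) - (1 / \<alpha>) *\<^sub>R (R n *\<^sub>R c)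
      = D_int H \<alpha> (?f n) s"
    unfolding eventually_sequentially by (intro exI[of _ 1] allI impI) (rule eq[symmetric])
  ultimately have "(\<lambda>n. D_int H \<alpha> (?f n) s) \<longlonglongrightarrow> D_int H \<alpha> \<phi> (s - t) - D_int H \<alpha> \<phi> (- t) - (1 / \<alpha>) *\<^sub>R (0 *\<^sub>R c)"
    by (rule Lim_transform_eventually)
  then show ?thesis by (simp only: c_def scaleR_zero_left scaleR_zero_right diff_0_right)
qed

text \<open>Target paths vanish at time 0, so the target metric dominates the difference of their
  values at each fixed time.\<close>

lemma B_top_continuous_pointwise:
  fixes D :: "'d::finite path \<Rightarrow> 'd path"
  assumes h: "0 < h" "h < 1" and k: "0 < k" "k < 1" and D: "continuous_map (B_top h) (B_top k) D"
    and \<omega>: "\<omega> \<in> B_space h" "\<And>n. W n \<in> B_space h" "(\<lambda>n. B_norm h (\<lambda>t. \<omega> t - W n t)) \<longlonglongrightarrow> 0"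
  shows "(\<lambda>n. D (W n) s) \<longlonglongrightarrow> D \<omega> s"
proof -
  have dist: "(\<lambda>n. B_dist h \<omega> (W n)) \<longlonglongrightarrow> 0"
    unfolding B_dist_def using tendsto_enn2real[OF \<omega>(3)[folded ennreal_0]] by simp
  have inB: "D \<omega> \<in> B_space k" "\<And>n. D (W n) \<in> B_space k"
    using continuous_map_B_top_D(1)[OF h k D] \<omega> by auto
  have Ddist: "(\<lambda>n. B_dist k (D \<omega>) (D (W n))) \<longlonglongrightarrow> 0"
  proof (rule order_tendstoI)
    fix e :: real assume "e > 0"
    from continuous_map_B_top_D(2)[OF h k D \<omega>(1) this] obtain \<delta> where
      \<delta>: "\<delta> > 0" "\<And>\<eta>. \<eta> \<in> B_space h \<Longrightarrow> B_dist h \<omega> \<eta> < \<delta> \<Longrightarrow> B_dist k (D \<omega>) (D \<eta>) < e" by blast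
    show "\<forall>\<^sub>F n in sequentially. B_dist k (D \<omega>) (D (W n)) < e"
      using order_tendstoD(2)[OF dist \<delta>(1)] by eventually_elim (rule \<delta>(2)[OF \<omega>(2)])
  next
    fix e :: real assume "e < 0"
    then have "e < B_dist k (D \<omega>) (D (W n))" for n
      by (simp add: B_dist_def less_le_trans)
    then show "\<forall>\<^sub>F n in sequentially. e < B_dist k (D \<omega>) (D (W n))" by simp
  qed
  show ?thesis
  proof (cases "s \<le> 0")
    case True
    have "norm (D (W n) s - D \<omega> s) \<le> B_dist k (D \<omega>) (D (W n)) * (sqrt (1 + \<bar>s\<bar>) * \<bar>s\<bar> powr ((1 - k) / 2))" for n
      using B_dist_bound[OF k inB(1) inB(2)[of n] True] by (simp add: norm_minus_commute)
    then have "(\<lambda>n. D (W n) s - D \<omega> s) \<longlonglongrightarrow> 0"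
      by (rule Lim_null_comparison[OF always_eventually[OF allI] tendsto_mult_left_zero[OF Ddist]])
    then show ?thesis by (simp add: LIM_zero_iff)
  next
    case False
    then have "D \<omega> s = 0" "\<And>n. D (W n) s = 0"
      using B_space_vanish[OF inB(1)] B_space_vanish[OF inB(2)] by auto
    then show ?thesis by simp
  qed
qed

text \<open>Two density arguments. For \<open>\<phi>\<close> in \<open>C0_inf\<close> the shifted
  path need not be in \<open>C0_inf\<close>, so \<open>D\<close> of it is identified as the limit of
  \<open>D_int\<close> along truncations. A general path is then approximated by elements of
  \<open>C0_inf\<close>, since shifting and \<open>D\<close> are both continuous.\<close>

lemma D_path_shift:
  fixes D :: "'d::finite path \<Rightarrow> 'd path"
  assumes H: "0 < H" "H < 1" and D: "continuous_map (B_top H) (B_top (1 - H)) D"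
    and Dint: "\<And>\<omega>. \<omega> \<in> C0_inf \<Longrightarrow> D \<omega> = D_int H \<alpha> \<omega>"
    and \<omega>: "\<omega> \<in> B_space H" and t: "t \<ge> 0"
  shows "D (path_shift t \<omega>) = path_shift t (D \<omega>)"
proof -
  have H': "0 < 1 - H" "1 - H < 1" using H by auto
  note pw = B_top_continuous_pointwise[OF H H' D]
  have C0: "D (path_shift t \<phi>) = path_shift t (D \<phi>)" if \<phi>: "\<phi> \<in> C0_inf" for \<phi>
  proof
    fix s
    have \<phi>B: "\<phi> \<in> B_space H" using \<phi> C0_inf_subset_B_space by blast
    show "D (path_shift t \<phi>) s = path_shift t (D \<phi>) s"
    proof (cases "s \<le> 0")
      case True
      obtain M where M: "\<And>s. s \<le> - M \<Longrightarrow> \<phi> s = 0" and sm: "smooth_on {..0} \<phi>"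
        using \<phi> by (auto simp: C0_inf_def smooth_neg_iff)
      let ?f = "\<lambda>s. \<phi> (s - t) - \<phi> (- t)"
      let ?W = "\<lambda>n r. if r \<le> 0 then ?f r - cutoff (real n) r *\<^sub>R (- \<phi> (- t)) else 0"
      have W: "?W n \<in> C0_inf" if "n \<ge> 1" for n
      proof (rule far_cutoff_in_C0_inf[where M = M])
        have "smooth_on {..0} (\<lambda>s. \<phi> (1 * s + - t) + (- \<phi> (- t)))"
          using t by (intro smooth_on_add smooth_on_const smooth_on_affine[OF sm]) auto
        then show "smooth_on {..0} ?f" by simp
        show "?f s = - \<phi> (- t)" if "s \<le> - M" for s using M[of "s - t"] that t by simp
      qed (use that in auto)
      have ps: "path_shift t \<phi> = (\<lambda>s. if s \<le> 0 then ?f s else 0)"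
        by (auto simp: path_shift_def)
      have "(\<lambda>n. B_norm H (\<lambda>s. path_shift t \<phi> s - ?W (Suc n) s)) \<longlonglongrightarrow> 0"
        unfolding ps by (rule LIMSEQ_Suc[OF B_norm_far_cutoff_tendsto_0[OF H]])
      then have "(\<lambda>n. D (?W (Suc n)) s) \<longlonglongrightarrow> D (path_shift t \<phi>) s"
        using W C0_inf_subset_B_space by (intro pw path_shift_in_B_space[OF H \<phi>B t]) auto
      moreover have "(\<lambda>n. D (?W (Suc n)) s) \<longlonglongrightarrow> D \<phi> (s - t) - D \<phi> (- t)"
        using LIMSEQ_Suc[OF D_int_shift_tendsto[OF H \<phi> t True, of \<alpha>]] Dint[OF W] Dint[OF \<phi>] by simp
      ultimately show ?thesis
        using True LIMSEQ_unique by (fastforce simp: path_shift_def)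
    next
      case False
      have "D (path_shift t \<phi>) \<in> B_space (1 - H)"
        by (rule continuous_map_B_top_D(1)[OF H H' D path_shift_in_B_space[OF H \<phi>B t]])
      then show ?thesis using False by (simp add: B_space_vanish path_shift_def)
    qed
  qed
  have "\<exists>\<phi>\<in>C0_inf. B_norm H (\<lambda>t. \<omega> t - \<phi> t) < ennreal (1 / real (Suc n))" for n
    using B_space_approx[OF \<omega>, of "ennreal (1 / real (Suc n))"] by (metis ennreal_less_zero_iff of_nat_0_less_iff zero_less_Suc zero_less_divide_1_iff)
  then obtain W where W: "\<And>n. W n \<in> C0_inf" "\<And>n. B_norm H (\<lambda>t. \<omega> t - W n t) < ennreal (1 / real (Suc n))"
    by metis
  have WB: "W n \<in> B_space H" for n using W C0_inf_subset_B_space by blast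
  have lim: "(\<lambda>n. ennreal (C * (1 / real (Suc n)))) \<longlonglongrightarrow> 0" for C
    using tendsto_ennrealI[OF tendsto_mult_right_zero[OF LIMSEQ_inverse_real_of_nat, of C]]
    by (simp add: inverse_eq_divide)
  have "(\<lambda>n. B_norm H (\<lambda>t. \<omega> t - W n t)) \<longlonglongrightarrow> 0"
    by (rule tendsto_sandwich[OF _ _ tendsto_const lim[of 1]])
       (use less_imp_le[OF W(2)] in \<open>auto simp del: of_nat_Suc\<close>)
  then have a: "(\<lambda>n. D (W n) r) \<longlonglongrightarrow> D \<omega> r" for r
    using WB \<omega> by (intro pw)
  have "B_norm H (\<lambda>s. path_shift t \<omega> s - path_shift t (W n) s) \<le> ennreal (sqrt (1 + 2 * t) * (1 / real (Suc n)))" for n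
  proof -
    have "B_norm H (\<lambda>s. path_shift t \<omega> s - path_shift t (W n) s) = B_norm H (path_shift t (\<lambda>s. \<omega> s - W n s))"
      by (intro B_norm_cong) (auto simp: path_shift_def)
    also have "\<dots> \<le> ennreal (sqrt (1 + 2 * t) * (1 / real (Suc n)))"
      by (intro B_norm_path_shift less_imp_le[OF W(2)] t H) auto
    finally show ?thesis .
  qed
  then have "(\<lambda>n. B_norm H (\<lambda>s. path_shift t \<omega> s - path_shift t (W n) s)) \<longlonglongrightarrow> 0"
    by (intro tendsto_sandwich[OF _ _ tendsto_const lim[of "sqrt (1 + 2 * t)"]]) auto
  then have b: "(\<lambda>n. D (path_shift t (W n)) r) \<longlonglongrightarrow> D (path_shift t \<omega>) r" for r
    using WB \<omega> t by (intro pw path_shift_in_B_space[OF H])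
  show ?thesis
  proof
    fix s
    have "(\<lambda>n. path_shift t (D (W n)) s) \<longlonglongrightarrow> path_shift t (D \<omega>) s"
      unfolding path_shift_def by (auto intro!: tendsto_diff a)
    then show "D (path_shift t \<omega>) s = path_shift t (D \<omega>) s"
      using b[of s] C0[OF W(1)] LIMSEQ_unique by fastforce
  qed
qed

section \<open>Differential equations with dissipative drift\<close>

text \<open>The function \<open>exp (- (k * s)) * w s - h s\<close> is nonincreasing. The forcing
  enters through a primitive \<open>h\<close> rather than an integral, and derivatives are asked for
  at interior times only, where \<open>solves_derivative\<close> provides them.\<close>

lemma gronwall_differential:
  fixes w h w' h' :: "real \<Rightarrow> real"
  assumes "0 \<le> T" "continuous_on {0..T} w" "continuous_on {0..T} h"
    and w: "\<And>s. 0 < s \<Longrightarrow> s < T \<Longrightarrow> (w has_real_derivative w' s) (at s)"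
    and h: "\<And>s. 0 < s \<Longrightarrow> s < T \<Longrightarrow> (h has_real_derivative h' s) (at s)"
    and le: "\<And>s. 0 < s \<Longrightarrow> s < T \<Longrightarrow> w' s - k * w s \<le> exp (k * s) * h' s"
  shows "w T \<le> exp (k * T) * (w 0 + (h T - h 0))"
proof -
  let ?g = "\<lambda>s. exp (- (k * s)) * w s - h s"
  have "?g T \<le> ?g 0"
  proof (rule DERIV_nonpos_imp_decreasing_open[OF \<open>0 \<le> T\<close>])
    show "continuous_on {0..T} ?g"
      by (intro continuous_intros assms)
    fix s assume s: "0 < s" "s < T"
    have "(?g has_real_derivative exp (- (k * s)) * (w' s - k * w s) - h' s) (at s)"
      by (rule derivative_eq_intros w[OF s] h[OF s] refl)+ (simp add: algebra_simps)
    moreover have "exp (- (k * s)) * (w' s - k * w s) - h' s \<le> 0"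
      using mult_left_mono[OF le[OF s], of "exp (- (k * s))"] by (simp add: exp_minus field_simps)
    ultimately show "\<exists>y. (?g has_real_derivative y) (at s) \<and> y \<le> 0" by blast
  qed
  then have "exp (k * T) * (exp (- (k * T)) * w T) \<le> exp (k * T) * (w 0 + (h T - h 0))"
    by (intro mult_left_mono) auto
  moreover have "exp (k * T) * (exp (- (k * T)) * w T) = w T"
    by (simp add: exp_minus)
  ultimately show ?thesis by simp
qed

lemma norm_power2_has_derivative:
  fixes v :: "real \<Rightarrow> 'a::real_inner"
  assumes "(v has_vector_derivative d) (at s)"
  shows "((\<lambda>s. (norm (v s))\<^sup>2) has_real_derivative 2 * (d \<bullet> v s)) (at s)"
proof -
  have "((\<lambda>s. v s \<bullet> v s) has_derivative (\<lambda>h. v s \<bullet> (h *\<^sub>R d) + (h *\<^sub>R d) \<bullet> v s)) (at s)"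
    using assms unfolding has_vector_derivative_def by (intro has_derivative_inner)
  then show ?thesis
    unfolding power2_norm_eq_inner has_field_derivative_def
    by (rule has_derivative_eq_rhs) (auto simp: inner_commute fun_eq_iff)
qed

lemma power_le_exp_scaled:
  fixes a :: real
  assumes "a > 0"
  obtains K where "K \<ge> 0" "\<And>y. y \<ge> 0 \<Longrightarrow> y ^ m \<le> K * exp (a * y)"
proof (cases m)
  case 0
  have "1 \<le> exp (a * y)" if "y \<ge> 0" for y
    using assms that by simp
  then show ?thesis using 0 by (intro that[of 1]) simp_all
next
  case (Suc n)
  show ?thesis
  proof (rule that[of "(real (Suc n) / a) ^ Suc n"])
    fix y :: real assume "y \<ge> 0"
    have "(real (Suc n) / a) ^ Suc n * (a * y / real (Suc n)) ^ Suc n \<le> (real (Suc n) / a) ^ Suc n * exp (a * y)"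
      using assms \<open>y \<ge> 0\<close> by (intro mult_left_mono power_le_exp) auto
    moreover have "(real (Suc n) / a) ^ Suc n * (a * y / real (Suc n)) ^ Suc n = y ^ m"
      unfolding power_mult_distrib[symmetric] Suc using assms by simp
    ultimately show "y ^ m \<le> (real (Suc n) / a) ^ Suc n * exp (a * y)" by simp
  qed (use assms in auto)
qed

text \<open>Picard iteration. Measured with the weight \<open>exp (- 2 * L * t)\<close> the Picard
  map contracts by the factor 1 / 2, so the iterates converge on the whole of \<open>{0..T}\<close>
  at once and no interval has to be subdivided.\<close>

lemma picard_existence:
  fixes G :: "'a::euclidean_space \<Rightarrow> 'a" and b :: "real \<Rightarrow> 'a" and L T :: real
  assumes "0 \<le> T" and L: "L > 0" "\<And>x y. norm (G x - G y) \<le> L * norm (x - y)"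
    and b: "continuous_on {0..T} b"
  shows "\<exists>u. continuous_on {0..T} u \<and> (\<forall>t\<in>{0..T}. u t = x + integral {0..t} (\<lambda>s. G (u s)) + b t)"
proof -
  have contG: "continuous_on A G" for A
  proof (rule lipschitz_on_continuous_on)
    show "L-lipschitz_on A G"
      using L by (auto simp: lipschitz_on_def dist_norm)
  qed
  have contGu: "continuous_on A (\<lambda>s. G (u s))" if "continuous_on A u" for A and u :: "real \<Rightarrow> 'a"
    using continuous_on_compose2[OF contG that] by auto
  define p where "p = rec_nat (\<lambda>_. x) (\<lambda>_ u t. x + integral {0..t} (\<lambda>s. G (u s)) + b t)"
  have p0: "p 0 = (\<lambda>_. x)" and pS: "\<And>n. p (Suc n) = (\<lambda>t. x + integral {0..t} (\<lambda>s. G (p n s)) + b t)"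
    by (simp_all add: p_def)
  have cp: "continuous_on {0..T} (p n)" for n
  proof (induction n)
    case (Suc n)
    have "continuous_on {0..T} (\<lambda>t. integral {0..t} (\<lambda>s. G (p n s)))"
      by (rule indefinite_integral_continuous_1[OF integrable_continuous_real[OF contGu[OF Suc]]])
    then show ?case unfolding pS by (intro continuous_intros b)
  qed (simp add: p0)
  have cp': "continuous_on {0..t} (p n)" if "t \<le> T" for n t
    using cp[of n] by (rule continuous_on_subset) (use that in auto)
  have int: "(\<lambda>s. G (p n s)) integrable_on {0..t}" if "t \<le> T" for n t
    by (intro integrable_continuous_real contGu cp' that)
  have "continuous_on {0..T} (\<lambda>t. p 1 t - p 0 t)" by (intro continuous_intros cp)
  then obtain M where M: "M \<ge> 0" "\<And>t. 0 \<le> t \<Longrightarrow> t \<le> T \<Longrightarrow> norm (p 1 t - p 0 t) \<le> M"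
    by (rule continuous_on_Icc_bound) (rule that)
  have step: "norm (p (Suc n) t - p n t) \<le> M * exp (2 * L * t) * (1 / 2) ^ n" if "0 \<le> t" "t \<le> T" for n t
    using that
  proof (induction n arbitrary: t)
    case 0
    have "M * 1 \<le> M * exp (2 * L * t)" using M(1) L 0 by (intro mult_left_mono) auto
    then show ?case using M(2)[of t] 0 by simp
  next
    case (Suc n)
    have hi: "((\<lambda>s. L * (M * exp (2 * L * s) * (1 / 2) ^ n)) has_integral
        M * (1 / 2) ^ Suc n * exp (2 * L * t) - M * (1 / 2) ^ Suc n * exp (2 * L * 0)) {0..t}"
      by (rule fundamental_theorem_of_calculus[OF Suc.prems(1)])
         (auto intro!: derivative_eq_intros simp flip: has_real_derivative_iff_has_vector_derivative)
    have "p (Suc (Suc n)) t - p (Suc n) t = integral {0..t} (\<lambda>s. G (p (Suc n) s) - G (p n s))"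
      unfolding Henstock_Kurzweil_Integration.integral_diff[OF int int, OF Suc.prems(2) Suc.prems(2)]
        pS[THEN fun_cong, of "Suc n" t] pS[THEN fun_cong, of n t] by simp
    also have "norm \<dots> \<le> integral {0..t} (\<lambda>s. L * (M * exp (2 * L * s) * (1 / 2) ^ n))"
    proof (rule integral_norm_bound_integral)
      show "(\<lambda>s. G (p (Suc n) s) - G (p n s)) integrable_on {0..t}"
        by (intro integrable_diff int Suc.prems)
      fix s assume "s \<in> {0..t}"
      then show "norm (G (p (Suc n) s) - G (p n s)) \<le> L * (M * exp (2 * L * s) * (1 / 2) ^ n)"
        using L(2)[of "p (Suc n) s" "p n s"] Suc.IH[of s] Suc.prems L(1)
        by (auto intro: order_trans mult_left_mono)
    qed (use hi in \<open>auto simp: integrable_on_def\<close>)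
    also have "\<dots> = M * (1 / 2) ^ Suc n * exp (2 * L * t) - M * (1 / 2) ^ Suc n * exp (2 * L * 0)"
      using hi by (rule integral_unique)
    also have "\<dots> \<le> M * exp (2 * L * t) * (1 / 2) ^ Suc n"
      using M(1) by simp
    finally show ?case .
  qed
  define u where "u t = x + (\<Sum>n. p (Suc n) t - p n t)" for t
  have ps: "p n t = x + (\<Sum>i<n. p (Suc i) t - p i t)" for n t
    by (subst sum_lessThan_telescope) (simp add: p0)
  have unif: "uniform_limit {0..T} p u sequentially"
  proof -
    have "uniform_limit {0..T} (\<lambda>n t. \<Sum>i<n. p (Suc i) t - p i t) (\<lambda>t. \<Sum>n. p (Suc n) t - p n t) sequentially"
    proof (rule Weierstrass_m_test)
      show "summable (\<lambda>n. M * exp (2 * L * T) * (1 / 2) ^ n)"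
        by (intro summable_mult summable_geometric) auto
      fix n t assume t: "t \<in> {0..T}"
      have "norm (p (Suc n) t - p n t) \<le> M * exp (2 * L * t) * (1 / 2) ^ n" using step t by auto
      also have "\<dots> \<le> M * exp (2 * L * T) * (1 / 2) ^ n"
        using t M(1) L(1) by (intro mult_left_mono mult_right_mono) auto
      finally show "norm (p (Suc n) t - p n t) \<le> M * exp (2 * L * T) * (1 / 2) ^ n" .
    qed
    from uniform_limit_add[OF uniform_limit_const[where c = "\<lambda>_. x"] this]
    have "uniform_limit {0..T} (\<lambda>n t. x + (\<Sum>i<n. p (Suc i) t - p i t)) u sequentially"
      unfolding u_def[abs_def] .
    then show ?thesis by (simp only: ps[symmetric])
  qed
  have cu: "continuous_on {0..T} u"
    by (rule uniform_limit_theorem[OF always_eventually[OF allI[OF cp]] unif]) simp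
  have "u t = x + integral {0..t} (\<lambda>s. G (u s)) + b t" if t: "t \<in> {0..T}" for t
  proof -
    have lim: "(\<lambda>n. p (Suc n) t) \<longlonglongrightarrow> u t"
      using tendsto_uniform_limitI[OF unif t] by (rule LIMSEQ_Suc)
    have iu: "(\<lambda>s. G (u s)) integrable_on {0..t}"
      using t by (intro integrable_continuous_real contGu continuous_on_subset[OF cu]) auto
    have "(\<lambda>n. integral {0..t} (\<lambda>s. G (p n s))) \<longlonglongrightarrow> integral {0..t} (\<lambda>s. G (u s))"
    proof (rule LIMSEQ_I)
      fix r :: real assume r: "r > 0"
      \<comment> \<open>\<open>T + 1\<close> instead of \<open>T\<close> keeps the divisor positive
        when \<open>T = 0\<close>.\<close>
      define X where "X = L * (T + 1)"
      have X: "X > 0" using L(1) \<open>0 \<le> T\<close> by (simp add: X_def)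
      define e where "e = r / (2 * X)"
      have e: "e > 0" using r X by (simp add: e_def)
      from uniform_limitD[OF unif e] obtain N where
        N: "\<And>n s. n \<ge> N \<Longrightarrow> s \<in> {0..T} \<Longrightarrow> dist (p n s) (u s) < e"
        unfolding eventually_sequentially by blast
      show "\<exists>N. \<forall>n\<ge>N. norm (integral {0..t} (\<lambda>s. G (p n s)) - integral {0..t} (\<lambda>s. G (u s))) < r"
      proof (intro exI[of _ N] allI impI)
        fix n assume n: "n \<ge> N"
        have "norm (integral {0..t} (\<lambda>s. G (p n s)) - integral {0..t} (\<lambda>s. G (u s)))
            = norm (integral {0..t} (\<lambda>s. G (p n s) - G (u s)))"
          using int[of t n] iu t by (simp add: Henstock_Kurzweil_Integration.integral_diff)
        also have "\<dots> \<le> integral {0..t} (\<lambda>s. L * e)"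
        proof (rule integral_norm_bound_integral)
          show "(\<lambda>s. G (p n s) - G (u s)) integrable_on {0..t}"
            using int[of t n] iu t by (intro integrable_diff) auto
          fix s assume "s \<in> {0..t}"
          then have "norm (p n s - u s) \<le> e" using N[OF n, of s] t by (auto simp: dist_norm)
          then show "norm (G (p n s) - G (u s)) \<le> L * e"
            using L(2)[of "p n s" "u s"] L(1) by (meson mult_left_mono less_imp_le order_trans)
        qed auto
        also have "\<dots> = t * (L * e)" using t by simp
        also have "\<dots> \<le> T * (L * e)"
          using t L(1) e by (intro mult_right_mono) auto
        also have "\<dots> \<le> (T + 1) * (L * e)" using L(1) e by (intro mult_right_mono) auto
        also have "\<dots> = X * e" by (simp add: X_def)
        also have "\<dots> = r / 2" using X by (simp add: e_def)
        also have "\<dots> < r" using r by simp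
        finally show "norm (integral {0..t} (\<lambda>s. G (p n s)) - integral {0..t} (\<lambda>s. G (u s))) < r" .
      qed
    qed
    then have "(\<lambda>n. p (Suc n) t) \<longlonglongrightarrow> x + integral {0..t} (\<lambda>s. G (u s)) + b t"
      unfolding pS by (intro tendsto_intros)
    with lim show ?thesis by (rule LIMSEQ_unique)
  qed
  with cu show ?thesis by blast
qed

text \<open>The derivative bound of the equation is recorded as a Lipschitz bound on balls, the form
  in which existence and continuity in the path consume it.\<close>

locale dissipative_drift =
  fixes F :: "'a::euclidean_space \<Rightarrow> 'a" and C1 C2 C3 C :: real and N :: nat
  assumes pos: "C1 \<ge> 0" "C2 > 0" "C3 \<ge> 0"
    and dissipative: "(F y - F x) \<bullet> (y - x) \<le> C1 - C2 * (norm (y - x))\<^sup>2"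
    and one_sided_lipschitz: "(F y - F x) \<bullet> (y - x) \<le> C3 * (norm (y - x))\<^sup>2"
    and local_lipschitz: "\<exists>L. \<forall>x\<in>cball 0 R. \<forall>y\<in>cball 0 R. norm (F x - F y) \<le> L * norm (x - y)"
    and growth: "norm (F x) \<le> C * (1 + norm x) ^ N"
begin

lemma local_lipschitz_pos:
  obtains L where "L > 0" "\<And>x y. norm x \<le> R \<Longrightarrow> norm y \<le> R \<Longrightarrow> norm (F x - F y) \<le> L * norm (x - y)"
proof -
  from local_lipschitz[of R] obtain L where
    "\<forall>x\<in>cball 0 R. \<forall>y\<in>cball 0 R. norm (F x - F y) \<le> L * norm (x - y)" ..
  then have L: "norm (F x - F y) \<le> L * norm (x - y)" if "norm x \<le> R" "norm y \<le> R" for x y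
    using that by simp
  show ?thesis
  proof (rule that[of "max L 1"])
    fix x y :: 'a assume "norm x \<le> R" "norm y \<le> R"
    then have "norm (F x - F y) \<le> L * norm (x - y)" by (rule L)
    also have "\<dots> \<le> max L 1 * norm (x - y)" by (intro mult_right_mono) auto
    finally show "norm (F x - F y) \<le> max L 1 * norm (x - y)" .
  qed auto
qed

lemma continuous_F: "continuous_on A F"
proof -
  have "isCont F x" for x
  proof -
    obtain L where L: "L > 0" "\<And>y z. norm y \<le> norm x + 1 \<Longrightarrow> norm z \<le> norm x + 1 \<Longrightarrow> norm (F y - F z) \<le> L * norm (y - z)"
      by (rule local_lipschitz_pos) (rule that)
    have "L-lipschitz_on (cball 0 (norm x + 1)) F"
      using L by (auto simp: lipschitz_on_def dist_norm)
    then have "continuous_on (cball 0 (norm x + 1)) F"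
      by (rule lipschitz_on_continuous_on)
    moreover have "x \<in> interior (cball 0 (norm x + 1))" by simp
    ultimately show ?thesis by (rule continuous_on_interior)
  qed
  then show ?thesis by (simp add: continuous_at_imp_continuous_on)
qed

text \<open>The forcing \<open>b\<close> is arbitrary, so the solution starts in
  \<open>x + b 0\<close>; the drivers used later vanish at 0. They are not differentiable in
  general, hence the integral form.\<close>

definition solves :: "(real \<Rightarrow> 'a) \<Rightarrow> 'a \<Rightarrow> real \<Rightarrow> (real \<Rightarrow> 'a) \<Rightarrow> bool" where
  "solves b x T u \<longleftrightarrow> continuous_on {0..T} u \<and>
     (\<forall>t\<in>{0..T}. u t = x + integral {0..t} (\<lambda>s. F (u s)) + b t)"

lemma solves_0: "solves b x T u \<Longrightarrow> 0 \<le> T \<Longrightarrow> u 0 = x + b 0"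
  by (simp add: solves_def)

lemma solves_mono: "solves b x T u \<Longrightarrow> t \<le> T \<Longrightarrow> solves b x t u"
  unfolding solves_def by (auto intro: continuous_on_subset)

lemma solves_cong: "(\<And>t. 0 \<le> t \<Longrightarrow> t \<le> T \<Longrightarrow> b t = b' t) \<Longrightarrow> solves b x T u \<longleftrightarrow> solves b' x T u"
  unfolding solves_def by auto

lemma continuous_F_comp: "continuous_on A u \<Longrightarrow> continuous_on A (\<lambda>s. F (u s))"
  using continuous_on_compose2[OF continuous_F] by blast

text \<open>\<open>u - b\<close> is differentiable although neither \<open>u\<close> nor
  \<open>b\<close> need be. The constant \<open>k\<close> leaves room for measuring the distance to
  \<open>b + k\<close> instead of \<open>b\<close>.\<close>

lemma solves_derivative:
  assumes "solves b x T u" "0 < s" "s < T"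
  shows "((\<lambda>t. u t - b t - k) has_vector_derivative F (u s)) (at s)"
proof -
  have c: "continuous_on {0..T} (\<lambda>s. F (u s))"
    using assms(1) by (intro continuous_F_comp) (simp add: solves_def)
  have "((\<lambda>t. integral {0..t} (\<lambda>s. F (u s))) has_vector_derivative F (u s)) (at s within {0..T})"
    using assms by (intro integral_has_vector_derivative[OF c]) auto
  moreover have "at s within {0..T} = at s"
    using assms by (intro at_within_interior) auto
  ultimately have "((\<lambda>t. integral {0..t} (\<lambda>s. F (u s))) has_vector_derivative F (u s)) (at s)" by simp
  then have "((\<lambda>t. (x - k) + integral {0..t} (\<lambda>s. F (u s))) has_vector_derivative F (u s)) (at s)"
    by (auto intro!: derivative_eq_intros)
  then show ?thesis
    by (rule has_vector_derivative_transform_within_open[of _ _ _ "{0<..<T}"])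
       (use assms in \<open>auto simp: solves_def\<close>)
qed

text \<open>Insert \<open>y = u2 s - b2 s + b1 s\<close>, for which \<open>u1 s - y\<close> is
  exactly the difference of the noise-free parts: the one-sided Lipschitz bound handles
  \<open>F (u1 s) - F y\<close>, and \<open>e\<close> bounds the remaining
  \<open>F y - F (u2 s)\<close>. As \<open>e\<close> concerns only points near \<open>u2\<close>, a
  Lipschitz constant around one known solution suffices. Uniqueness, dependence on \<open>x\<close>
  and dependence on the path are all instances.\<close>

lemma solves_stability:
  assumes u: "solves b1 x1 T u1" "solves b2 x2 T u2" and T: "0 \<le> T"
    and b: "continuous_on {0..T} b1" "continuous_on {0..T} b2"
    and e: "\<And>s. 0 \<le> s \<Longrightarrow> s \<le> T \<Longrightarrow> norm (F (u2 s - b2 s + b1 s) - F (u2 s)) \<le> e"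
  shows "(norm ((u1 T - b1 T) - (u2 T - b2 T)))\<^sup>2 \<le> exp ((2 * C3 + 1) * T) * ((norm (x1 - x2))\<^sup>2 + e\<^sup>2 * T)"
proof -
  let ?v = "\<lambda>s. (u1 s - b1 s) - (u2 s - b2 s)"
  let ?w' = "\<lambda>s. 2 * ((F (u1 s) - F (u2 s)) \<bullet> ?v s)"
  have "(norm (?v T))\<^sup>2 \<le> exp ((2 * C3 + 1) * T) * ((norm (?v 0))\<^sup>2 + (e\<^sup>2 * T - e\<^sup>2 * 0))"
  proof (rule gronwall_differential[where w' = ?w' and h' = "\<lambda>_. e\<^sup>2", OF T])
    show "continuous_on {0..T} (\<lambda>s. (norm (?v s))\<^sup>2)"
      using u b by (intro continuous_intros) (auto simp: solves_def)
    fix s assume s: "0 < s" "s < T"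
    have "(?v has_vector_derivative F (u1 s) - F (u2 s)) (at s)"
      using has_vector_derivative_diff[OF solves_derivative[OF u(1) s, of 0] solves_derivative[OF u(2) s, of 0]]
      by simp
    then show "((\<lambda>s. (norm (?v s))\<^sup>2) has_real_derivative ?w' s) (at s)"
      by (rule norm_power2_has_derivative)
    define y where "y = u2 s - b2 s + b1 s"
    have v: "u1 s - y = ?v s" by (simp add: y_def)
    have "(F (u1 s) - F y) \<bullet> ?v s \<le> C3 * (norm (?v s))\<^sup>2"
      using one_sided_lipschitz[of "u1 s" y] unfolding v .
    moreover have "(F y - F (u2 s)) \<bullet> ?v s \<le> e * norm (?v s)"
      using norm_cauchy_schwarz[of "F y - F (u2 s)" "?v s"] 
        mult_right_mono[OF e[of s], of "norm (?v s)"] s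
      unfolding y_def by simp
    moreover have "2 * (e * norm (?v s)) \<le> (norm (?v s))\<^sup>2 + e\<^sup>2"
      using sum_squares_bound[of e "norm (?v s)"] by (simp add: algebra_simps)
    moreover have "(F (u1 s) - F (u2 s)) \<bullet> ?v s = (F (u1 s) - F y) \<bullet> ?v s + (F y - F (u2 s)) \<bullet> ?v s"
      by (simp add: inner_diff_left)
    ultimately have "?w' s - (2 * C3 + 1) * (norm (?v s))\<^sup>2 \<le> e\<^sup>2"
      unfolding distrib_right by linarith
    also have "e\<^sup>2 \<le> exp ((2 * C3 + 1) * s) * e\<^sup>2"
      using pos s mult_right_mono[of 1 "exp ((2 * C3 + 1) * s)" "e\<^sup>2"] by simp
    finally show "?w' s - (2 * C3 + 1) * (norm (?v s))\<^sup>2 \<le> exp ((2 * C3 + 1) * s) * e\<^sup>2" .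
  qed (auto intro!: derivative_eq_intros continuous_intros)
  then show ?thesis using solves_0[OF u(1) T] solves_0[OF u(2) T] by simp
qed

lemma solves_unique:
  assumes "solves b x T u1" "solves b x T u2" "continuous_on {0..T} b" "0 \<le> t" "t \<le> T"
  shows "u1 t = u2 t"
  using solves_stability[OF solves_mono[OF assms(1,5)] solves_mono[OF assms(2,5)] assms(4), of 0]
    continuous_on_subset[OF assms(3), of "{0..t}"] assms(4,5) by auto

text \<open>\<open>b + k\<close> is a reference path. Dissipativity contributes the rate
  \<open>- 2 * C2\<close>, and half of it is spent on the cross term with \<open>F (b s + k)\<close>
  by Young's inequality. The bound on that term may grow backwards in time at rate
  \<open>C2 / 2\<close>, half of the remaining decay, so its total contribution stays below
  \<open>2 * G / C2\<close> uniformly in \<open>T\<close>.\<close>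

lemma solves_absorb:
  assumes u: "solves b x T u" and T: "0 \<le> T" and b: "continuous_on {0..T} b"
    and G: "\<And>s. 0 \<le> s \<Longrightarrow> s \<le> T \<Longrightarrow> 2 * C1 + (norm (F (b s + k)))\<^sup>2 / C2 \<le> G * exp (C2 * (T - s) / 2)"
  shows "(norm (u T - b T - k))\<^sup>2 \<le> exp (- C2 * T) * (norm (x - k))\<^sup>2 + 2 * G / C2"
proof -
  let ?v = "\<lambda>s. u s - b s - k"
  let ?w' = "\<lambda>s. 2 * (F (u s) \<bullet> ?v s)"
  \<comment> \<open>A primitive of
    \<open>exp (C2 * s) * (G * exp (C2 * (T - s) / 2))\<close>.\<close>
  let ?h = "\<lambda>s. 2 * G / C2 * exp (C2 * T / 2) * exp (C2 * s / 2)"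
  let ?h' = "\<lambda>s. G * exp (C2 * T / 2) * exp (C2 * s / 2)"
  have "0 \<le> 2 * C1 + (norm (F (b T + k)))\<^sup>2 / C2" using pos by simp
  also have "\<dots> \<le> G" using G[of T] T by simp
  finally have G0: "G \<ge> 0" .
  have "(norm (?v T))\<^sup>2 \<le> exp ((- C2) * T) * ((norm (?v 0))\<^sup>2 + (?h T - ?h 0))"
  proof (rule gronwall_differential[where w' = ?w' and h' = ?h', OF T])
    show "continuous_on {0..T} (\<lambda>s. (norm (?v s))\<^sup>2)"
      using u b by (intro continuous_intros) (auto simp: solves_def)
    fix s assume s: "0 < s" "s < T"
    show "((\<lambda>s. (norm (?v s))\<^sup>2) has_real_derivative ?w' s) (at s)"
      by (rule norm_power2_has_derivative[OF solves_derivative[OF u s]])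
    show "(?h has_real_derivative ?h' s) (at s)"
      using pos by (auto intro!: derivative_eq_intros)
    define y where "y = b s + k"
    have v: "u s - y = ?v s" by (simp add: y_def)
    define n where "n = norm (?v s)"
    define f where "f = norm (F y)"
    have a: "(F (u s) - F y) \<bullet> ?v s \<le> C1 - C2 * n\<^sup>2"
      using dissipative[of "u s" y] unfolding v n_def .
    have b: "F y \<bullet> ?v s \<le> f * n"
      unfolding n_def f_def by (rule norm_cauchy_schwarz)
    have "2 * (f / sqrt C2) * (sqrt C2 * n) \<le> (f / sqrt C2)\<^sup>2 + (sqrt C2 * n)\<^sup>2"
      by (rule sum_squares_bound)
    then have c: "2 * (f * n) \<le> f\<^sup>2 / C2 + C2 * n\<^sup>2"
      using pos by (simp add: power_divide power_mult_distrib)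
    have "F (u s) \<bullet> ?v s = (F (u s) - F y) \<bullet> ?v s + F y \<bullet> ?v s"
      by (simp add: inner_diff_left)
    with a b c have "?w' s - (- C2) * n\<^sup>2 \<le> 2 * C1 + f\<^sup>2 / C2"
      by (simp add: algebra_simps)
    also have "\<dots> \<le> G * exp (C2 * (T - s) / 2)"
      unfolding f_def y_def using s by (intro G) auto
    also have "\<dots> = exp ((- C2) * s) * ?h' s"
      by (simp add: exp_add[symmetric] field_simps flip: exp_add)
    finally show "?w' s - (- C2) * (norm (?v s))\<^sup>2 \<le> exp ((- C2) * s) * ?h' s"
      unfolding n_def .
  qed (use pos in \<open>auto intro!: continuous_intros\<close>)
  also have "\<dots> \<le> exp ((- C2) * T) * ((norm (x - k))\<^sup>2 + 2 * G / C2 * exp (C2 * T))"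
  proof (intro mult_left_mono add_mono)
    have "?h T = 2 * G / C2 * exp (C2 * T)"
      by (simp add: mult.assoc flip: exp_add)
    moreover have "?h 0 \<ge> 0" using G0 pos by simp
    ultimately show "?h T - ?h 0 \<le> 2 * G / C2 * exp (C2 * T)" by linarith
    show "(norm (?v 0))\<^sup>2 \<le> (norm (x - k))\<^sup>2" using solves_0[OF u T] by simp
  qed auto
  also have "\<dots> = exp (- C2 * T) * (norm (x - k))\<^sup>2 + 2 * G / C2"
    by (simp add: distrib_left exp_minus)
  finally show ?thesis .
qed

text \<open>Truncate the drift by projecting onto a ball, solve the globally Lipschitz equation, and
  show that the solution never reaches the sphere: up to the first time of reaching it, it solves
  the original equation, whose solutions obey an a priori bound strictly inside.\<close>

lemma solves_exists:
  assumes T: "0 \<le> T" and b: "continuous_on {0..T} b"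
  shows "\<exists>u. solves b x T u"
proof -
  obtain Mb where Mb: "Mb \<ge> 0" "\<And>t. 0 \<le> t \<Longrightarrow> t \<le> T \<Longrightarrow> norm (b t) \<le> Mb"
    by (rule continuous_on_Icc_bound[OF b]) (rule that)
  have "continuous_on {0..T} (\<lambda>t. 2 * C1 + (norm (F (b t)))\<^sup>2 / C2)"
    using pos by (intro continuous_intros continuous_F_comp b) auto
  then obtain G where G: "G \<ge> 0" "\<And>t. 0 \<le> t \<Longrightarrow> t \<le> T \<Longrightarrow> norm (2 * C1 + (norm (F (b t)))\<^sup>2 / C2) \<le> G"
    by (rule continuous_on_Icc_bound) (rule that)
  \<comment> \<open>The summand 1 makes the a priori bound strict, so that a first time on or beyond
    the sphere is contradictory.\<close>
  define \<rho> where "\<rho> = Mb + sqrt ((norm x)\<^sup>2 + 2 * G / C2) + 1"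
  have \<rho>: "\<rho> > 0" using Mb(1) G(1) pos unfolding \<rho>_def by (intro add_nonneg_pos add_nonneg_nonneg) auto
  have apriori: "norm (u t) < \<rho>" if u: "solves b x t u" and t: "0 \<le> t" "t \<le> T" for u t
  proof -
    have "(norm (u t - b t - 0))\<^sup>2 \<le> exp (- C2 * t) * (norm (x - 0))\<^sup>2 + 2 * G / C2"
    proof (rule solves_absorb[OF u t(1)])
      show "continuous_on {0..t} b" using b by (rule continuous_on_subset) (use t in auto)
      fix s assume s: "0 \<le> s" "s \<le> t"
      have "2 * C1 + (norm (F (b s + 0)))\<^sup>2 / C2 \<le> G * 1" using G(2)[of s] s t by simp
      also have "\<dots> \<le> G * exp (C2 * (t - s) / 2)"
        using G(1) pos s by (intro mult_left_mono) auto
      finally show "2 * C1 + (norm (F (b s + 0)))\<^sup>2 / C2 \<le> G * exp (C2 * (t - s) / 2)" .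
    qed
    also have "\<dots> \<le> (norm x)\<^sup>2 + 2 * G / C2"
      using mult_right_mono[of "exp (- C2 * t)" 1 "(norm x)\<^sup>2"] pos t by simp
    finally have "norm (u t - b t) \<le> sqrt ((norm x)\<^sup>2 + 2 * G / C2)"
      by (simp add: real_le_rsqrt)
    then show ?thesis
      using norm_triangle_ineq[of "u t - b t" "b t"] Mb(2)[of t] t by (simp add: \<rho>_def)
  qed
  define \<pi> where "\<pi> = closest_point (cball (0::'a) \<rho>)"
  have \<pi>: "norm (\<pi> y) \<le> \<rho>" for y
    using closest_point_in_set[of "cball (0::'a) \<rho>" y] \<rho> unfolding \<pi>_def by auto
  have \<pi>_id: "\<pi> y = y" if "norm y \<le> \<rho>" for y
    unfolding \<pi>_def using that by (intro closest_point_self) auto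
  have \<pi>_lip: "norm (\<pi> y - \<pi> z) \<le> norm (y - z)" for y z
    using closest_point_lipschitz[of "cball (0::'a) \<rho>" y z] \<rho> unfolding \<pi>_def dist_norm by auto
  obtain L where L: "L > 0" "\<And>x y. norm x \<le> \<rho> \<Longrightarrow> norm y \<le> \<rho> \<Longrightarrow> norm (F x - F y) \<le> L * norm (x - y)"
    by (rule local_lipschitz_pos) (rule that)
  have "norm (F (\<pi> y) - F (\<pi> z)) \<le> L * norm (y - z)" for y z
    using L(2)[OF \<pi> \<pi>, of y z] \<pi>_lip[of y z] L(1) by (meson less_imp_le mult_left_mono order_trans)
  from picard_existence[OF T L(1) this b, of x] obtain u where
    cu: "continuous_on {0..T} u" and
    u: "\<And>t. t \<in> {0..T} \<Longrightarrow> u t = x + integral {0..t} (\<lambda>s. F (\<pi> (u s))) + b t" by blast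
  have "norm (u t) < \<rho>" if "t \<in> {0..T}" for t
  proof (rule ccontr)
    assume "\<not> norm (u t) < \<rho>"
    let ?S = "{t \<in> {0..T}. \<rho> \<le> norm (u t)}"
    have "closed ?S"
      using continuous_closed_preimage[of "{0..T}" "\<lambda>t. norm (u t)" "{\<rho>..}"] continuous_on_norm[OF cu]
      by (simp add: vimage_def Int_def)
    then have cpt: "compact ?S"
      by (intro compact_eq_bounded_closed[THEN iffD2] conjI bounded_subset[OF bounded_closed_interval[of 0 T]]) auto
    have ne: "?S \<noteq> {}" using that \<open>\<not> norm (u t) < \<rho>\<close> by force
    from compact_attains_inf[OF cpt ne] obtain \<tau> where \<tau>: "\<tau> \<in> ?S" "\<forall>s\<in>?S. \<tau> \<le> s"
      by (rule bexE)
    have before: "\<pi> (u s) = u s" if "0 \<le> s" "s < \<tau>" for s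
      using bspec[OF \<tau>(2), of s] that \<tau>(1) by (intro \<pi>_id) force
    have "solves b x \<tau> u"
      unfolding solves_def
    proof (intro conjI ballI)
      show "continuous_on {0..\<tau>} u" using cu by (rule continuous_on_subset) (use \<tau>(1) in auto)
      fix s assume s: "s \<in> {0..\<tau>}"
      \<comment> \<open>Before \<open>\<tau>\<close> the projection is the identity; the single time
        \<open>\<tau>\<close> is negligible for the integral.\<close>
      have "integral {0..s} (\<lambda>s. F (\<pi> (u s))) = integral {0..s} (\<lambda>s. F (u s))"
        by (rule integral_spike[of "{\<tau>}"]) (use s before in auto)
      then show "u s = x + integral {0..s} (\<lambda>s. F (u s)) + b s"
        using u[of s] s \<tau>(1) by auto
    qed
    then have "norm (u \<tau>) < \<rho>" using \<tau>(1) by (intro apriori) auto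
    then show False using \<tau>(1) by auto
  qed
  then have "\<pi> (u t) = u t" if "t \<in> {0..T}" for t
    using that by (intro \<pi>_id) (auto intro: less_imp_le)
  then have "integral {0..t} (\<lambda>s. F (\<pi> (u s))) = integral {0..t} (\<lambda>s. F (u s))" if "t \<in> {0..T}" for t
    using that by (intro integral_cong) auto
  then show ?thesis using u cu unfolding solves_def by auto
qed

end

section \<open>Pullback flow and attractor\<close>

text \<open>Linear growth is what the path norm provides; after composition with the polynomially
  bounded drift it is still dominated by every exponential, as absorption requires.\<close>

definition tempered_path :: "(real \<Rightarrow> 'a::real_normed_vector) \<Rightarrow> bool" where
  "tempered_path \<zeta> \<longleftrightarrow> continuous_on {..0} \<zeta> \<and> \<zeta> 0 = 0 \<and> (\<exists>c>0. \<forall>t\<le>0. norm (\<zeta> t) \<le> c * (1 + \<bar>t\<bar>))"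

definition driver :: "real \<Rightarrow> (real \<Rightarrow> 'a::real_normed_vector) \<Rightarrow> real \<Rightarrow> 'a" where
  "driver T \<zeta> s = \<zeta> (s - T) - \<zeta> (- T)"

lemma continuous_driver:
  assumes "tempered_path \<zeta>"
  shows "continuous_on {0..T} (driver T \<zeta>)"
proof -
  have c: "continuous_on {..0} \<zeta>" using assms by (simp add: tempered_path_def)
  have "continuous_on {0..T} (\<lambda>s. \<zeta> (s - T))"
    by (intro continuous_on_compose2[OF c] continuous_intros) auto
  then show ?thesis unfolding driver_def[abs_def] by (intro continuous_intros)
qed

lemma tempered_path_shift:
  assumes "tempered_path \<zeta>" "s \<ge> 0"
  shows "tempered_path (path_shift s \<zeta>)"
proof -
  from assms obtain c where c: "c > 0" "\<And>t. t \<le> 0 \<Longrightarrow> norm (\<zeta> t) \<le> c * (1 + \<bar>t\<bar>)"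
    and cont: "continuous_on {..0} \<zeta>" by (auto simp: tempered_path_def)
  have "continuous_on {..0} (\<lambda>r. \<zeta> (r - s) - \<zeta> (- s))"
    using assms(2) by (intro continuous_intros continuous_on_compose2[OF cont]) auto
  then have "continuous_on {..0} (path_shift s \<zeta>)"
    by (rule continuous_on_eq) (auto simp: path_shift_def)
  moreover have "norm (path_shift s \<zeta> t) \<le> (2 * c * (1 + s)) * (1 + \<bar>t\<bar>)" if "t \<le> 0" for t
  proof -
    have "norm (path_shift s \<zeta> t) \<le> norm (\<zeta> (t - s)) + norm (\<zeta> (- s))"
      using that by (simp add: path_shift_def norm_triangle_ineq4)
    also have "\<dots> \<le> c * (1 + \<bar>t - s\<bar>) + c * (1 + \<bar>- s\<bar>)"
      using that assms(2) by (intro add_mono c(2)) auto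
    also have "\<dots> = c * (2 + \<bar>t\<bar> + 2 * s)"
      using that assms(2) by (simp add: algebra_simps)
    also have "\<dots> \<le> c * ((2 * (1 + s)) * (1 + \<bar>t\<bar>))"
      using c(1) assms(2) by (intro mult_left_mono) (auto simp: algebra_simps)
    finally show ?thesis by (simp add: mult_ac)
  qed
  moreover have "2 * c * (1 + s) > 0" using c(1) assms(2) by simp
  ultimately show ?thesis unfolding tempered_path_def by (auto simp: path_shift_def intro!: exI[of _ "2 * c * (1 + s)"])
qed

text \<open>Boundedness is asked of one set only, since the tails of a ball are known to be bounded
  only from some index on.\<close>

lemma nested_closed_nonempty:
  fixes K :: "nat \<Rightarrow> 'a::heine_borel set"
  assumes "\<And>n. closed (K n)" "\<And>n. K n \<noteq> {}" "\<And>m n. m \<le> n \<Longrightarrow> K n \<subseteq> K m" "bounded (K n0)"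
  shows "\<Inter> (range K) \<noteq> {}"
proof -
  have "compact (K (n + n0))" for n
    using bounded_subset[OF assms(4) assms(3)[OF le_add2]] assms(1) by (simp add: compact_eq_bounded_closed)
  then have "\<Inter> (range (\<lambda>n. K (n + n0))) \<noteq> {}"
    using assms by (intro compact_nest) auto
  moreover have "\<Inter> (range (\<lambda>n. K (n + n0))) \<subseteq> \<Inter> (range K)"
    using assms(3)[OF le_add1] by blast
  ultimately show ?thesis by blast
qed

lemma infdist_less_iff:
  "A \<noteq> {} \<Longrightarrow> infdist x A < c \<longleftrightarrow> (\<exists>a\<in>A. dist x a < c)"
  unfolding infdist_notempty by (subst cINF_less_iff) (auto intro: bdd_belowI2[of _ 0])

lemma infdist_closure_less_iff:
  assumes "A \<noteq> {}"
  shows "infdist x (closure A) < c \<longleftrightarrow> (\<exists>a\<in>A. dist x a < c)"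
proof
  assume "infdist x (closure A) < c"
  then obtain a where a: "a \<in> closure A" "dist x a < c"
    using assms by (auto simp: infdist_less_iff)
  then obtain a' where "a' \<in> A" "dist a' a < c - dist x a"
    unfolding closure_approachable by (metis diff_gt_0_iff_gt)
  then show "\<exists>a\<in>A. dist x a < c"
    using dist_triangle[of x a' a] by (intro bexI[of _ a']) (auto simp: dist_commute)
next
  assume "\<exists>a\<in>A. dist x a < c"
  then show "infdist x (closure A) < c"
    using assms closure_subset[of A] by (subst infdist_less_iff) auto
qed

text \<open>Boundedness makes \<open>closure U\<close> compact, so its image is closed.\<close>

lemma image_closure_eq:
  fixes g :: "'a::heine_borel \<Rightarrow> 'b::t2_space"
  assumes "continuous_on UNIV g" "bounded U"
  shows "g ` closure U = closure (g ` U)"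
proof
  show "g ` closure U \<subseteq> closure (g ` U)"
    by (rule image_closure_subset[OF continuous_on_subset[OF assms(1)] closed_closure closure_subset]) simp
  have "compact (g ` closure U)"
    using assms by (intro compact_continuous_image continuous_on_subset[OF assms(1)]) (auto simp: compact_closure)
  then show "closure (g ` U) \<subseteq> g ` closure U"
    by (intro closure_minimal image_mono closure_subset compact_imp_closed)
qed

locale dissipative_sde = dissipative_drift F C1 C2 C3 C N
  for F :: "real ^ 'd::finite \<Rightarrow> real ^ 'd" and C1 C2 C3 C N
begin

text \<open>\<open>flow T \<zeta> x\<close> starts in \<open>x\<close> at time \<open>- T\<close>, is driven by the past \<open>\<zeta>\<close>, and is evaluated at time \<open>0\<close>.\<close>

definition flow :: "real \<Rightarrow> 'd path \<Rightarrow> real ^ 'd \<Rightarrow> real ^ 'd" where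
  "flow T \<zeta> x = (THE y. \<exists>u. solves (driver T \<zeta>) x T u \<and> u T = y)"

lemma flow_eq:
  assumes "tempered_path \<zeta>" "0 \<le> T" "solves (driver T \<zeta>) x T u"
  shows "flow T \<zeta> x = u T"
  unfolding flow_def
proof (rule the_equality)
  show "\<exists>v. solves (driver T \<zeta>) x T v \<and> v T = u T" using assms(3) by blast
  fix y assume "\<exists>v. solves (driver T \<zeta>) x T v \<and> v T = y"
  then obtain v where v: "solves (driver T \<zeta>) x T v" "v T = y" by blast
  show "y = u T"
    using solves_unique[OF v(1) assms(3) continuous_driver[OF assms(1)] assms(2) order_refl] v(2) by simp
qed

lemma flow_solution:
  assumes "tempered_path \<zeta>" "0 \<le> T"
  obtains u where "solves (driver T \<zeta>) x T u" "flow T \<zeta> x = u T"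
proof -
  from solves_exists[OF assms(2) continuous_driver[OF assms(1)]] obtain u where
    u: "solves (driver T \<zeta>) x T u" ..
  show ?thesis by (rule that[OF u flow_eq[OF assms u]])
qed

text \<open>The solution over \<open>t + s\<close> time units is cut at time \<open>- s\<close>.
  Before it, the increments of \<zeta> are those of \<open>path_shift s \<zeta>\<close>; after it,
  the solution restarts in \<open>u t\<close> and sees \<zeta> on the last \<open>s\<close>
  units.\<close>

lemma flow_cocycle:
  assumes \<zeta>: "tempered_path \<zeta>" and t: "0 \<le> t" and s: "0 \<le> s"
  shows "flow (t + s) \<zeta> x = flow s \<zeta> (flow t (path_shift s \<zeta>) x)"
proof -
  have ts: "0 \<le> t + s" using t s by simp
  obtain u where u: "solves (driver (t + s) \<zeta>) x (t + s) u" "flow (t + s) \<zeta> x = u (t + s)"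
    by (rule flow_solution[OF \<zeta> ts]) (rule that)
  have "solves (driver (t + s) \<zeta>) x t u"
    using u(1) by (rule solves_mono) (use s in simp)
  also have "solves (driver (t + s) \<zeta>) x t u \<longleftrightarrow> solves (driver t (path_shift s \<zeta>)) x t u"
  proof (rule solves_cong)
    have "\<zeta> (- t - s) = \<zeta> (- s - t)" by (rule arg_cong[where f = \<zeta>]) simp
    then show "driver (t + s) \<zeta> r = driver t (path_shift s \<zeta>) r" if "0 \<le> r" "r \<le> t" for r
      using that t by (simp add: driver_def path_shift_def algebra_simps)
  qed
  finally have 1: "flow t (path_shift s \<zeta>) x = u t"
    by (intro flow_eq tempered_path_shift \<zeta> s t)
  have cu: "continuous_on {0..t + s} u" and
    ueq: "\<And>r. 0 \<le> r \<Longrightarrow> r \<le> t + s \<Longrightarrow> u r = x + integral {0..r} (\<lambda>s. F (u s)) + driver (t + s) \<zeta> r"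
    using u(1) by (auto simp: solves_def)
  have cF: "continuous_on {0..t + s} (\<lambda>s. F (u s))"
    by (rule continuous_F_comp[OF cu])
  have "solves (driver s \<zeta>) (u t) s (\<lambda>r. u (r + t))"
    unfolding solves_def
  proof (intro conjI ballI)
    show "continuous_on {0..s} (\<lambda>r. u (r + t))"
      using t by (intro continuous_on_compose2[OF cu] continuous_intros) auto
    fix r assume r: "r \<in> {0..s}"
    have "integral {0..r} (\<lambda>s. F (u (s + t))) = integral {t..r + t} (\<lambda>s. F (u s))"
      using integral_shift[of 0 t r "\<lambda>s. F (u s)"] continuous_on_subset[OF cF, of "{t..r + t}"] r t
      by (simp add: o_def)
    moreover have "integral {0..t} (\<lambda>s. F (u s)) + integral {t..r + t} (\<lambda>s. F (u s)) = integral {0..r + t} (\<lambda>s. F (u s))"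
      using r t by (intro Henstock_Kurzweil_Integration.integral_combine integrable_continuous_real continuous_on_subset[OF cF]) auto
    moreover have "driver (t + s) \<zeta> (r + t) - driver (t + s) \<zeta> t = driver s \<zeta> r"
      by (simp add: driver_def algebra_simps)
    ultimately show "u (r + t) = u t + integral {0..r} (\<lambda>s. F (u (s + t))) + driver s \<zeta> r"
      using ueq[of t] ueq[of "r + t"] r t s by (simp add: algebra_simps)
  qed
  then have "flow s \<zeta> (u t) = u (s + t)"
    by (intro flow_eq \<zeta> s)
  then show ?thesis using 1 u(2) by (simp add: add.commute)
qed

text \<open>\<open>solves_absorb\<close> with its offset taken as \<open>\<zeta> (- T)\<close>
  compares the solution with \<zeta> itself. The quantifier order matters: the radius
  \<open>R\<close> serves all balls, only the entry time depends on \<open>k\<close>.\<close>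

lemma flow_absorbing:
  assumes \<zeta>: "tempered_path \<zeta>"
  shows "\<exists>R. \<forall>k. \<exists>T0\<ge>0. \<forall>T\<ge>T0. \<forall>x. norm x \<le> k \<longrightarrow> norm (flow T \<zeta> x) \<le> R"
proof -
  from \<zeta> obtain c where c: "c > 0" "\<And>t. t \<le> 0 \<Longrightarrow> norm (\<zeta> t) \<le> c * (1 + \<bar>t\<bar>)"
    by (auto simp: tempered_path_def)
  have C: "C \<ge> 0" using order_trans[OF norm_ge_zero growth[of 0]] by simp
  \<comment> \<open>Chosen so that \<open>a * y \<le> C2 / 2 * (1 + \<tau>)\<close> for
    \<open>y = 1 + c * (1 + \<tau>)\<close>: the polynomial growth then consumes at most the rate
    \<open>C2 / 2\<close> that \<open>solves_absorb\<close> permits.\<close>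
  define a where "a = C2 / (2 * (1 + c))"
  have a: "a > 0" using pos c by (simp add: a_def)
  obtain K where K: "K \<ge> 0" "\<And>y. y \<ge> 0 \<Longrightarrow> y ^ (2 * N) \<le> K * exp (a * y)"
    by (rule power_le_exp_scaled[OF a]) (rule that)
  define G where "G = 2 * C1 + C\<^sup>2 * (K * exp (C2 / 2)) / C2"
  have G: "2 * C1 + (norm (F (\<zeta> (- \<tau>))))\<^sup>2 / C2 \<le> G * exp (C2 * \<tau> / 2)" if \<tau>: "\<tau> \<ge> 0" for \<tau>
  proof -
    define y where "y = 1 + c * (1 + \<tau>)"
    have y: "y \<ge> 0" using c \<tau> by (simp add: y_def)
    have "norm (F (\<zeta> (- \<tau>))) \<le> C * (1 + norm (\<zeta> (- \<tau>))) ^ N" by (rule growth)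
    also have "\<dots> \<le> C * y ^ N"
      using c(2)[of "- \<tau>"] \<tau> C by (intro mult_left_mono power_mono) (auto simp: y_def)
    finally have "(norm (F (\<zeta> (- \<tau>))))\<^sup>2 \<le> (C * y ^ N)\<^sup>2"
      by (intro power_mono) auto
    also have "\<dots> = C\<^sup>2 * y ^ (2 * N)"
      by (simp add: power_mult_distrib power_mult[symmetric] mult.commute)
    also have "\<dots> \<le> C\<^sup>2 * (K * (exp (C2 / 2) * exp (C2 * \<tau> / 2)))"
    proof (intro mult_left_mono)
      have "a * y \<le> C2 / 2 + C2 * \<tau> / 2"
      proof -
        have "a * y \<le> a * ((1 + c) * (1 + \<tau>))"
          using a \<tau> by (intro mult_left_mono) (auto simp: y_def algebra_simps)
        also have "\<dots> = (a * (1 + c)) * (1 + \<tau>)" by (simp only: mult.assoc)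
        also have "a * (1 + c) = C2 / 2"
          using c(1) by (simp add: a_def nonzero_divide_eq_eq nonzero_eq_divide_eq)
        finally show ?thesis by (simp add: algebra_simps)
      qed
      then have "K * exp (a * y) \<le> K * (exp (C2 / 2) * exp (C2 * \<tau> / 2))"
        using K(1) by (intro mult_left_mono) (auto simp flip: exp_add)
      then show "y ^ (2 * N) \<le> K * (exp (C2 / 2) * exp (C2 * \<tau> / 2))"
        using K(2)[OF y] by linarith
    qed auto
    finally have "(norm (F (\<zeta> (- \<tau>))))\<^sup>2 / C2 \<le> C\<^sup>2 * (K * (exp (C2 / 2) * exp (C2 * \<tau> / 2))) / C2"
      using pos by (intro divide_right_mono) auto
    also have "\<dots> = C\<^sup>2 * (K * exp (C2 / 2)) / C2 * exp (C2 * \<tau> / 2)" by simp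
    finally have "(norm (F (\<zeta> (- \<tau>))))\<^sup>2 / C2 \<le> C\<^sup>2 * (K * exp (C2 / 2)) / C2 * exp (C2 * \<tau> / 2)" .
    moreover have "2 * C1 * 1 \<le> 2 * C1 * exp (C2 * \<tau> / 2)"
      using pos \<tau> by (intro mult_left_mono) auto
    ultimately show ?thesis unfolding G_def distrib_right by linarith
  qed
  define R where "R = sqrt (1 + 2 * G / C2)"
  have "\<exists>T0\<ge>0. \<forall>T\<ge>T0. \<forall>x. norm x \<le> k \<longrightarrow> norm (flow T \<zeta> x) \<le> R" for k
  proof -
    \<comment> \<open>The initial distance to \<open>\<zeta> (- T)\<close> grows at most linearly in
      \<open>T\<close>; with this rate its square is at most \<open>X * exp (C2 * T / 2)\<close>.
      The other half of the decay outweighs \<open>X\<close> from time \<open>2 * X / C2\<close> on,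
      because \<open>exp z \<ge> 1 + z\<close>.\<close>
    define b where "b = C2 / (2 * c)"
    have b: "b > 0" using pos c by (simp add: b_def)
    obtain K2 where K2: "K2 \<ge> 0" "\<And>y. y \<ge> 0 \<Longrightarrow> y\<^sup>2 \<le> K2 * exp (b * y)"
      by (rule power_le_exp_scaled[OF b]) (rule that)
    define X where "X = K2 * exp (b * (\<bar>k\<bar> + c))"
    have X: "X \<ge> 0" using K2 by (simp add: X_def)
    show ?thesis
    proof (intro exI[of _ "2 * X / C2"] conjI allI impI)
      show "0 \<le> 2 * X / C2" using X pos by simp
      fix T :: real and x :: "real ^ 'd" assume T: "2 * X / C2 \<le> T" and x: "norm x \<le> k"
      have T0: "0 \<le> T" using T X pos by (meson divide_nonneg_pos mult_nonneg_nonneg order_trans zero_le_numeral)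
      obtain u where u: "solves (driver T \<zeta>) x T u" "flow T \<zeta> x = u T"
        by (rule flow_solution[OF \<zeta> T0]) (rule that)
      have "(norm (u T - driver T \<zeta> T - \<zeta> (- T)))\<^sup>2 \<le> exp (- C2 * T) * (norm (x - \<zeta> (- T)))\<^sup>2 + 2 * G / C2"
      proof (rule solves_absorb[OF u(1) T0 continuous_driver[OF \<zeta>]])
        fix s assume "0 \<le> s" "s \<le> T"
        then show "2 * C1 + (norm (F (driver T \<zeta> s + \<zeta> (- T))))\<^sup>2 / C2 \<le> G * exp (C2 * (T - s) / 2)"
          using G[of "T - s"] by (simp add: driver_def)
      qed
      \<comment> \<open>At the final time the reference path is \<open>\<zeta> 0 = 0\<close>, so the
        estimate is about \<open>u T\<close> itself.\<close>
      moreover have "driver T \<zeta> T + \<zeta> (- T) = 0" using \<zeta> by (simp add: driver_def tempered_path_def)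
      then have "u T - driver T \<zeta> T - \<zeta> (- T) = u T" by (simp add: diff_diff_eq)
      moreover have "exp (- C2 * T) * (norm (x - \<zeta> (- T)))\<^sup>2 \<le> 1"
      proof -
        have "norm (x - \<zeta> (- T)) \<le> \<bar>k\<bar> + c + c * T"
          using norm_triangle_ineq4[of x "\<zeta> (- T)"] x c(2)[of "- T"] T0 by (simp add: algebra_simps)
        then have "(norm (x - \<zeta> (- T)))\<^sup>2 \<le> (\<bar>k\<bar> + c + c * T)\<^sup>2"
          by (intro power_mono) auto
        also have "\<dots> \<le> K2 * exp (b * (\<bar>k\<bar> + c + c * T))"
          using c T0 by (intro K2(2)) auto
        also have "\<dots> = X * exp (C2 * T / 2)"
          using c(1) by (simp add: X_def b_def distrib_left exp_add)
        also have "\<dots> \<le> exp (C2 * T / 2) * exp (C2 * T / 2)"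
        proof (rule mult_right_mono)
          have "X \<le> C2 * T / 2" using T pos by (simp add: field_simps)
          then show "X \<le> exp (C2 * T / 2)" using exp_ge_add_one_self[of "C2 * T / 2"] by linarith
        qed auto
        also have "\<dots> = exp (C2 * T)" by (simp flip: exp_add)
        finally have "exp (- C2 * T) * (norm (x - \<zeta> (- T)))\<^sup>2 \<le> exp (- C2 * T) * exp (C2 * T)"
          by (intro mult_left_mono) auto
        then show ?thesis by (simp flip: exp_add)
      qed
      ultimately have "(norm (u T))\<^sup>2 \<le> 1 + 2 * G / C2" by simp
      then show "norm (flow T \<zeta> x) \<le> R"
        unfolding u(2) R_def by (rule real_le_rsqrt)
    qed
  qed
  then show ?thesis by blast
qed

lemma flow_lipschitz:
  assumes \<zeta>: "tempered_path \<zeta>" and T: "0 \<le> T"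
  shows "norm (flow T \<zeta> x - flow T \<zeta> y) \<le> sqrt (exp ((2 * C3 + 1) * T)) * norm (x - y)"
proof -
  obtain u where u: "solves (driver T \<zeta>) x T u" "flow T \<zeta> x = u T"
    by (rule flow_solution[OF \<zeta> T]) (rule that)
  obtain v where v: "solves (driver T \<zeta>) y T v" "flow T \<zeta> y = v T"
    by (rule flow_solution[OF \<zeta> T]) (rule that)
  have "(norm (u T - driver T \<zeta> T - (v T - driver T \<zeta> T)))\<^sup>2
      \<le> exp ((2 * C3 + 1) * T) * ((norm (x - y))\<^sup>2 + 0\<^sup>2 * T)"
    by (rule solves_stability[OF u(1) v(1) T]) (auto intro: continuous_driver[OF \<zeta>])
  then have "norm (u T - v T) \<le> sqrt (exp ((2 * C3 + 1) * T) * (norm (x - y))\<^sup>2)"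
    by (intro real_le_rsqrt) simp
  then show ?thesis unfolding u(2) v(2) by (simp add: real_sqrt_mult)
qed

lemma continuous_flow:
  assumes "tempered_path \<zeta>" "0 \<le> T"
  shows "continuous_on A (flow T \<zeta>)"
proof (rule lipschitz_on_continuous_on)
  show "(sqrt (exp ((2 * C3 + 1) * T)))-lipschitz_on A (flow T \<zeta>)"
    using flow_lipschitz[OF assms] by (auto simp: lipschitz_on_def dist_norm)
qed

text \<open>The stability estimate along the solution for \<zeta>, which stays in a ball of radius
  \<open>M\<close>. Because \<open>d \<le> 1\<close>, the drivers differ by at most 2, and the
  Lipschitz constant on the ball of radius \<open>M + 2\<close> applies. \<open>B\<close> may depend
  on \<zeta> and \<open>x\<close>, which is enough for openness around a given path.\<close>

lemma flow_continuous_path: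
  assumes \<zeta>: "tempered_path \<zeta>" and T: "0 \<le> T"
  shows "\<exists>B>0. \<forall>\<zeta>' d. tempered_path \<zeta>' \<longrightarrow> 0 \<le> d \<longrightarrow> d \<le> 1 \<longrightarrow>
    (\<forall>r\<in>{- T..0}. norm (\<zeta>' r - \<zeta> r) \<le> d) \<longrightarrow> norm (flow T \<zeta>' x - flow T \<zeta> x) \<le> B * d"
proof -
  obtain u where u: "solves (driver T \<zeta>) x T u" "flow T \<zeta> x = u T"
    by (rule flow_solution[OF \<zeta> T]) (rule that)
  have "continuous_on {0..T} u" using u(1) by (simp add: solves_def)
  then obtain M where M: "M \<ge> 0" "\<And>s. 0 \<le> s \<Longrightarrow> s \<le> T \<Longrightarrow> norm (u s) \<le> M"
    by (rule continuous_on_Icc_bound) (rule that)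
  obtain L where L: "L > 0" "\<And>x y. norm x \<le> M + 2 \<Longrightarrow> norm y \<le> M + 2 \<Longrightarrow> norm (F x - F y) \<le> L * norm (x - y)"
    by (rule local_lipschitz_pos) (rule that)
  \<comment> \<open>The summand 1 pays for passing from the noise-free parts back to the solutions:
    at time \<open>T\<close> the drivers differ by at most \<open>d\<close>.\<close>
  define B where "B = sqrt (exp ((2 * C3 + 1) * T) * ((2 * L)\<^sup>2 * T)) + 1"
  have sq: "sqrt (exp ((2 * C3 + 1) * T) * ((2 * L)\<^sup>2 * T)) \<ge> 0" using T by simp
  show ?thesis
  proof (intro exI[of _ B] conjI allI impI)
    show "B > 0" using sq unfolding B_def by linarith
    fix \<zeta>' :: "'d path" and d :: real
    assume \<zeta>': "tempered_path \<zeta>'" and d: "0 \<le> d" "d \<le> 1"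
      and close: "\<forall>r\<in>{- T..0}. norm (\<zeta>' r - \<zeta> r) \<le> d"
    obtain v where v: "solves (driver T \<zeta>') x T v" "flow T \<zeta>' x = v T"
      by (rule flow_solution[OF \<zeta>' T]) (rule that)
    have "(norm ((v T - driver T \<zeta>' T) - (u T - driver T \<zeta> T)))\<^sup>2
        \<le> exp ((2 * C3 + 1) * T) * ((norm (x - x))\<^sup>2 + (2 * L * d)\<^sup>2 * T)"
    proof (rule solves_stability[OF v(1) u(1) T continuous_driver[OF \<zeta>'] continuous_driver[OF \<zeta>]])
      fix s assume s: "0 \<le> s" "s \<le> T"
      define \<delta> where "\<delta> = driver T \<zeta>' s - driver T \<zeta> s"
      have "\<delta> = (\<zeta>' (s - T) - \<zeta> (s - T)) - (\<zeta>' (- T) - \<zeta> (- T))"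
        by (simp add: \<delta>_def driver_def)
      then have \<delta>: "norm \<delta> \<le> 2 * d"
        using norm_triangle_ineq4[of "\<zeta>' (s - T) - \<zeta> (s - T)" "\<zeta>' (- T) - \<zeta> (- T)"]
          bspec[OF close, of "s - T"] bspec[OF close, of "- T"] s T by simp
      have eq: "u s - driver T \<zeta> s + driver T \<zeta>' s = u s + \<delta>" by (simp add: \<delta>_def)
      have "norm (F (u s + \<delta>) - F (u s)) \<le> L * norm ((u s + \<delta>) - u s)"
        using norm_triangle_ineq[of "u s" \<delta>] \<delta> M(2)[OF s] d by (intro L(2)) auto
      also have "\<dots> \<le> L * (2 * d)" using \<delta> L(1) by (intro mult_left_mono) auto
      finally show "norm (F (u s - driver T \<zeta> s + driver T \<zeta>' s) - F (u s)) \<le> 2 * L * d"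
        unfolding eq by simp
    qed
    then have "norm ((v T - driver T \<zeta>' T) - (u T - driver T \<zeta> T))
        \<le> sqrt (exp ((2 * C3 + 1) * T) * ((2 * L * d)\<^sup>2 * T))"
      by (intro real_le_rsqrt) simp
    also have "\<dots> = sqrt (exp ((2 * C3 + 1) * T) * ((2 * L)\<^sup>2 * T)) * d"
    proof -
      have "exp ((2 * C3 + 1) * T) * ((2 * L * d)\<^sup>2 * T) = exp ((2 * C3 + 1) * T) * ((2 * L)\<^sup>2 * T) * d\<^sup>2"
        by (simp add: power_mult_distrib mult_ac)
      then show ?thesis using d by (simp only: real_sqrt_mult[of _ "d\<^sup>2"]) simp
    qed
    finally have 1: "norm ((v T - driver T \<zeta>' T) - (u T - driver T \<zeta> T)) \<le> (B - 1) * d"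
      by (simp add: B_def)
    have "driver T \<zeta>' T - driver T \<zeta> T = \<zeta> (- T) - \<zeta>' (- T)"
      using \<zeta> \<zeta>' by (simp add: driver_def tempered_path_def)
    then have 2: "norm (driver T \<zeta>' T - driver T \<zeta> T) \<le> d"
      using bspec[OF close, of "- T"] T by (simp add: norm_minus_commute)
    have "v T - u T = ((v T - driver T \<zeta>' T) - (u T - driver T \<zeta> T)) + (driver T \<zeta>' T - driver T \<zeta> T)"
      by simp
    then have "norm (v T - u T) \<le> (B - 1) * d + d"
      using norm_triangle_mono[OF 1 2] by simp
    then show "norm (flow T \<zeta>' x - flow T \<zeta> x) \<le> B * d"
      unfolding u(2) v(2) by (simp add: algebra_simps)
  qed
qed

section \<open>Tails, limit sets of balls and the attractor\<close>

definition tail :: "nat \<Rightarrow> nat \<Rightarrow> 'd path \<Rightarrow> (real ^ 'd) set" where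
  "tail k n \<zeta> = {flow t \<zeta> x | t x. real n \<le> t \<and> norm x \<le> real k}"

definition omega :: "nat \<Rightarrow> 'd path \<Rightarrow> (real ^ 'd) set" where
  "omega k \<zeta> = (\<Inter>n. closure (tail k n \<zeta>))"

text \<open>Deterministic balls are used rather than one absorbing ball because the absorbing radius
  varies with the path: for fixed \<open>k\<close> the sets \<open>omega k\<close> of a path and of
  its shifts are mapped onto each other, and no measurability of a radius has to be discussed. The
  union need not be closed, hence the closure.\<close>

definition attractor :: "'d path \<Rightarrow> (real ^ 'd) set" where
  "attractor \<zeta> = closure (\<Union>k. omega k \<zeta>)"

lemma tailI: "real n \<le> t \<Longrightarrow> norm x \<le> real k \<Longrightarrow> flow t \<zeta> x \<in> tail k n \<zeta>"
  unfolding tail_def by blast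

lemma tail_antimono: "m \<le> n \<Longrightarrow> closure (tail k n \<zeta>) \<subseteq> closure (tail k m \<zeta>)"
  by (rule closure_mono) (auto simp: tail_def, metis le_trans of_nat_le_iff order_trans)

lemma tail_nonempty: "tail k n \<zeta> \<noteq> {}"
  using tailI[of n "real n" 0 k] by auto

lemma tail_bounded:
  assumes "tempered_path \<zeta>"
  obtains R where "\<And>k. \<exists>n. closure (tail k n \<zeta>) \<subseteq> cball 0 R"
proof -
  from flow_absorbing[OF assms] obtain R where
    R: "\<And>k. \<exists>T0\<ge>0. \<forall>T\<ge>T0. \<forall>x. norm x \<le> k \<longrightarrow> norm (flow T \<zeta> x) \<le> R" by blast
  have "\<exists>n. closure (tail k n \<zeta>) \<subseteq> cball 0 R" for k
  proof -
    from R[of "real k"] obtain T0 where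
      T0: "\<And>T x. T \<ge> T0 \<Longrightarrow> norm x \<le> real k \<Longrightarrow> norm (flow T \<zeta> x) \<le> R" by blast
    have "tail k (nat \<lceil>T0\<rceil>) \<zeta> \<subseteq> cball 0 R"
      by (auto simp: tail_def intro!: T0) linarith
    then show ?thesis using closure_minimal[OF _ closed_cball] by blast
  qed
  then show ?thesis by (rule that)
qed

lemma tail_eventually_bounded:
  assumes "tempered_path \<zeta>"
  obtains n where "bounded (closure (tail k n \<zeta>))"
proof -
  obtain R where "\<And>k. \<exists>n. closure (tail k n \<zeta>) \<subseteq> cball 0 R"
    by (rule tail_bounded[OF assms]) (rule that)
  then show ?thesis using bounded_subset[OF bounded_cball] that by blast
qed

lemma omega_nonempty:
  assumes "tempered_path \<zeta>"
  shows "omega k \<zeta> \<noteq> {}"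
proof -
  obtain n where "bounded (closure (tail k n \<zeta>))" by (rule tail_eventually_bounded[OF assms])
  then show ?thesis
    unfolding omega_def
    by (intro nested_closed_nonempty) (auto simp: tail_nonempty intro: subsetD[OF tail_antimono])
qed

text \<open>Cantor's intersection principle for the sets
  \<open>closure (tail k n \<zeta>) \<inter> S\<close>, which are nested and eventually bounded. It
  reduces the compactness arguments for attraction, backward invariance and measurability to
  checking that a closed set meets all tail closures.\<close>

lemma omega_meets:
  assumes "tempered_path \<zeta>" "closed S" "\<And>n. closure (tail k n \<zeta>) \<inter> S \<noteq> {}"
  shows "omega k \<zeta> \<inter> S \<noteq> {}"
proof -
  obtain n where n: "bounded (closure (tail k n \<zeta>))" by (rule tail_eventually_bounded[OF assms(1)])
  have "\<Inter> (range (\<lambda>n. closure (tail k n \<zeta>) \<inter> S)) \<noteq> {}"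
  proof (rule nested_closed_nonempty)
    show "bounded (closure (tail k n \<zeta>) \<inter> S)" using n by (rule bounded_subset) auto
    show "closure (tail k n \<zeta>) \<inter> S \<subseteq> closure (tail k m \<zeta>) \<inter> S" if "m \<le> n" for m n
      using tail_antimono[OF that] by blast
  qed (use assms in auto)
  then show ?thesis unfolding omega_def by blast
qed

lemma attractor_nonempty: "tempered_path \<zeta> \<Longrightarrow> attractor \<zeta> \<noteq> {}"
  unfolding attractor_def using omega_nonempty by auto

lemma omega_bounded:
  assumes "tempered_path \<zeta>"
  shows "bounded (\<Union>k. omega k \<zeta>)"
proof -
  obtain R where R: "\<And>k. \<exists>n. closure (tail k n \<zeta>) \<subseteq> cball 0 R"
    by (rule tail_bounded[OF assms]) (rule that)
  have "(\<Union>k. omega k \<zeta>) \<subseteq> cball 0 R" unfolding omega_def using R by blast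
  then show ?thesis by (rule bounded_subset[OF bounded_cball])
qed

lemma attractor_compact: "tempered_path \<zeta> \<Longrightarrow> compact (attractor \<zeta>)"
  unfolding attractor_def using omega_bounded by (simp add: compact_closure)

text \<open>Otherwise the closed set of points at distance at least \<open>e\<close> meets every
  tail, hence contains a point of \<open>omega k \<zeta>\<close>, which lies in the
  attractor.\<close>

lemma attractor_attracts:
  assumes \<zeta>: "tempered_path \<zeta>" and "e > 0"
  shows "\<exists>n. \<forall>t\<ge>real n. \<forall>x. norm x \<le> real k \<longrightarrow> infdist (flow t \<zeta> x) (attractor \<zeta>) < e"
proof (rule ccontr)
  assume neg: "\<not> ?thesis"
  let ?S = "{y. e \<le> infdist y (attractor \<zeta>)}"
  have "closed ?S"
    by (intro closed_Collect_le continuous_intros)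
  moreover have "closure (tail k n \<zeta>) \<inter> ?S \<noteq> {}" for n
  proof -
    from neg obtain t x where "real n \<le> t" "norm x \<le> real k" "flow t \<zeta> x \<in> ?S"
      unfolding not_ex not_all not_imp not_less mem_Collect_eq by blast
    then show ?thesis using tailI[of n t x k \<zeta>] closure_subset[of "tail k n \<zeta>"] by blast
  qed
  ultimately obtain y where "y \<in> omega k \<zeta>" "e \<le> infdist y (attractor \<zeta>)"
    using omega_meets[OF \<zeta>] by blast
  moreover from this have "y \<in> attractor \<zeta>"
    unfolding attractor_def using closure_subset[of "\<Union>k. omega k \<zeta>"] by blast
  ultimately show False using \<open>e > 0\<close> by simp
qed

text \<open>One inclusion is the cocycle property with continuity. For the other, the fibre of
  \<open>y\<close> under \<open>flow s \<zeta>\<close> is closed and has to meet each tail closure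
  of the shifted path; boundedness of late tails makes the image of the closure closed, so
  \<open>y\<close> is attained and not merely approached.\<close>

lemma omega_invariant:
  assumes \<zeta>: "tempered_path \<zeta>" and s: "0 \<le> s"
  shows "flow s \<zeta> ` omega k (path_shift s \<zeta>) = omega k \<zeta>"
proof
  let ?\<zeta>s = "path_shift s \<zeta>" and ?g = "flow s \<zeta>"
  note \<zeta>s = tempered_path_shift[OF \<zeta> s]
  have g: "continuous_on A ?g" for A by (rule continuous_flow[OF \<zeta> s])
  have sub: "?g ` tail k n ?\<zeta>s \<subseteq> tail k n \<zeta>" for n
  proof clarify
    fix y assume "y \<in> tail k n ?\<zeta>s"
    then obtain t x where tx: "y = flow t ?\<zeta>s x" "real n \<le> t" "norm x \<le> real k" by (auto simp: tail_def)
    then have "?g y = flow (t + s) \<zeta> x"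
      using flow_cocycle[OF \<zeta> _ s, of t x] by (auto dest: order_trans[OF of_nat_0_le_iff])
    then show "?g y \<in> tail k n \<zeta>" using tx s by (auto intro!: tailI)
  qed
  show "?g ` omega k ?\<zeta>s \<subseteq> omega k \<zeta>"
    unfolding omega_def
  proof clarify
    fix z n assume "z \<in> (\<Inter>n. closure (tail k n ?\<zeta>s))"
    then have "?g z \<in> ?g ` closure (tail k n ?\<zeta>s)" by blast
    also have "\<dots> \<subseteq> closure (?g ` tail k n ?\<zeta>s)"
      by (rule image_closure_subset[OF g closed_closure closure_subset])
    also have "\<dots> \<subseteq> closure (tail k n \<zeta>)" by (rule closure_mono[OF sub])
    finally show "?g z \<in> closure (tail k n \<zeta>)" .
  qed
  show "omega k \<zeta> \<subseteq> ?g ` omega k ?\<zeta>s"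
  proof
    fix y assume y: "y \<in> omega k \<zeta>"
    obtain n0 where n0: "bounded (closure (tail k n0 ?\<zeta>s))" by (rule tail_eventually_bounded[OF \<zeta>s])
    have "closed (?g -` {y})"
      using continuous_closed_vimage[of "{y}" ?g] g[of UNIV] by (simp add: continuous_on_eq_continuous_at)
    moreover have "closure (tail k n ?\<zeta>s) \<inter> ?g -` {y} \<noteq> {}" for n
    proof -
      define m where "m = max n n0"
      have bd: "bounded (tail k m ?\<zeta>s)"
        by (rule bounded_subset[OF n0]) (use tail_antimono[of n0 m k ?\<zeta>s] closure_subset in \<open>auto simp: m_def\<close>)
      \<comment> \<open>Rounding \<open>s\<close> up leaves at least \<open>m\<close> time units
        before the last \<open>s\<close> ones.\<close>
      have "tail k (m + nat \<lceil>s\<rceil>) \<zeta> \<subseteq> ?g ` tail k m ?\<zeta>s"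
      proof
        fix z assume "z \<in> tail k (m + nat \<lceil>s\<rceil>) \<zeta>"
        then obtain t x where tx: "z = flow t \<zeta> x" "real (m + nat \<lceil>s\<rceil>) \<le> t" "norm x \<le> real k"
          by (auto simp: tail_def)
        then have ts: "real m \<le> t - s" by (simp add: le_diff_eq) linarith
        then have "z = ?g (flow (t - s) ?\<zeta>s x)"
          using flow_cocycle[OF \<zeta> _ s, of "t - s" x] tx(1) by simp
        then show "z \<in> ?g ` tail k m ?\<zeta>s" using tailI[OF ts tx(3)] by blast
      qed
      then have "y \<in> closure (?g ` tail k m ?\<zeta>s)"
        using y closure_mono unfolding omega_def by blast
      also have "\<dots> = ?g ` closure (tail k m ?\<zeta>s)"
        by (rule image_closure_eq[OF g bd, symmetric])
      also have "\<dots> \<subseteq> ?g ` closure (tail k n ?\<zeta>s)"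
        by (intro image_mono tail_antimono) (simp add: m_def)
      finally show ?thesis by auto
    qed
    ultimately have "omega k ?\<zeta>s \<inter> ?g -` {y} \<noteq> {}" by (rule omega_meets[OF \<zeta>s])
    then show "y \<in> ?g ` omega k ?\<zeta>s" by auto
  qed
qed

lemma attractor_invariant:
  assumes \<zeta>: "tempered_path \<zeta>" and s: "0 \<le> s"
  shows "flow s \<zeta> ` attractor (path_shift s \<zeta>) = attractor \<zeta>"
proof -
  have "flow s \<zeta> ` attractor (path_shift s \<zeta>) = closure (flow s \<zeta> ` (\<Union>k. omega k (path_shift s \<zeta>)))"
    unfolding attractor_def
    by (intro image_closure_eq continuous_flow[OF \<zeta> s] omega_bounded tempered_path_shift[OF \<zeta> s])
  then show ?thesis
    unfolding attractor_def image_UN omega_invariant[OF \<zeta> s] .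
qed

text \<open>The distance is expressed through the tails with countably many quantifiers besides the
  choice of a point. The slack \<open>1 / Suc m\<close> keeps the inequality strict in the limit,
  since \<open>omega_meets\<close> only returns a point of the closed ball of radius
  \<open>c - 1 / Suc m\<close>.\<close>

lemma infdist_attractor_less_iff:
  assumes \<zeta>: "tempered_path \<zeta>"
  shows "infdist x (attractor \<zeta>) < c \<longleftrightarrow>
    (\<exists>k m. \<forall>n. \<exists>y\<in>tail k n \<zeta>. dist x y < c - 1 / real (Suc m))"
proof -
  have ne: "(\<Union>k. omega k \<zeta>) \<noteq> {}" using omega_nonempty[OF \<zeta>] by auto
  have "infdist x (attractor \<zeta>) < c \<longleftrightarrow> (\<exists>k. \<exists>a\<in>omega k \<zeta>. dist x a < c)"
    unfolding attractor_def infdist_closure_less_iff[OF ne] by auto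
  also have "\<dots> \<longleftrightarrow> (\<exists>k m. \<forall>n. \<exists>y\<in>tail k n \<zeta>. dist x y < c - 1 / real (Suc m))"
  proof (rule ex_cong1, rule iffI)
    fix k assume "\<exists>a\<in>omega k \<zeta>. dist x a < c"
    then obtain a where a: "a \<in> omega k \<zeta>" "dist x a < c" by blast
    obtain m where m: "1 / real (Suc m) < c - dist x a"
      using reals_Archimedean[of "c - dist x a"] a(2) by (auto simp: inverse_eq_divide)
    have "\<exists>y\<in>tail k n \<zeta>. dist x y < c - 1 / real (Suc m)" for n
    proof -
      have "a \<in> closure (tail k n \<zeta>)" using a(1) by (auto simp: omega_def)
      moreover have "c - 1 / real (Suc m) - dist x a > 0" using m by linarith
      ultimately obtain y where y: "y \<in> tail k n \<zeta>" "dist y a < c - 1 / real (Suc m) - dist x a"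
        unfolding closure_approachable by blast
      then show ?thesis
        using dist_triangle[of x y a] by (intro bexI[of _ y]) (auto simp: dist_commute)
    qed
    then show "\<exists>m. \<forall>n. \<exists>y\<in>tail k n \<zeta>. dist x y < c - 1 / real (Suc m)" by blast
  next
    fix k assume "\<exists>m. \<forall>n. \<exists>y\<in>tail k n \<zeta>. dist x y < c - 1 / real (Suc m)"
    then obtain m where m: "\<And>n. \<exists>y\<in>tail k n \<zeta>. dist x y < c - 1 / real (Suc m)" by blast
    have "omega k \<zeta> \<inter> cball x (c - 1 / real (Suc m)) \<noteq> {}"
    proof (rule omega_meets[OF \<zeta> closed_cball])
      fix n
      from m[of n] obtain y where "y \<in> tail k n \<zeta>" "dist x y < c - 1 / real (Suc m)" by blast
      then show "closure (tail k n \<zeta>) \<inter> cball x (c - 1 / real (Suc m)) \<noteq> {}"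
        using closure_subset[of "tail k n \<zeta>"] by (auto simp: disjoint_iff intro!: exI[of _ y])
    qed
    then obtain a where "a \<in> omega k \<zeta>" "dist x a \<le> c - 1 / real (Suc m)" by auto
    moreover have "1 / real (Suc m) > 0" by simp
    ultimately show "\<exists>a\<in>omega k \<zeta>. dist x a < c" by (intro bexI[of _ a]) linarith+
  qed
  finally show ?thesis .
qed

end

section \<open>Existence of the attractor for the stochastic equation\<close>

lemma B_weight_le:
  fixes t a :: real
  assumes "0 \<le> a" "a \<le> 1 / 2"
  shows "sqrt (1 + \<bar>t\<bar>) * \<bar>t\<bar> powr a \<le> 1 + \<bar>t\<bar>"
proof -
  have "\<bar>t\<bar> powr a \<le> (1 + \<bar>t\<bar>) powr a" using assms by (intro powr_mono2) auto
  also have "\<dots> \<le> (1 + \<bar>t\<bar>) powr (1 / 2)" using assms by (intro powr_mono) auto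
  also have "\<dots> = sqrt (1 + \<bar>t\<bar>)" by (simp add: powr_half_sqrt)
  finally have "sqrt (1 + \<bar>t\<bar>) * \<bar>t\<bar> powr a \<le> sqrt (1 + \<bar>t\<bar>) * sqrt (1 + \<bar>t\<bar>)"
    by (intro mult_left_mono) auto
  then show ?thesis by simp
qed

text \<open>The norm bound against time 0 gives linear growth; against a nearby time it gives local
  Hoelder continuity with exponent \<open>(1 - h) / 2 > 0\<close>.\<close>

lemma B_space_tempered:
  fixes \<eta> :: "'d::finite path"
  assumes h: "0 < h" "h < 1" and \<eta>: "\<eta> \<in> B_space h"
  shows "tempered_path \<eta>"
proof -
  define M where "M = enn2real (B_norm h \<eta>)"
  have M0: "M \<ge> 0" by (simp add: M_def)
  note bd = B_norm_finite_bound[OF B_norm_B_space_finite[OF h \<eta>], folded M_def]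
  have "continuous_on {..0} \<eta>"
    unfolding continuous_on_def
  proof
    fix s :: real assume s: "s \<in> {..0}"
    let ?F = "at s within {..0}"
    have "((\<lambda>t. \<bar>t - s\<bar>) \<longlongrightarrow> \<bar>s - s\<bar>) ?F" by (intro tendsto_intros)
    then have "((\<lambda>t. \<bar>t - s\<bar>) \<longlongrightarrow> 0) ?F" by simp
    then have "((\<lambda>t. \<bar>t - s\<bar> powr ((1 - h) / 2)) \<longlongrightarrow> 0) ?F"
      by (rule tendsto_zero_powrI[OF _ tendsto_const]) (use h in auto)
    moreover have "((\<lambda>t. sqrt (1 + \<bar>t\<bar> + \<bar>s\<bar>)) \<longlongrightarrow> sqrt (1 + \<bar>s\<bar> + \<bar>s\<bar>)) ?F"
      by (intro tendsto_intros)
    ultimately have "((\<lambda>t. M * (sqrt (1 + \<bar>t\<bar> + \<bar>s\<bar>) * \<bar>t - s\<bar> powr ((1 - h) / 2))) \<longlongrightarrow>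
        M * (sqrt (1 + \<bar>s\<bar> + \<bar>s\<bar>) * 0)) ?F"
      by (intro tendsto_mult tendsto_const)
    moreover have "\<forall>\<^sub>F t in ?F. norm (\<eta> t - \<eta> s) \<le> M * (sqrt (1 + \<bar>t\<bar> + \<bar>s\<bar>) * \<bar>t - s\<bar> powr ((1 - h) / 2))"
      unfolding eventually_at_filter using bd[of s] s by (intro always_eventually) auto
    ultimately have "((\<lambda>t. \<eta> t - \<eta> s) \<longlongrightarrow> 0) ?F"
      by (intro Lim_null_comparison[of "\<lambda>t. \<eta> t - \<eta> s"]) auto
    then show "(\<eta> \<longlongrightarrow> \<eta> s) ?F" by (rule LIM_zero_cancel)
  qed
  moreover have "norm (\<eta> t) \<le> (M + 1) * (1 + \<bar>t\<bar>)" if "t \<le> 0" for t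
  proof -
    have "norm (\<eta> t) \<le> M * (sqrt (1 + \<bar>t\<bar>) * \<bar>t\<bar> powr ((1 - h) / 2))"
      using bd[of 0 t] that B_space_vanish[OF \<eta>, of 0] by simp
    also have "\<dots> \<le> M * (1 + \<bar>t\<bar>)"
      using h M0 by (intro mult_left_mono B_weight_le) auto
    finally show ?thesis by (simp add: distrib_right)
  qed
  ultimately show ?thesis
    unfolding tempered_path_def using B_space_vanish[OF \<eta>, of 0] M0 by (auto intro!: exI[of _ "M + 1"])
qed

lemma tempered_path_linear:
  assumes L: "bounded_linear L" and \<zeta>: "tempered_path \<zeta>"
  shows "tempered_path (\<lambda>t. L (\<zeta> t))"
proof -
  from \<zeta> obtain c where c: "c > 0" "\<And>t. t \<le> 0 \<Longrightarrow> norm (\<zeta> t) \<le> c * (1 + \<bar>t\<bar>)"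
    and cont: "continuous_on {..0} \<zeta>" and z: "\<zeta> 0 = 0" by (auto simp: tempered_path_def)
  from bounded_linear.pos_bounded[OF L] obtain K where K: "K > 0" "\<And>x. norm (L x) \<le> norm x * K" by blast
  have "norm (L (\<zeta> t)) \<le> (c * K) * (1 + \<bar>t\<bar>)" if "t \<le> 0" for t
  proof -
    have "norm (L (\<zeta> t)) \<le> norm (\<zeta> t) * K" by (rule K(2))
    also have "\<dots> \<le> (c * (1 + \<bar>t\<bar>)) * K" using c(2)[OF that] K(1) by (intro mult_right_mono) auto
    finally show ?thesis by (simp add: mult_ac)
  qed
  moreover have "continuous_on {..0} (\<lambda>t. L (\<zeta> t))"
    by (rule bounded_linear.continuous_on[OF L cont])
  moreover have "c * K > 0" using c(1) K(1) by simp
  ultimately show ?thesis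
    unfolding tempered_path_def using z linear_0[OF bounded_linear.linear[OF L]] by auto
qed

lemma path_shift_linear:
  assumes "bounded_linear L"
  shows "path_shift s (\<lambda>t. L (\<zeta> t)) = (\<lambda>t. L (path_shift s \<zeta> t))"
  using linear_diff[OF bounded_linear.linear[OF assms]] linear_0[OF bounded_linear.linear[OF assms]]
  by (auto simp: path_shift_def)

lemma continuous_on_atLeast_iff:
  fixes u :: "real \<Rightarrow> 'a::topological_space"
  shows "continuous_on {0..} u \<longleftrightarrow> (\<forall>T\<ge>0. continuous_on {0..T} u)"
proof (intro iffI allI impI)
  assume *: "\<forall>T\<ge>0. continuous_on {0..T} u"
  show "continuous_on {0..} u"
    unfolding continuous_on_eq_continuous_within
  proof
    fix t :: real assume t: "t \<in> {0..}"
    have "at t within {0..} = at t within {0..t + 1}"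
      by (rule at_within_nhd[of _ "{..<t + 1}"]) auto
    then show "continuous (at t within {0..}) u"
      using * t by (simp add: continuous_on_eq_continuous_within)
  qed
qed (auto intro: continuous_on_subset)

section \<open>From the stochastic equation to the pathwise flow\<close>

context dissipative_sde
begin

lemma solves_cong_solution:
  assumes "\<And>t. 0 \<le> t \<Longrightarrow> t \<le> T \<Longrightarrow> u t = v t" "solves b x T u"
  shows "solves b x T v"
proof -
  have "integral {0..t} (\<lambda>s. F (u s)) = integral {0..t} (\<lambda>s. F (v s))" if "t \<le> T" for t
    using assms(1) that by (intro integral_cong) auto
  moreover have "continuous_on {0..T} v"
    using assms by (intro continuous_on_eq[of _ u v]) (auto simp: solves_def)
  ultimately show ?thesis using assms unfolding solves_def by auto
qed

text \<open>Solutions on different horizons agree by uniqueness, so the diagonal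
  \<open>U t t\<close> solves on all of them.\<close>

lemma solves_global:
  assumes b: "\<And>T. 0 \<le> T \<Longrightarrow> continuous_on {0..T} b"
  shows "\<exists>u. \<forall>T\<ge>0. solves b x T u"
proof -
  have "\<exists>u. solves b x T u" if "T \<ge> 0" for T
    using solves_exists[OF that b[OF that]] .
  then obtain U where U: "\<And>T. T \<ge> 0 \<Longrightarrow> solves b x T (U T)" by metis
  have "solves b x T (\<lambda>t. U t t)" if T: "T \<ge> 0" for T
  proof (rule solves_cong_solution[OF _ U[OF T]])
    fix t :: real assume t: "0 \<le> t" "t \<le> T"
    show "U T t = U t t"
      by (rule solves_unique[OF solves_mono[OF U[OF T] t(2)] U[OF t(1)] b[OF t(1)] t(1) order_refl])
  qed
  then show ?thesis by blast
qed

text \<open>\<open>Phi\<close> is defined by global solutions for one noise pair,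
  \<open>flow\<close> by a horizon and a past. The past \<open>Z T\<close> may vary with the
  horizon, as \<open>P_op T\<close> does; only its increments on \<open>{- T..0}\<close> must
  reproduce the noise.\<close>

lemma Phi_eq_flow:
  assumes Z: "\<And>T. T \<ge> 0 \<Longrightarrow> tempered_path (Z T)"
    and drv: "\<And>s T. 0 \<le> s \<Longrightarrow> s \<le> T \<Longrightarrow> \<sigma> *v fBM D s \<omega> = driver T (Z T) s"
    and t: "t \<ge> 0"
  shows "Phi D F \<sigma> t \<omega> x = flow t (Z t) x"
proof -
  let ?b = "\<lambda>s. \<sigma> *v fBM D s \<omega>"
  have sol: "sde_solution D F \<sigma> \<omega> x u \<longleftrightarrow> (\<forall>T\<ge>0. solves ?b x T u)" for u
    unfolding sde_solution_def solves_def continuous_on_atLeast_iff by auto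
  have "continuous_on {0..T} ?b" if "T \<ge> 0" for T
    by (rule continuous_on_eq[OF continuous_driver[OF Z[OF that]]]) (use drv in auto)
  then obtain u where u: "\<And>T. T \<ge> 0 \<Longrightarrow> solves ?b x T u"
    using solves_global[of ?b x] by blast
  have uniq: "v t = flow t (Z t) x" if v: "sde_solution D F \<sigma> \<omega> x v" for v
  proof -
    have "solves ?b x t v" using v t by (simp add: sol)
    also have "solves ?b x t v \<longleftrightarrow> solves (driver t (Z t)) x t v"
      by (rule solves_cong) (rule drv)
    finally show ?thesis by (rule flow_eq[OF Z[OF t] t, symmetric])
  qed
  show ?thesis
    unfolding Phi_def
  proof (rule the_equality)
    have "sde_solution D F \<sigma> \<omega> x u" using u by (simp add: sol)
    then show "\<exists>u. sde_solution D F \<sigma> \<omega> x u \<and> u t = flow t (Z t) x"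
      using uniq by blast
  qed (use uniq in blast)
qed

end

text \<open>Commutation with shifts turns \<open>D (P_op s (\<omega>m, \<omega>p))\<close> into a
  shift of \<open>D (P_op T (\<omega>m, \<omega>p))\<close>, and the minus sign in
  \<open>fBM\<close> orients the increment from \<open>- T\<close> to \<open>s - T\<close>.\<close>

lemma fBM_eq_driver:
  fixes D :: "'d::finite path \<Rightarrow> 'd path"
  assumes H: "0 < H" "H < 1"
    and shift: "\<And>\<omega> t. \<omega> \<in> B_space H \<Longrightarrow> t \<ge> 0 \<Longrightarrow> D (path_shift t \<omega>) = path_shift t (D \<omega>)"
    and \<omega>: "\<omega>m \<in> B_space H" "\<omega>p \<in> B_space H" and s: "0 \<le> s" "s \<le> T"
  shows "\<sigma> *v fBM D s (\<omega>m, \<omega>p) = driver T (\<lambda>r. \<sigma> *v D (P_op T (\<omega>m, \<omega>p)) r) s"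
proof -
  let ?\<eta> = "D (P_op T (\<omega>m, \<omega>p))"
  have "P_op s (\<omega>m, \<omega>p) = path_shift (T - s) (P_op T (\<omega>m, \<omega>p))"
    using \<omega> s by (intro path_shift_P_op_le[symmetric]) (auto simp: B_space_vanish)
  then have "D (P_op s (\<omega>m, \<omega>p)) = path_shift (T - s) ?\<eta>"
    using shift[OF P_op_in_B_space[OF H \<omega>], of T "T - s"] s by simp
  then have "fBM D s (\<omega>m, \<omega>p) = ?\<eta> (s - T) - ?\<eta> (- T)"
    using s by (simp add: fBM_def path_shift_def)
  then show ?thesis
    by (simp add: driver_def matrix_vector_mult_diff_distrib)
qed

theorem theorem3p7:
  fixes H \<alpha> C1 C2 C3 C :: real and N :: nat
    and P :: "'d::finite path measure"
    and D :: "'d path \<Rightarrow> 'd path"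
    and F :: "real ^ 'd \<Rightarrow> real ^ 'd"
    and \<sigma> :: "real ^ 'd ^ 'd"
  assumes H: "0 < H" "H < 1"
    and P: "wiener_measure H P"
    and D: "is_D_op H P \<alpha> D"
    and sigma: "invertible \<sigma>"
    and pos: "C1 > 0" "C2 > 0" "C3 > 0"
    and dissipative: "\<And>\<xi>1 \<xi>2. (F \<xi>2 - F \<xi>1) \<bullet> (\<xi>2 - \<xi>1)
          \<le> min (C1 - C2 * (norm (\<xi>2 - \<xi>1))\<^sup>2) (C3 * (norm (\<xi>2 - \<xi>1))\<^sup>2)"
    and diff: "\<And>\<xi>. F differentiable (at \<xi>)"
    and growth_pos: "C > 0" "N \<ge> 1"
    and growth: "\<And>\<xi>. norm (F \<xi>) \<le> C * (1 + norm \<xi>) ^ N"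
    and growth_deriv: "\<And>\<xi>. onorm (frechet_derivative F (at \<xi>)) \<le> C * (1 + norm \<xi>) ^ N"
    and deriv_bounded: "H > 1 / 2 \<Longrightarrow> \<exists>K. \<forall>\<xi>. onorm (frechet_derivative F (at \<xi>)) \<le> K"
  shows "\<exists>A. P_pullback_attractor P (Phi D F \<sigma>) (phi D F \<sigma>) A"
proof -
  interpret dissipative_sde F C1 C2 C3 C N
  proof
    fix R
    \<comment> \<open>Mean value inequality on the convex ball, where the derivative bound is at
      most its value at radius \<open>R\<close>.\<close>
    have "norm (F x - F y) \<le> (C * (1 + R) ^ N) * norm (x - y)" if "x \<in> cball 0 R" "y \<in> cball 0 R" for x y
    proof (rule differentiable_bound[OF convex_cball _ _ that])
      fix z :: "real ^ 'd" assume z: "z \<in> cball 0 R"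
      show "(F has_derivative frechet_derivative F (at z)) (at z within cball 0 R)"
        using diff[of z] unfolding frechet_derivative_works by (rule has_derivative_at_withinI)
      have "C * (1 + norm z) ^ N \<le> C * (1 + R) ^ N"
        using z growth_pos by (intro mult_left_mono power_mono) auto
      then show "onorm (frechet_derivative F (at z)) \<le> C * (1 + R) ^ N"
        using growth_deriv[of z] by linarith
    qed
    then show "\<exists>L. \<forall>x\<in>cball 0 R. \<forall>y\<in>cball 0 R. norm (F x - F y) \<le> L * norm (x - y)" by blast
  next
    show "C1 \<ge> 0" "C2 > 0" "C3 \<ge> 0" using pos by simp_all
    show "(F y - F x) \<bullet> (y - x) \<le> C1 - C2 * (norm (y - x))\<^sup>2" for x y
      by (rule order_trans[OF dissipative min.cobounded1])
    show "(F y - F x) \<bullet> (y - x) \<le> C3 * (norm (y - x))\<^sup>2" for x y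
      by (rule order_trans[OF dissipative min.cobounded2])
    show "norm (F x) \<le> C * (1 + norm x) ^ N" for x by (rule growth)
  qed
  have H': "0 < 1 - H" "1 - H < 1" using H by auto
  have setsP: "sets P = sets (B_borel H)" using P by (simp add: wiener_measure_def)
  have spaceP: "space P = B_space H"
    using sets_eq_imp_space_eq[OF setsP] space_B_borel[OF H] by simp
  have Dcont: "continuous_map (B_top H) (B_top (1 - H)) D" using D by (simp add: is_D_op_def)
  have shift: "D (path_shift t \<omega>) = path_shift t (D \<omega>)" if "\<omega> \<in> B_space H" "t \<ge> 0" for \<omega> t
    by (rule D_path_shift[OF H Dcont _ that, of \<alpha>]) (use D in \<open>simp add: is_D_op_def\<close>)
  have DB: "D \<omega> \<in> B_space (1 - H)" if "\<omega> \<in> B_space H" for \<omega>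
    by (rule continuous_map_B_top_D(1)[OF H H' Dcont that])
  have \<sigma>: "bounded_linear ((*v) \<sigma>)" by simp
  define Z where "Z \<omega> = (\<lambda>r. \<sigma> *v D \<omega> r)" for \<omega>
  have Z: "tempered_path (Z \<omega>)" if "\<omega> \<in> B_space H" for \<omega>
    unfolding Z_def by (intro tempered_path_linear[OF \<sigma>] B_space_tempered[OF H'] DB that)
  have Z_shift: "Z (path_shift t \<omega>) = path_shift t (Z \<omega>)" if "\<omega> \<in> B_space H" "t \<ge> 0" for \<omega> t
    unfolding Z_def shift[OF that] path_shift_linear[OF \<sigma>] ..
  have Phi_flow: "Phi D F \<sigma> t (\<omega>m, \<omega>p) x = flow t (Z (P_op t (\<omega>m, \<omega>p))) x"
    if \<omega>: "\<omega>m \<in> B_space H" "\<omega>p \<in> B_space H" and t: "t \<ge> 0" for \<omega>m \<omega>p t x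
  proof (rule Phi_eq_flow[OF _ _ t])
    show "tempered_path (Z (P_op T (\<omega>m, \<omega>p)))" if "T \<ge> 0" for T
      by (intro Z P_op_in_B_space[OF H \<omega> that])
    show "\<sigma> *v fBM D s (\<omega>m, \<omega>p) = driver T (Z (P_op T (\<omega>m, \<omega>p))) s" if "0 \<le> s" "s \<le> T" for s T
      unfolding Z_def by (rule fBM_eq_driver[OF H shift \<omega> that])
  qed
  have zero: "(\<lambda>_. 0) \<in> (B_space H :: 'd path set)" using C0_inf_zero C0_inf_subset_B_space by blast
  have phi_flow: "phi D F \<sigma> t \<omega> x = flow t (Z \<omega>) x" if \<omega>: "\<omega> \<in> B_space H" and t: "t \<ge> 0" for \<omega> t x
  proof -
    obtain \<omega>1 \<omega>2 where th: "theta (- t) (\<omega>, \<lambda>_. 0) = (\<omega>1, \<omega>2)" by fastforce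
    have "\<omega>1 \<in> B_space H \<and> \<omega>2 \<in> B_space H"
    \<comment> \<open>At \<open>t = 0\<close> the definition of \<open>theta\<close> takes its
      branch for nonnegative times, where the roles of \<open>P_op\<close> and
      \<open>path_shift\<close> are exchanged.\<close>
    proof (cases "t = 0")
      case True
      then show ?thesis
        using th P_op_in_B_space[OF H \<omega> zero, of 0] path_shift_in_B_space[OF H zero, of 0] by (auto simp del: P_op.simps)
    next
      case False
      then show ?thesis
        using th t P_op_in_B_space[OF H zero \<omega>, of t] path_shift_in_B_space[OF H \<omega>, of t] by (auto simp del: P_op.simps)
    qed
    moreover have "P_op t (\<omega>1, \<omega>2) = \<omega>"
      unfolding th[symmetric] using \<omega> t by (intro P_op_theta_neg) (auto simp: B_space_vanish)
    ultimately show ?thesis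
      unfolding phi_def th using Phi_flow[of \<omega>1 \<omega>2 t x] t by simp
  qed
  define A where "A \<omega> = attractor (Z \<omega>)" for \<omega>
  \<comment> \<open>A single witness \<open>flow t (Z \<omega>) z\<close> strictly within distance
    \<open>c\<close> of \<open>x\<close> persists for all nearby paths, so the set is open although
    \<open>t\<close> and \<open>z\<close> range over uncountable sets.\<close>
  have open_tail: "openin (B_top H) {\<omega> \<in> B_space H. \<exists>y\<in>tail k n (Z \<omega>). dist x y < c}" for k n x c
  proof (rule openin_B_top_I[OF H])
    fix \<omega> assume "\<omega> \<in> {\<omega> \<in> B_space H. \<exists>y\<in>tail k n (Z \<omega>). dist x y < c}"
    then obtain t z where \<omega>: "\<omega> \<in> B_space H" and tz: "real n \<le> t" "norm z \<le> real k" "dist x (flow t (Z \<omega>) z) < c"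
      by (auto simp: tail_def)
    have t: "0 \<le> t" using tz(1) by (auto intro: order_trans[OF of_nat_0_le_iff])
    from flow_continuous_path[OF Z[OF \<omega>] t, of z] obtain B where B: "B > 0"
      "\<And>\<zeta>' d. tempered_path \<zeta>' \<Longrightarrow> 0 \<le> d \<Longrightarrow> d \<le> 1 \<Longrightarrow>
        (\<forall>r\<in>{- t..0}. norm (\<zeta>' r - Z \<omega> r) \<le> d) \<Longrightarrow> norm (flow t \<zeta>' z - flow t (Z \<omega>) z) \<le> B * d" by blast
    from bounded_linear.pos_bounded[OF \<sigma>] obtain K where K: "K > 0" "\<And>x. norm (\<sigma> *v x) \<le> norm x * K" by blast
    define e where "e = c - dist x (flow t (Z \<omega>) z)"
    \<comment> \<open>With this \<open>d\<close> the flow moves by less than the slack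
      \<open>e\<close>. The radius \<open>d / (K * (1 + t))\<close> below absorbs the bound
      \<open>K\<close> of \<sigma> and the weight, which is at most \<open>1 + t\<close> on
      \<open>{- t..0}\<close>.\<close>
    define d where "d = min 1 (e / (2 * B))"
    have e: "e > 0" using tz(3) by (simp add: e_def)
    have d: "d > 0" "d \<le> 1" "B * d < e"
    proof -
      show "d > 0" "d \<le> 1" using e B(1) by (auto simp: d_def)
      have "B * d \<le> B * (e / (2 * B))" using B(1) by (intro mult_left_mono) (auto simp: d_def)
      also have "\<dots> = e / 2" using B(1) by simp
      finally show "B * d < e" using e by linarith
    qed
    have "d / (K * (1 + t)) > 0" using d K t by simp
    from continuous_map_B_top_D(2)[OF H H' Dcont \<omega> this] obtain r where
      r: "r > 0" "\<And>\<eta>. \<eta> \<in> B_space H \<Longrightarrow> B_dist H \<omega> \<eta> < r \<Longrightarrow> B_dist (1 - H) (D \<omega>) (D \<eta>) < d / (K * (1 + t))" by blast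
    have "\<eta> \<in> {\<omega> \<in> B_space H. \<exists>y\<in>tail k n (Z \<omega>). dist x y < c}"
      if \<eta>: "\<eta> \<in> B_space H" "B_dist H \<omega> \<eta> < r" for \<eta>
    proof -
      have "norm (flow t (Z \<eta>) z - flow t (Z \<omega>) z) \<le> B * d"
      proof (rule B(2)[OF Z[OF \<eta>(1)]], goal_cases)
        case 3
        show ?case
        proof
          fix s assume "s \<in> {- t..0}"
          then have s: "- t \<le> s" "s \<le> 0" by auto
          have "norm (Z \<eta> s - Z \<omega> s) = norm (\<sigma> *v (D \<eta> s - D \<omega> s))"
            by (simp add: Z_def matrix_vector_mult_diff_distrib)
          also have "\<dots> \<le> norm (D \<eta> s - D \<omega> s) * K" by (rule K(2))
          also have "\<dots> \<le> (B_dist (1 - H) (D \<omega>) (D \<eta>) * (sqrt (1 + \<bar>s\<bar>) * \<bar>s\<bar> powr ((1 - (1 - H)) / 2))) * K"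
            using B_dist_bound[OF H' DB[OF \<omega>] DB[OF \<eta>(1)] s(2)] K(1)
            by (intro mult_right_mono) (auto simp: norm_minus_commute)
          also have "\<dots> \<le> (d / (K * (1 + t)) * (1 + t)) * K"
          proof (intro mult_right_mono mult_mono)
            have "sqrt (1 + \<bar>s\<bar>) * \<bar>s\<bar> powr ((1 - (1 - H)) / 2) \<le> 1 + \<bar>s\<bar>"
              using H by (intro B_weight_le) auto
            then show "sqrt (1 + \<bar>s\<bar>) * \<bar>s\<bar> powr ((1 - (1 - H)) / 2) \<le> 1 + t" using s by linarith
          qed (use r(2)[OF \<eta>] d K t in auto)
          also have "\<dots> = d" using K(1) t by simp
          finally show "norm (Z \<eta> s - Z \<omega> s) \<le> d" .
        qed
      qed (use d in auto)
      then have "dist x (flow t (Z \<eta>) z) < c"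
        using dist_triangle[of x "flow t (Z \<eta>) z" "flow t (Z \<omega>) z"] d(3)
        by (simp add: e_def dist_norm norm_minus_commute)
      then show ?thesis using \<eta>(1) tailI[OF tz(1,2), of "Z \<eta>"] by blast
    qed
    then show "\<exists>r>0. \<forall>\<eta>\<in>B_space H. B_dist H \<omega> \<eta> < r \<longrightarrow> \<eta> \<in> {\<omega> \<in> B_space H. \<exists>y\<in>tail k n (Z \<omega>). dist x y < c}"
      using r(1) by blast
  qed auto
  have meas: "(\<lambda>\<omega>. infdist x (A \<omega>)) \<in> borel_measurable P" for x
    unfolding borel_measurable_iff_less
  proof
    fix c
    \<comment> \<open>Each sublevel set is a countable union of countable intersections of open
      sets.\<close>
    have "{\<omega> \<in> space P. infdist x (A \<omega>) < c} =
        (\<Union>k. \<Union>m. \<Inter>n. {\<omega> \<in> B_space H. \<exists>y\<in>tail k n (Z \<omega>). dist x y < c - 1 / real (Suc m)})"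
    proof (rule set_eqI)
      fix \<omega>
      show "\<omega> \<in> {\<omega> \<in> space P. infdist x (A \<omega>) < c} \<longleftrightarrow>
          \<omega> \<in> (\<Union>k. \<Union>m. \<Inter>n. {\<omega> \<in> B_space H. \<exists>y\<in>tail k n (Z \<omega>). dist x y < c - 1 / real (Suc m)})"
        unfolding spaceP A_def
        by (cases "\<omega> \<in> B_space H") (simp_all add: infdist_attractor_less_iff[OF Z] del: of_nat_Suc)
    qed
    also have "\<dots> \<in> sets P"
      unfolding setsP by (intro sets.countable_UN sets.countable_INT image_subsetI openin_B_top_sets[OF H] open_tail) auto
    finally show "{\<omega> \<in> space P. infdist x (A \<omega>) < c} \<in> sets P" .
  qed
  have rcs: "random_compact_set P A"
    unfolding random_compact_set_def A_def spaceP
    using meas attractor_nonempty[OF Z] attractor_compact[OF Z]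
    by (auto simp: A_def spaceP intro!: AE_I2)
  have inv: "Phi D F \<sigma> t (\<omega>m, \<omega>p) ` A \<omega>m = A (P_op t (\<omega>m, \<omega>p))"
    if \<omega>: "\<omega>m \<in> B_space H" "\<omega>p \<in> B_space H" and t: "t \<ge> 0" for \<omega>m \<omega>p t
  proof -
    let ?\<omega> = "P_op t (\<omega>m, \<omega>p)"
    have \<omega>': "?\<omega> \<in> B_space H" by (rule P_op_in_B_space[OF H \<omega> t])
    \<comment> \<open>Invariance is applied along the glued path, whose shift by \<open>t\<close> is
      the original past.\<close>
    have "path_shift t ?\<omega> = \<omega>m"
      using \<omega> t by (intro path_shift_P_op) (auto simp: B_space_vanish)
    then have "Z \<omega>m = path_shift t (Z ?\<omega>)" using Z_shift[OF \<omega>' t] by simp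
    then show ?thesis
      unfolding A_def using attractor_invariant[OF Z[OF \<omega>'] t] Phi_flow[OF \<omega> t] by (simp del: P_op.simps)
  qed
  have attr: "((\<lambda>t. SUP x\<in>K. ennreal (infdist (phi D F \<sigma> t \<omega> x) (A \<omega>))) \<longlongrightarrow> 0) at_top"
    if K: "compact K" and \<omega>: "\<omega> \<in> B_space H" for K \<omega>
  proof (rule order_tendstoI)
    fix \<epsilon> :: ennreal assume "0 < \<epsilon>"
    then obtain e where e: "e > 0" "ennreal e < \<epsilon>" by (rule ennreal_pos_obtain_real)
    obtain M where M: "\<And>x. x \<in> K \<Longrightarrow> norm x \<le> M"
      using compact_imp_bounded[OF K] unfolding bounded_iff by blast
    have Mk: "M \<le> real (nat \<lceil>M\<rceil>)" by linarith
    from attractor_attracts[OF Z[OF \<omega>] e(1), of "nat \<lceil>M\<rceil>"] obtain n where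
      n: "\<And>t x. t \<ge> real n \<Longrightarrow> norm x \<le> real (nat \<lceil>M\<rceil>) \<Longrightarrow> infdist (flow t (Z \<omega>) x) (attractor (Z \<omega>)) < e" by blast
    have "(SUP x\<in>K. ennreal (infdist (phi D F \<sigma> t \<omega> x) (A \<omega>))) < \<epsilon>" if t: "t \<ge> real n" for t
    \<comment> \<open>Values below \<open>e\<close> only give a supremum at most \<open>e\<close>;
      strictness comes from \<open>e\<close> lying below \<epsilon>.\<close>
    proof (rule le_less_trans[OF _ e(2)], rule SUP_least, rule ennreal_leI)
      fix x assume "x \<in> K"
      then have "norm x \<le> real (nat \<lceil>M\<rceil>)" using M Mk order_trans by blast
      moreover have "t \<ge> 0" using t by (auto intro: order_trans[OF of_nat_0_le_iff])
      ultimately show "infdist (phi D F \<sigma> t \<omega> x) (A \<omega>) \<le> e"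
        using n[OF t] unfolding A_def by (simp add: phi_flow[OF \<omega>] less_imp_le)
    qed
    then show "\<forall>\<^sub>F t in at_top. (SUP x\<in>K. ennreal (infdist (phi D F \<sigma> t \<omega> x) (A \<omega>))) < \<epsilon>"
      unfolding eventually_at_top_linorder by blast
  qed auto
  have "P_pullback_attractor P (Phi D F \<sigma>) (phi D F \<sigma>) A"
    unfolding P_pullback_attractor_def spaceP
    using rcs inv attr by (auto simp: spaceP simp del: P_op.simps intro!: AE_I2)
  then show ?thesis by blast
qed

end
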